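(* Let $G$ be a second countable locally compact group and let $J\subseteq A(G)$ be a closed ideal of the Fourier algebra $A(G)$. The following are equivalent: (i) $J$ is an ideal of multiplicity; (ii) $\mathrm{Bim}(J^{\perp})$ is a bimodule of multiplicity.
   Context: $L^p(G)$ is taken with respect to a fixed left Haar measure. $C_r^*(G)\subseteq \mathcal{B}(L^2(G))$ is the reduced C*-algebra of $G$ (the operator norm closure of $\lambda(L^1(G))$, where $\lambda$ is the left regular representation) and $\mathrm{VN}(G)$ is its weak* closure. The Fourier algebra $A(G)$ consists of the functions $s\mapsto (\lambda_s\xi,\eta)$, $\xi,\eta\in L^2(G)$, and is identified with the predual of $\mathrm{VN}(G)$ via $\langle u,T\rangle=(T\xi,\eta)$ when $u(s)=(\lambda_s\xi,\eta)$. For $J\subseteq A(G)$, $J^{\perp}=\{T\in \mathrm{VN}(G) : \langle u,T\rangle=0 \text{ for all } u\in J\}$. A closed ideal $J$ of $A(G)$ is an ideal of multiplicity if $J^{\perp}\cap C_r^*(G)\neq\{0\}$. With $\mathcal{D}$ the algebra of multiplication operators $M_a$, $a\in L^\infty(G)$, on $L^2(G)$, a masa-bimodule is a subspace $\mathcal{U}\subseteq\mathcal{B}(L^2(G))$ such that $ATB\in\mathcal{U}$ whenever $T\in\mathcal{U}$ and $A,B\in\mathcal{D}$. A weak* closed masa-bimodule $\mathcal{U}$ is a bimodule of multiplicity if $\mathcal{U}\cap\mathcal{K}\neq\{0\}$, where $\mathcal{K}$ is the space of compact operators on $L^2(G)$. For a subspace $\mathcal{X}\subseteq \mathrm{VN}(G)$,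 $\mathrm{Bim}(\mathcal{X})$ is the weak* closed masa-bimodule in $\mathcal{B}(L^2(G))$ generated by $\mathcal{X}$. *)

theory Defs
  imports "HOL-Analysis.Analysis"
begin

text \<open>
  Groups are written additively, as in the library class \<open>topological_group_add\<close>; this class does
  not assume commutativity, so \<open>s + t\<close>, \<open>- s\<close> and \<open>0\<close> stand for \<open>st\<close>, \<open>s\<inverse>\<close> and \<open>e\<close>.  The class
  \<open>haar_group\<close> describes a locally compact Hausdorff group together with a fixed left Haar measure,
  i.e. a nonzero left invariant Radon measure.
\<close>

class haar_group = topological_group_add + t2_space +
  fixes haar :: "'a measure"
  assumes locally_compact: "\<exists>U K. open U \<and> compact K \<and> x \<in> U \<and> U \<subseteq> K"
    and sets_haar_sigma: "sets haar = sigma_sets UNIV {U. open U}"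
    and haar_nonzero: "emeasure haar UNIV \<noteq> 0"
    and haar_left_invariant: "A \<in> sets haar \<Longrightarrow> emeasure haar ((\<lambda>t. s + t) ` A) = emeasure haar A"
    and haar_compact_finite: "compact K \<Longrightarrow> emeasure haar K < \<infinity>"
    and haar_outer_regular:
      "A \<in> sets haar \<Longrightarrow> emeasure haar A = (INF U\<in>{U. open U \<and> A \<subseteq> U}. emeasure haar U)"
    and haar_inner_regular:
      "open U \<Longrightarrow> emeasure haar U = (SUP K\<in>{K. compact K \<and> K \<subseteq> U}. emeasure haar K)"

lemma sets_haar: "sets haar = sets borel"
  by (simp add: sets_haar_sigma borel_def)

definition square_integrable :: "('g::haar_group \<Rightarrow> complex) \<Rightarrow> bool" where
  "square_integrable f \<longleftrightarrow>
     f \<in> borel_measurable haar \<and> integrable haar (\<lambda>x. (cmod (f x))\<^sup>2)"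

definition L2_rel :: "('g::haar_group \<Rightarrow> complex) \<Rightarrow> ('g \<Rightarrow> complex) \<Rightarrow> bool" where
  "L2_rel f g \<longleftrightarrow> square_integrable f \<and> square_integrable g \<and> (AE x in haar. f x = g x)"

lemma square_integrable_zero: "square_integrable (\<lambda>_. 0)"
  by (simp add: square_integrable_def)

lemma square_integrable_add:
  assumes "square_integrable f" "square_integrable g"
  shows "square_integrable (\<lambda>x. f x + g x)"
proof -
  have m: "f \<in> borel_measurable haar" "g \<in> borel_measurable haar"
    and i: "integrable haar (\<lambda>x. 2 * (cmod (f x))\<^sup>2 + 2 * (cmod (g x))\<^sup>2)"
    using assms by (auto simp: square_integrable_def)
  have "(cmod (f x + g x))\<^sup>2 \<le> 2 * (cmod (f x))\<^sup>2 + 2 * (cmod (g x))\<^sup>2" for x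
  proof -
    have "(cmod (f x + g x))\<^sup>2 \<le> (cmod (f x) + cmod (g x))\<^sup>2"
      by (intro power_mono norm_triangle_ineq) auto
    also have "\<dots> \<le> 2 * (cmod (f x))\<^sup>2 + 2 * (cmod (g x))\<^sup>2"
      using sum_squares_bound[of "cmod (f x)" "cmod (g x)"] by (simp add: power2_sum)
    finally show ?thesis .
  qed
  then have "integrable haar (\<lambda>x. (cmod (f x + g x))\<^sup>2)"
    by (intro Bochner_Integration.integrable_bound[OF i]) (use m in auto)
  with m show ?thesis by (simp add: square_integrable_def)
qed

lemma square_integrable_mult_bounded:
  assumes a: "a \<in> borel_measurable haar" "AE x in haar. cmod (a x) \<le> C"
    and f: "square_integrable f"
  shows "square_integrable (\<lambda>x. a x * f x)"
proof -
  have m: "f \<in> borel_measurable haar" and i: "integrable haar (\<lambda>x. C\<^sup>2 * (cmod (f x))\<^sup>2)"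
    using f by (auto simp: square_integrable_def)
  have "AE x in haar. (cmod (a x * f x))\<^sup>2 \<le> C\<^sup>2 * (cmod (f x))\<^sup>2"
    using a(2)
  proof eventually_elim
    case (elim x)
    then have "(cmod (a x))\<^sup>2 \<le> C\<^sup>2"
      by (intro power_mono) auto
    then show ?case
      by (simp add: norm_mult power_mult_distrib mult_right_mono)
  qed
  then have "integrable haar (\<lambda>x. (cmod (a x * f x))\<^sup>2)"
    by (intro Bochner_Integration.integrable_bound[OF i]) (use a m in auto)
  with a m show ?thesis by (simp add: square_integrable_def)
qed

lemma square_integrable_cmult: "square_integrable f \<Longrightarrow> square_integrable (\<lambda>x. c * f x)"
  by (rule square_integrable_mult_bounded[where C = "cmod c"]) auto

lemma integrable_mult_cnj:
  assumes "square_integrable f" "square_integrable g"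
  shows "integrable haar (\<lambda>x. f x * cnj (g x))"
proof -
  have m: "f \<in> borel_measurable haar" "g \<in> borel_measurable haar"
    and i: "integrable haar (\<lambda>x. (cmod (f x))\<^sup>2 + (cmod (g x))\<^sup>2)"
    using assms by (auto simp: square_integrable_def)
  have mc: "(\<lambda>x. cnj (g x)) \<in> borel_measurable haar"
    using m(2) by (rule measurable_compose) (intro borel_measurable_continuous_onI continuous_intros)
  have "cmod (f x * cnj (g x)) \<le> (cmod (f x))\<^sup>2 + (cmod (g x))\<^sup>2" for x
  proof -
    have "0 \<le> cmod (f x) * cmod (g x)"
      by simp
    then show ?thesis
      using sum_squares_bound[of "cmod (f x)" "cmod (g x)"]
      unfolding norm_mult complex_mod_cnj mult.assoc by linarith
  qed
  then show ?thesis
    by (intro Bochner_Integration.integrable_bound[OF i]) (use m mc in auto)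
qed

quotient_type (overloaded) 'g L2 = "'g::haar_group \<Rightarrow> complex" / partial: L2_rel
proof (rule part_equivpI)
  show "\<exists>f::'g \<Rightarrow> complex. L2_rel f f"
    using square_integrable_zero by (auto simp: L2_rel_def)
  show "symp (L2_rel :: ('g \<Rightarrow> complex) \<Rightarrow> _)"
    by (rule sympI) (auto simp: L2_rel_def elim: AE_mp)
  show "transp (L2_rel :: ('g \<Rightarrow> complex) \<Rightarrow> _)"
    unfolding transp_def L2_rel_def by (auto elim: eventually_elim2)
qed

lift_definition scaleC :: "complex \<Rightarrow> 'g::haar_group L2 \<Rightarrow> 'g L2" (infixr "*\<^sub>C" 75)
  is "\<lambda>c f x. c * f x"
  by (auto simp: L2_rel_def square_integrable_cmult)

lift_definition cinner :: "'g::haar_group L2 \<Rightarrow> 'g L2 \<Rightarrow> complex"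
  is "\<lambda>f g. \<integral>x. f x * cnj (g x) \<partial>haar"
proof -
  fix f f' g g' :: "'g \<Rightarrow> complex"
  assume r: "L2_rel f f'" "L2_rel g g'"
  have "AE x in haar. f x * cnj (g x) = f' x * cnj (g' x)"
    using r unfolding L2_rel_def by (auto elim: eventually_elim2)
  then show "(\<integral>x. f x * cnj (g x) \<partial>haar) = (\<integral>x. f' x * cnj (g' x) \<partial>haar)"
    using r by (intro integral_cong_AE borel_measurable_integrable integrable_mult_cnj)
      (auto simp: L2_rel_def)
qed

text \<open>
  The library has no class of complex inner product spaces: the type is made an instance of
  \<open>real_inner\<close> through the real part of \<open>cinner\<close>, which induces the same norm, and complex
  linearity is imposed where it is needed.
\<close>

instantiation L2 :: (haar_group) real_inner
begin

lift_definition zero_L2 :: "'a L2" is "\<lambda>_. 0"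
  by (auto simp: L2_rel_def square_integrable_zero)

lift_definition plus_L2 :: "'a L2 \<Rightarrow> 'a L2 \<Rightarrow> 'a L2" is "\<lambda>f g x. f x + g x"
  unfolding L2_rel_def by (auto simp: square_integrable_add elim: eventually_elim2)

definition uminus_L2 :: "'a L2 \<Rightarrow> 'a L2" where "- \<xi> = (- 1) *\<^sub>C \<xi>"

definition minus_L2 :: "'a L2 \<Rightarrow> 'a L2 \<Rightarrow> 'a L2" where "\<xi> - \<eta> = \<xi> + - (\<eta> :: 'a L2)"

definition scaleR_L2 :: "real \<Rightarrow> 'a L2 \<Rightarrow> 'a L2" where "r *\<^sub>R \<xi> = complex_of_real r *\<^sub>C \<xi>"

definition inner_L2 :: "'a L2 \<Rightarrow> 'a L2 \<Rightarrow> real" where "inner \<xi> \<eta> = Re (cinner \<xi> \<eta>)"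

definition norm_L2 :: "'a L2 \<Rightarrow> real" where "norm \<xi> = sqrt (inner \<xi> \<xi>)" for \<xi> :: "'a L2"

definition sgn_L2 :: "'a L2 \<Rightarrow> 'a L2" where "sgn \<xi> = scaleR (inverse (norm \<xi>)) \<xi>" for \<xi> :: "'a L2"

definition dist_L2 :: "'a L2 \<Rightarrow> 'a L2 \<Rightarrow> real" where "dist \<xi> \<eta> = norm (\<xi> - \<eta>)" for \<xi> \<eta> :: "'a L2"

definition uniformity_L2 :: "('a L2 \<times> 'a L2) filter" where
  "uniformity_L2 = (INF e\<in>{0 <..}. principal {(\<xi>, \<eta>). dist \<xi> \<eta> < e})"

definition open_L2 :: "'a L2 set \<Rightarrow> bool" where
  "open_L2 U \<longleftrightarrow> (\<forall>\<xi>\<in>U. eventually (\<lambda>(\<xi>', \<eta>). \<xi>' = \<xi> \<longrightarrow> \<eta> \<in> U) uniformity)"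

instance
proof
  fix \<xi> \<eta> \<zeta> :: "'a L2" and r q :: real and U :: "'a L2 set"
  show "\<xi> + \<eta> + \<zeta> = \<xi> + (\<eta> + \<zeta>)"
    by transfer (auto simp: L2_rel_def add.assoc intro!: square_integrable_add)
  show "\<xi> + \<eta> = \<eta> + \<xi>"
    by transfer (auto simp: L2_rel_def add.commute intro!: square_integrable_add)
  show "0 + \<xi> = \<xi>"
    by transfer (auto simp: L2_rel_def)
  show "- \<xi> + \<xi> = 0"
    unfolding uminus_L2_def
    by transfer (use square_integrable_zero in \<open>auto simp: L2_rel_def\<close>)
  show "\<xi> - \<eta> = \<xi> + - \<eta>"
    by (rule minus_L2_def)
  show "r *\<^sub>R (\<xi> + \<eta>) = r *\<^sub>R \<xi> + r *\<^sub>R \<eta>"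
    unfolding scaleR_L2_def
    by transfer (auto simp: L2_rel_def distrib_left intro!: square_integrable_add square_integrable_cmult)
  show "(r + q) *\<^sub>R \<xi> = r *\<^sub>R \<xi> + q *\<^sub>R \<xi>"
    unfolding scaleR_L2_def
    by transfer (auto simp: L2_rel_def distrib_right intro!: square_integrable_add square_integrable_cmult)
  show "r *\<^sub>R q *\<^sub>R \<xi> = (r * q) *\<^sub>R \<xi>"
    unfolding scaleR_L2_def
    by transfer (use square_integrable_cmult in \<open>auto simp: L2_rel_def mult.assoc\<close>)
  show "1 *\<^sub>R \<xi> = \<xi>"
    unfolding scaleR_L2_def by transfer (auto simp: L2_rel_def)
  show "sgn \<xi> = scaleR (inverse (norm \<xi>)) \<xi>"
    by (rule sgn_L2_def)
  show "dist \<xi> \<eta> = norm (\<xi> - \<eta>)"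
    by (rule dist_L2_def)
  show "(uniformity :: ('a L2 \<times> 'a L2) filter) = (INF e\<in>{0 <..}. principal {(\<xi>, \<eta>). dist \<xi> \<eta> < e})"
    by (rule uniformity_L2_def)
  show "open U \<longleftrightarrow> (\<forall>\<xi>\<in>U. eventually (\<lambda>(\<xi>', \<eta>). \<xi>' = \<xi> \<longrightarrow> \<eta> \<in> U) uniformity)"
    by (rule open_L2_def)
  show "inner \<xi> \<eta> = inner \<eta> \<xi>"
    unfolding inner_L2_def
  proof transfer
    fix f g :: "'a \<Rightarrow> complex"
    assume r: "L2_rel f f" "L2_rel g g"
    have "(\<integral>x. g x * cnj (f x) \<partial>haar) = (\<integral>x. cnj (f x * cnj (g x)) \<partial>haar)"
      by (simp add: mult.commute)
    also have "\<dots> = cnj (\<integral>x. f x * cnj (g x) \<partial>haar)"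
      by (rule Bochner_Integration.integral_cnj)
    finally show "Re (\<integral>x. f x * cnj (g x) \<partial>haar) = Re (\<integral>x. g x * cnj (f x) \<partial>haar)"
      by simp
  qed
  show "inner (\<xi> + \<eta>) \<zeta> = inner \<xi> \<zeta> + inner \<eta> \<zeta>"
    unfolding inner_L2_def
    by transfer (auto simp: L2_rel_def distrib_right integrable_mult_cnj)
  show "inner (r *\<^sub>R \<xi>) \<eta> = r * inner \<xi> \<eta>"
    unfolding inner_L2_def scaleR_L2_def
    by transfer (auto simp: L2_rel_def mult.assoc)
  have sq: "Re (\<integral>x. f x * cnj (f x) \<partial>haar) = (\<integral>x. (cmod (f x))\<^sup>2 \<partial>haar)"
    if "L2_rel f f" for f :: "'a \<Rightarrow> complex"
    by (simp add: complex_norm_square[symmetric] flip: of_real_power)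
  show "0 \<le> inner \<xi> \<xi>"
    unfolding inner_L2_def by transfer (simp add: sq)
  show "inner \<xi> \<xi> = 0 \<longleftrightarrow> \<xi> = 0"
    unfolding inner_L2_def
  proof transfer
    fix f :: "'a \<Rightarrow> complex"
    assume r: "L2_rel f f"
    then have "(\<integral>x. (cmod (f x))\<^sup>2 \<partial>haar) = 0 \<longleftrightarrow> (AE x in haar. (cmod (f x))\<^sup>2 = 0)"
      by (intro integral_nonneg_eq_0_iff_AE) (auto simp: L2_rel_def square_integrable_def)
    then show "Re (\<integral>x. f x * cnj (f x) \<partial>haar) = 0 \<longleftrightarrow> L2_rel f (\<lambda>_. 0)"
      using r square_integrable_zero by (auto simp: sq L2_rel_def)
  qed
  show "norm \<xi> = sqrt (inner \<xi> \<xi>)"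
    by (rule norm_L2_def)
qed

end

lemma bounded_linear_scaleC: "bounded_linear (scaleC c :: 'g::haar_group L2 \<Rightarrow> 'g L2)"
proof (rule bounded_linear_intro[where K = "cmod c"])
  fix \<xi> \<eta> :: "'g L2" and r :: real
  show "c *\<^sub>C (\<xi> + \<eta>) = c *\<^sub>C \<xi> + c *\<^sub>C \<eta>"
    by transfer (auto simp: L2_rel_def distrib_left intro!: square_integrable_add square_integrable_cmult)
  show "c *\<^sub>C (r *\<^sub>R \<xi>) = r *\<^sub>R (c *\<^sub>C \<xi>)"
    unfolding scaleR_L2_def
    by transfer (use square_integrable_cmult in \<open>auto simp: L2_rel_def mult.left_commute\<close>)
  have "inner (c *\<^sub>C \<xi>) (c *\<^sub>C \<xi>) = (cmod c)\<^sup>2 * inner \<xi> \<xi>"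
    unfolding inner_L2_def
  proof transfer
    fix c :: complex and f :: "'g \<Rightarrow> complex"
    have "(\<integral>x. c * f x * cnj (c * f x) \<partial>haar) = (\<integral>x. (c * cnj c) * (f x * cnj (f x)) \<partial>haar)"
      by (simp add: mult_ac)
    also have "\<dots> = complex_of_real ((cmod c)\<^sup>2) * (\<integral>x. f x * cnj (f x) \<partial>haar)"
      by (simp only: complex_norm_square integral_mult_right_zero)
    finally show "Re (\<integral>x. c * f x * cnj (c * f x) \<partial>haar) = (cmod c)\<^sup>2 * Re (\<integral>x. f x * cnj (f x) \<partial>haar)"
      by simp
  qed
  then show "norm (c *\<^sub>C \<xi>) \<le> norm \<xi> * cmod c"
    by (simp add: norm_eq_sqrt_inner real_sqrt_mult)
qed

type_synonym 'g op = "'g L2 \<Rightarrow>\<^sub>L 'g L2"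

text \<open>The elements of \<open>'g op\<close> are only real linear.\<close>

definition bounded_operators :: "'g::haar_group op set" where
  "bounded_operators = {T :: 'g op. \<forall>c \<xi>. T (c *\<^sub>C \<xi>) = c *\<^sub>C T \<xi>}"

definition scaleC_op :: "complex \<Rightarrow> 'g::haar_group op \<Rightarrow> 'g op" where
  "scaleC_op c T = Blinfun (scaleC c) o\<^sub>L T"

lemma scaleC_op_apply: "scaleC_op c T \<xi> = c *\<^sub>C T \<xi>"
  by (simp add: scaleC_op_def bounded_linear_Blinfun_apply bounded_linear_scaleC)

definition compact_operators :: "'g::haar_group op set" where
  "compact_operators = {T :: 'g op. T \<in> bounded_operators \<and> compact (closure (T ` ball 0 1))}"

text \<open>The functionals given by trace class operators under the duality between trace class
  and bounded operators.\<close>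

definition normal_functional :: "('g::haar_group op \<Rightarrow> complex) \<Rightarrow> bool" where
  "normal_functional \<phi> \<longleftrightarrow>
     (\<exists>\<xi> \<eta> :: nat \<Rightarrow> 'g L2.
        summable (\<lambda>n. (norm (\<xi> n))\<^sup>2) \<and> summable (\<lambda>n. (norm (\<eta> n))\<^sup>2) \<and>
        \<phi> = (\<lambda>T :: 'g op. \<Sum>n. cinner (T (\<xi> n)) (\<eta> n)))"

definition weak_star :: "'g::haar_group op topology" where
  "weak_star = topology_generated_by
     {{T \<in> bounded_operators. \<phi> T \<in> U} |\<phi> U. normal_functional \<phi> \<and> open U}"

lemma haar_distr_translate: "distr haar haar (\<lambda>t. s + t) = (haar :: 'g::haar_group measure)"
proof (rule measure_eqI)
  fix A :: "'g set"
  assume "A \<in> sets (distr haar haar (\<lambda>t. s + t))"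
  then have A: "A \<in> sets borel"
    by (simp add: sets_haar)
  have sp: "space haar = (UNIV :: 'g set)"
    using sets_eq_imp_space_eq[OF sets_haar] by simp
  have m: "(\<lambda>t. s + t) \<in> measurable haar (haar :: 'g measure)"
    unfolding measurable_cong_sets[OF sets_haar sets_haar]
    by (intro borel_measurable_continuous_onI continuous_intros)
  have "(\<lambda>t. s + t) -` A = (\<lambda>t. - s + t) ` A"
  proof (intro equalityI subsetI)
    fix t assume "t \<in> (\<lambda>t. s + t) -` A"
    then show "t \<in> (\<lambda>t. - s + t) ` A"
      by (intro image_eqI[of _ _ "s + t"]) (auto simp: add.assoc[symmetric])
  qed (auto simp: add.assoc[symmetric])
  then show "emeasure (distr haar haar (\<lambda>t. s + t)) A = emeasure haar A"
    using A m by (simp add: emeasure_distr sets_haar sp haar_left_invariant)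
qed simp

lift_definition left_translation :: "'g::haar_group \<Rightarrow> 'g L2 \<Rightarrow> 'g L2"
  is "\<lambda>s f t. f (- s + t)"
proof -
  fix s :: 'g and f g :: "'g \<Rightarrow> complex"
  assume r: "L2_rel f g"
  have m: "(\<lambda>t. - s + t) \<in> measurable haar (haar :: 'g measure)"
    unfolding measurable_cong_sets[OF sets_haar sets_haar]
    by (intro borel_measurable_continuous_onI continuous_intros)
  have sq: "square_integrable (\<lambda>t. h (- s + t))" if "square_integrable h" for h :: "'g \<Rightarrow> complex"
  proof -
    have "integrable (distr haar haar (\<lambda>t. - s + t)) (\<lambda>x. (cmod (h x))\<^sup>2)"
      using that unfolding haar_distr_translate by (simp add: square_integrable_def)
    then have "integrable haar (\<lambda>t. (cmod (h (- s + t)))\<^sup>2)"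
      by (rule integrable_distr[OF m])
    then show ?thesis
      using that measurable_compose[OF m, of h] by (simp add: square_integrable_def)
  qed
  have "AE x in distr haar haar (\<lambda>t. - s + t). f x = g x"
    using r unfolding haar_distr_translate by (simp add: L2_rel_def)
  then have "AE t in haar. f (- s + t) = g (- s + t)"
    by (rule AE_distrD[OF m])
  with r sq show "L2_rel (\<lambda>t. f (- s + t)) (\<lambda>t. g (- s + t))"
    by (simp add: L2_rel_def)
qed

text \<open>\<open>\<lambda>(f)\<close>, \<open>f \<in> L\<^sup>1(G)\<close>, is the operator determined by the weak integral
  \<open>(\<lambda>(f)\<xi>, \<eta>) = \<integral> f(s) (\<lambda>\<^sub>s\<xi>, \<eta>) ds\<close>.\<close>

definition L1_operators :: "'g::haar_group op set" where
  "L1_operators =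
     {T :: 'g op. T \<in> bounded_operators \<and> (\<exists>f :: 'g \<Rightarrow> complex. integrable haar f \<and>
        (\<forall>\<xi> \<eta>. cinner (T \<xi>) \<eta> = (\<integral>s. f s * cinner (left_translation s \<xi>) \<eta> \<partial>haar)))}"

definition reduced_Cstar :: "'g::haar_group op set" where
  "reduced_Cstar = closure L1_operators"

definition VN :: "'g::haar_group op set" where
  "VN = weak_star closure_of reduced_Cstar"

definition coefficient :: "'g::haar_group L2 \<Rightarrow> 'g L2 \<Rightarrow> 'g \<Rightarrow> complex" where
  "coefficient \<xi> \<eta> = (\<lambda>s. cinner (left_translation s \<xi>) \<eta>)"

definition fourier_algebra :: "('g::haar_group \<Rightarrow> complex) set" where
  "fourier_algebra = {coefficient \<xi> \<eta> |\<xi> \<eta>. True}"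

text \<open>For \<open>u\<close> in the Fourier algebra and \<open>T\<close> in \<open>VN\<close>, the value \<open>(T\<xi>, \<eta>)\<close> does not depend on the
  choice of \<open>\<xi>\<close> and \<open>\<eta>\<close> with \<open>u = coefficient \<xi> \<eta>\<close>.\<close>

definition fourier_pairing :: "('g::haar_group \<Rightarrow> complex) \<Rightarrow> 'g op \<Rightarrow> complex" where
  "fourier_pairing u T = (THE c. \<exists>\<xi> \<eta>. u = coefficient \<xi> \<eta> \<and> c = cinner (T \<xi>) \<eta>)"

text \<open>The norm of the Fourier algebra as the predual of \<open>VN\<close>.\<close>

definition fourier_norm :: "('g::haar_group \<Rightarrow> complex) \<Rightarrow> real" where
  "fourier_norm u = (SUP T\<in>{T \<in> VN. norm T \<le> 1}. cmod (fourier_pairing u T))"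

definition closed_ideal :: "('g::haar_group \<Rightarrow> complex) set \<Rightarrow> bool" where
  "closed_ideal J \<longleftrightarrow>
     J \<subseteq> fourier_algebra \<and>
     (\<lambda>_. 0) \<in> J \<and>
     (\<forall>u\<in>J. \<forall>v\<in>J. (\<lambda>s. u s + v s) \<in> J) \<and>
     (\<forall>c. \<forall>u\<in>J. (\<lambda>s. c * u s) \<in> J) \<and>
     (\<forall>u\<in>J. \<forall>v\<in>fourier_algebra. (\<lambda>s. v s * u s) \<in> J) \<and>
     (\<forall>u\<in>fourier_algebra. (\<forall>e>0. \<exists>v\<in>J. fourier_norm (\<lambda>s. u s - v s) < e) \<longrightarrow> u \<in> J)"

definition annihilator :: "('g::haar_group \<Rightarrow> complex) set \<Rightarrow> 'g op set" where
  "annihilator J = {T \<in> VN. \<forall>u\<in>J. fourier_pairing u T = 0}"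

definition ideal_of_multiplicity :: "('g::haar_group \<Rightarrow> complex) set \<Rightarrow> bool" where
  "ideal_of_multiplicity J \<longleftrightarrow> closed_ideal J \<and> annihilator J \<inter> reduced_Cstar \<noteq> {0}"

definition essentially_bounded :: "('g::haar_group \<Rightarrow> complex) \<Rightarrow> bool" where
  "essentially_bounded a \<longleftrightarrow>
     a \<in> borel_measurable haar \<and> (\<exists>C. AE x in haar. cmod (a x) \<le> C)"

text \<open>The value for functions \<open>a\<close> that are not essentially bounded is a dummy.\<close>

lift_definition multiplication :: "('g::haar_group \<Rightarrow> complex) \<Rightarrow> 'g L2 \<Rightarrow> 'g L2"
  is "\<lambda>a f. if essentially_bounded a then (\<lambda>x. a x * f x) else (\<lambda>_. 0)"
proof -
  fix a f g :: "'g \<Rightarrow> complex"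
  assume r: "L2_rel f g"
  show "L2_rel (if essentially_bounded a then (\<lambda>x. a x * f x) else (\<lambda>_. 0))
      (if essentially_bounded a then (\<lambda>x. a x * g x) else (\<lambda>_. 0))"
  proof (cases "essentially_bounded a")
    case True
    then obtain C where C: "a \<in> borel_measurable haar" "AE x in haar. cmod (a x) \<le> C"
      by (auto simp: essentially_bounded_def)
    have "AE x in haar. a x * f x = a x * g x"
      using r unfolding L2_rel_def by (auto elim: eventually_mono)
    then show ?thesis
      using r True square_integrable_mult_bounded[OF C] by (simp add: L2_rel_def)
  next
    case False
    then show ?thesis
      using square_integrable_zero by (simp add: L2_rel_def)
  qed
qed

definition multiplication_masa :: "'g::haar_group op set" where
  "multiplication_masa = {A. \<exists>a. essentially_bounded a \<and> blinfun_apply A = multiplication a}"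

definition masa_bimodule :: "'g::haar_group op set \<Rightarrow> bool" where
  "masa_bimodule \<U> \<longleftrightarrow>
     \<U> \<subseteq> bounded_operators \<and>
     0 \<in> \<U> \<and>
     (\<forall>S\<in>\<U>. \<forall>T\<in>\<U>. S + T \<in> \<U>) \<and>
     (\<forall>c. \<forall>T\<in>\<U>. scaleC_op c T \<in> \<U>) \<and>
     (\<forall>T\<in>\<U>. \<forall>A\<in>multiplication_masa. \<forall>B\<in>multiplication_masa. A o\<^sub>L T o\<^sub>L B \<in> \<U>)"

definition Bim :: "'g::haar_group op set \<Rightarrow> 'g op set" where
  "Bim \<X> = \<Inter> {\<U>. masa_bimodule \<U> \<and> closedin weak_star \<U> \<and> \<X> \<subseteq> \<U>}"

definition bimodule_of_multiplicity :: "'g::haar_group op set \<Rightarrow> bool" where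
  "bimodule_of_multiplicity \<U> \<longleftrightarrow>
     masa_bimodule \<U> \<and> closedin weak_star \<U> \<and> \<U> \<inter> compact_operators \<noteq> {0}"

end

theory Submission
  imports Defs
begin

text \<open>
  Everything rests on averaging an operator \<open>K\<close> over right translations:
  \<open>(E a, b) = \<integral> (K (\<rho>\<^sub>t a \<cdot> x), \<rho>\<^sub>t b \<cdot> y) dt\<close> for fixed \<open>x\<close>, \<open>y\<close>, which is Schur multiplication by
  \<open>(s, t) \<mapsto> u(st\<inverse>)\<close>, \<open>u = coefficient a b\<close>.  Expanding along a Parseval frame turns the integral into
  a series of vector functionals, so the form is weak* continuous in \<open>K\<close> without any appeal to trace
  class operators.  On \<open>VN\<close> it is the pairing with \<open>u \<cdot> coefficient x y\<close>; hence for \<open>u \<in> J\<close> it vanishes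
  on the annihilator of \<open>J\<close>, and then on the whole bimodule.  If \<open>K\<close> has rank one, then \<open>E\<close> is given by an
  \<open>L\<^sup>1\<close> function, so \<open>E\<close> lies in the reduced C*-algebra for compact \<open>K\<close>, and choosing \<open>u\<close> locally constant
  makes \<open>E\<close> nonzero.  Conversely, compressing an element of the reduced C*-algebra to sets of finite
  measure on which the modular function is bounded gives a limit of operators with square integrable
  kernels.
\<close>

section \<open>The Hilbert space of square integrable functions\<close>

text \<open>The four vectors of the form have two readings. With \<open>a\<close>, \<open>b\<close>
  fixed, it evaluates the Schur multiple of \<open>K\<close> at the test vectors \<open>x\<close>,
  \<open>y\<close>; the masa acts there, since multiplications commute with the frame functions and
  slide onto \<open>x\<close> and \<open>y\<close>. With \<open>x\<close>, \<open>y\<close> fixed,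
  it is the form of \<open>E\<close> in \<open>a\<close>, \<open>b\<close>, and for \<open>K\<close>
  = \<lambda>(f) this is \<lambda>(fv) with v = \<open>coefficient x y\<close>. One vanishing
  statement thus serves both the minimality of \<open>Bim\<close> and the pairing of
  \<open>E\<close> with \<open>J\<close>. The series comes from writing u(st\<inverse>) as the inner
  product of \<open>left_translation (- t) a\<close> and \<open>left_translation (- s) b\<close>:
  the frame coefficients of such translates are bounded functions of the group variable, square
  summable at each point. Kernels are at hand only for finite rank operators and for \<lambda>(f),
  so statements on compact operators and on the reduced C*-algebra pass through norm closures. The
  modular function enters only as a measurable Radon-Nikodym density; its bound is therefore
  obtained by cutting a set down to where the density is at most m.\<close>

declare sets_haar [measurable_cong]

lemma space_haar [simp]: "space haar = UNIV"
  using sets_eq_imp_space_eq[OF sets_haar] by simp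

lemma square_integrable_rep [simp]: "square_integrable (rep_L2 x)"
  using Quotient_rep_reflp[OF Quotient_L2, of x] by (simp add: L2_rel_def)

lemma measurable_rep_L2 [measurable]: "rep_L2 x \<in> borel_measurable haar"
  using square_integrable_rep square_integrable_def by blast

lemma abs_rep_L2 [simp]: "abs_L2 (rep_L2 x) = x"
  by (rule Quotient_abs_rep[OF Quotient_L2])

lemma AE_rep_abs_L2: "square_integrable f \<Longrightarrow> AE t in haar. rep_L2 (abs_L2 f) t = f t"
  using Quotient_rep_abs[OF Quotient_L2, of f] by (simp add: L2_rel_def)

lemma L2_eqI: "(AE t in haar. rep_L2 x t = rep_L2 y t) \<Longrightarrow> x = y"
  using Quotient_rel_rep[OF Quotient_L2, of x y] by (simp add: L2_rel_def)

lemma AE_rep_eq_of_L2_rel: "L2_rel f f \<Longrightarrow> x = abs_L2 f \<Longrightarrow> AE t in haar. rep_L2 x t = f t"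
  by (simp add: AE_rep_abs_L2 L2_rel_def)

lemma AE_rep_plus: "AE t in haar. rep_L2 (x + y) t = rep_L2 x t + rep_L2 y t"
  by (rule AE_rep_eq_of_L2_rel)
    (auto simp: L2_rel_def square_integrable_add plus_L2.abs_eq[symmetric])

lemma AE_rep_scaleC: "AE t in haar. rep_L2 (c *\<^sub>C x) t = c * rep_L2 x t"
  by (rule AE_rep_eq_of_L2_rel)
    (auto simp: L2_rel_def square_integrable_cmult scaleC.abs_eq[symmetric])

lemma AE_rep_left_translation: "AE t in haar. rep_L2 (left_translation s x) t = rep_L2 x (- s + t)"
proof -
  have "L2_rel (rep_L2 x) (rep_L2 x)" by (simp add: L2_rel_def)
  note left_translation.abs_eq[OF this, of s] left_translation.rsp
  moreover have "L2_rel (\<lambda>t. rep_L2 x (- s + t)) (\<lambda>t. rep_L2 x (- s + t))"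
    using left_translation.rsp[unfolded rel_fun_def, rule_format, OF refl \<open>L2_rel (rep_L2 x) (rep_L2 x)\<close>] .
  ultimately show ?thesis by (intro AE_rep_eq_of_L2_rel) auto
qed

lemma AE_rep_multiplication:
  assumes "essentially_bounded a"
  shows "AE t in haar. rep_L2 (multiplication a x) t = a t * rep_L2 x t"
proof -
  have "L2_rel (rep_L2 x) (rep_L2 x)" by (simp add: L2_rel_def)
  note multiplication.abs_eq[OF this, of a]
  moreover have "L2_rel (\<lambda>t. a t * rep_L2 x t) (\<lambda>t. a t * rep_L2 x t)"
    using multiplication.rsp[unfolded rel_fun_def, rule_format, OF refl \<open>L2_rel (rep_L2 x) (rep_L2 x)\<close>, of a]
      assms by simp
  ultimately show ?thesis using assms by (intro AE_rep_eq_of_L2_rel) auto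
qed

lemma cinner_eq_integral: "cinner x y = (\<integral>t. rep_L2 x t * cnj (rep_L2 y t) \<partial>haar)"
  using cinner.abs_eq[of "rep_L2 x" "rep_L2 y"] by (simp add: L2_rel_def)

lemma integrable_rep_cnj [simp]: "integrable haar (\<lambda>t. rep_L2 x t * cnj (rep_L2 y t))"
  by (rule integrable_mult_cnj) auto

lemma measurable_cnj [measurable]: "f \<in> borel_measurable M \<Longrightarrow> (\<lambda>x. cnj (f x)) \<in> borel_measurable M"
  by (erule measurable_compose) (intro borel_measurable_continuous_onI continuous_intros)

text \<open>Vectors come with chosen representatives, on which the operations are known only almost
  everywhere. This allows an inner product to be computed from any measurable functions agreeing
  with the representatives almost everywhere.\<close>

lemma cinner_eq_integral_AE:
  assumes "AE t in haar. rep_L2 x t = f t" "AE t in haar. rep_L2 y t = g t"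
    and [measurable]: "f \<in> borel_measurable haar" "g \<in> borel_measurable haar"
  shows "cinner x y = (\<integral>t. f t * cnj (g t) \<partial>haar)" "integrable haar (\<lambda>t. f t * cnj (g t))"
proof -
  have ae: "AE t in haar. rep_L2 x t * cnj (rep_L2 y t) = f t * cnj (g t)"
    using assms(1,2) by eventually_elim simp
  show "cinner x y = (\<integral>t. f t * cnj (g t) \<partial>haar)"
    unfolding cinner_eq_integral by (rule integral_cong_AE) (use ae in auto)
  show "integrable haar (\<lambda>t. f t * cnj (g t))"
    using integrable_cong_AE[OF _ _ ae] by auto
qed

lemma cinner_commute: "cinner y x = cnj (cinner x y)"
  unfolding cinner_eq_integral by (simp add: mult.commute flip: Bochner_Integration.integral_cnj)

lemma cinner_add_left: "cinner (x + y) z = cinner x z + cinner y z"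
  by (subst cinner_eq_integral_AE[OF AE_rep_plus AE_I2[OF refl]])
    (auto simp: cinner_eq_integral distrib_right)

lemma cinner_scaleC_left [simp]: "cinner (c *\<^sub>C x) y = c * cinner x y"
  by (subst cinner_eq_integral_AE[OF AE_rep_scaleC AE_I2[OF refl]])
    (auto simp: cinner_eq_integral mult.assoc)

lemma cinner_scaleC_right [simp]: "cinner x (c *\<^sub>C y) = cnj c * cinner x y"
  by (metis cinner_commute cinner_scaleC_left complex_cnj_mult complex_cnj_cnj)

lemma cinner_add_right: "cinner x (y + z) = cinner x y + cinner x z"
  by (metis cinner_commute cinner_add_left complex_cnj_add)

lemma uminus_eq_scaleC: "- x = (- 1) *\<^sub>C x" for x :: "'g::haar_group L2"
  by (rule uminus_L2_def)

lemma cinner_minus_left [simp]: "cinner (- x) y = - cinner x y"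
  by (simp add: uminus_eq_scaleC)

lemma cinner_minus_right [simp]: "cinner x (- y) = - cinner x y"
  by (simp add: uminus_eq_scaleC)

lemma cinner_diff_left: "cinner (x - y) z = cinner x z - cinner y z"
  using cinner_add_left[of x "- y" z] by simp

lemma cinner_diff_right: "cinner x (y - z) = cinner x y - cinner x z"
  using cinner_add_right[of x y "- z"] by simp

lemma cinner_zero_left [simp]: "cinner 0 x = 0"
  using cinner_add_left[of 0 0 x] by simp

lemma cinner_zero_right [simp]: "cinner x 0 = 0"
  using cinner_add_right[of x 0 0] by simp

lemma cinner_scaleR_left [simp]: "cinner (r *\<^sub>R x) y = of_real r * cinner x y"
  by (simp add: scaleR_L2_def)

lemma cinner_scaleR_right [simp]: "cinner x (r *\<^sub>R y) = of_real r * cinner x y"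
  by (simp add: scaleR_L2_def)

lemma cinner_sum_left: "cinner (sum f A) y = (\<Sum>i\<in>A. cinner (f i) y)"
  by (induction A rule: infinite_finite_induct) (auto simp: cinner_add_left)

lemma cinner_sum_right: "cinner x (sum f A) = (\<Sum>i\<in>A. cinner x (f i))"
  by (induction A rule: infinite_finite_induct) (auto simp: cinner_add_right)

text \<open>By conjugate linearity in the second argument, the imaginary part is the real part taken
  at \<open>\<i> *\<^sub>C y\<close>. This is how statements about the real inner product become
  complex ones.\<close>

lemma cinner_eq_inner: "cinner x y = Complex (inner x y) (inner x (\<i> *\<^sub>C y))"
  by (simp add: inner_L2_def complex_eq_iff)

lemma cinner_self: "cinner x x = of_real ((norm x)\<^sup>2)"
  using cinner_commute[of x x]
  by (simp add: complex_eq_iff power2_norm_eq_inner inner_L2_def)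

lemma norm_scaleC [simp]: "norm (c *\<^sub>C x) = cmod c * norm x"
proof -
  have "complex_of_real ((norm (c *\<^sub>C x))\<^sup>2) = of_real ((cmod c * norm x)\<^sup>2)"
    unfolding power_mult_distrib of_real_mult complex_norm_square cinner_self[symmetric]
    by simp
  then have "(norm (c *\<^sub>C x))\<^sup>2 = (cmod c * norm x)\<^sup>2"
    using of_real_eq_iff by blast
  then show ?thesis by (simp add: power2_eq_iff_nonneg)
qed

lemma norm_cinner_le: "cmod (cinner x y) \<le> norm x * norm y"
proof (cases "cinner x y = 0")
  case False
  \<comment> \<open>A unimodular factor rotating \<open>cinner x y\<close> onto the positive real
    axis, which reduces the claim to the real Cauchy-Schwarz inequality.\<close>
  define c where "c = cnj (sgn (cinner x y))"
  have "c * cinner x y = of_real (cmod (cinner x y))"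
    by (simp add: c_def sgn_div_norm scaleR_conv_of_real complex_norm_square[symmetric] False
        power2_eq_square divide_simps mult.commute flip: of_real_mult)
  then have "cmod (cinner x y) = inner (c *\<^sub>C x) y"
    by (simp add: inner_L2_def)
  also have "\<dots> \<le> norm (c *\<^sub>C x) * norm y"
    by (rule norm_cauchy_schwarz)
  also have "\<dots> = norm x * norm y"
    by (simp add: c_def norm_sgn False)
  finally show ?thesis .
qed simp

lemma cinner_ext: "(\<And>y. cinner x y = cinner x' y) \<Longrightarrow> x = x'"
  by (metis cinner_diff_left cinner_self eq_iff_diff_eq_0 norm_eq_zero of_real_eq_0_iff power2_eq_square
      mult_eq_0_iff)

lemma bounded_bilinear_cinner: "bounded_bilinear (cinner :: 'g::haar_group L2 \<Rightarrow> _)"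
  by (standard; (rule exI[of _ 1])?) 
    (auto simp: cinner_add_left cinner_add_right norm_cinner_le scaleR_conv_of_real)

lemmas bounded_linear_cinner_left = bounded_bilinear.bounded_linear_left[OF bounded_bilinear_cinner]

lemma scaleC_add_right: "c *\<^sub>C (x + y) = c *\<^sub>C x + c *\<^sub>C y"
  by (rule cinner_ext) (simp add: cinner_add_left distrib_left)

lemma scaleC_scaleC [simp]: "c *\<^sub>C d *\<^sub>C x = (c * d) *\<^sub>C x"
  by (rule cinner_ext) simp

lemma scaleC_zero_right [simp]: "c *\<^sub>C 0 = 0"
  by (rule cinner_ext) simp

lemma scaleC_add_left: "(c + d) *\<^sub>C x = c *\<^sub>C x + d *\<^sub>C x"
  by (rule cinner_ext) (simp add: cinner_add_left distrib_right)

lemma norm_power2_eq_integral: "(norm x)\<^sup>2 = (\<integral>t. (cmod (rep_L2 x t))\<^sup>2 \<partial>haar)"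
proof -
  have "complex_of_real ((norm x)\<^sup>2) = of_real (\<integral>t. (cmod (rep_L2 x t))\<^sup>2 \<partial>haar)"
    unfolding cinner_self[symmetric] cinner_eq_integral
    by (simp add: complex_norm_square[symmetric] flip: of_real_power)
  then show ?thesis using of_real_eq_iff by blast
qed

lemma integrable_norm_rep_power2 [simp]: "integrable haar (\<lambda>t. (cmod (rep_L2 x t))\<^sup>2)"
  using square_integrable_rep[of x] unfolding square_integrable_def by blast

section \<open>Left invariance of the measure and the regular representation\<close>

lemma measurable_translate [measurable]: "(\<lambda>t. s + t) \<in> measurable haar (haar :: 'g::haar_group measure)"
  by (auto intro!: borel_measurable_continuous_onI continuous_intros
        simp: measurable_cong_sets[OF sets_haar sets_haar])

lemma AE_haar_translate:
  fixes P :: "'g::haar_group \<Rightarrow> bool"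
  assumes "AE t in haar. P t"
  shows "AE t in haar. P (s + t)"
proof -
  have "AE t in distr haar haar (\<lambda>t. s + t). P t"
    unfolding haar_distr_translate by (rule assms)
  then show ?thesis by (rule AE_distrD[OF measurable_translate])
qed

lemma integral_haar_translate:
  fixes f :: "'g::haar_group \<Rightarrow> complex"
  assumes [measurable]: "f \<in> borel_measurable haar"
  shows "(\<integral>t. f (s + t) \<partial>haar) = (\<integral>t. f t \<partial>haar)"
  by (subst (2) haar_distr_translate[of s, symmetric]) (simp add: integral_distr)

lemma nn_integral_haar_translate:
  fixes f :: "'g::haar_group \<Rightarrow> ennreal"
  assumes [measurable]: "f \<in> borel_measurable haar"
  shows "(\<integral>\<^sup>+t. f (s + t) \<partial>haar) = (\<integral>\<^sup>+t. f t \<partial>haar)"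
  by (subst (2) haar_distr_translate[of s, symmetric]) (simp add: nn_integral_distr)

lemma cinner_left_translation:
  "cinner (left_translation s x) y = (\<integral>t. rep_L2 x (- s + t) * cnj (rep_L2 y t) \<partial>haar)"
  and integrable_left_translation_cnj:
  "integrable haar (\<lambda>t. rep_L2 x (- s + t) * cnj (rep_L2 y t))"
  by (rule cinner_eq_integral_AE[OF AE_rep_left_translation AE_I2[OF refl]]; simp)+

lemma left_translation_add: "left_translation s (x + y) = left_translation s x + left_translation s y"
  by (rule L2_eqI) (use AE_rep_left_translation[of s "x + y"] AE_rep_left_translation[of s x]
    AE_rep_left_translation[of s y] AE_rep_plus[of "left_translation s x" "left_translation s y"]
    AE_haar_translate[OF AE_rep_plus[of x y], of "- s"] in eventually_elim, simp)

lemma left_translation_scaleC: "left_translation s (c *\<^sub>C x) = c *\<^sub>C left_translation s x"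
  by (rule L2_eqI) (use AE_rep_left_translation[of s "c *\<^sub>C x"] AE_rep_left_translation[of s x]
    AE_rep_scaleC[of c "left_translation s x"]
    AE_haar_translate[OF AE_rep_scaleC[of c x], of "- s"] in eventually_elim, simp)

lemma left_translation_left_translation:
  "left_translation s (left_translation t x) = left_translation (s + t) x"
  by (rule L2_eqI) (use AE_rep_left_translation[of s "left_translation t x"]
    AE_rep_left_translation[of "s + t" x]
    AE_haar_translate[OF AE_rep_left_translation[of t x], of "- s"]
    in eventually_elim, simp add: minus_add add.assoc del: add_uminus_conv_diff)

lemma cinner_left_translation_both [simp]:
  "cinner (left_translation s x) (left_translation s y) = cinner x y"
proof -
  have "cinner (left_translation s x) (left_translation s y)
      = (\<integral>t. rep_L2 x (- s + t) * cnj (rep_L2 y (- s + t)) \<partial>haar)"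
    by (rule cinner_eq_integral_AE(1)[OF AE_rep_left_translation AE_rep_left_translation]) auto
  also have "\<dots> = cinner x y"
    using integral_haar_translate[of "\<lambda>t. rep_L2 x t * cnj (rep_L2 y t)" "- s"]
    by (simp add: cinner_eq_integral)
  finally show ?thesis .
qed

lemma norm_left_translation [simp]: "norm (left_translation s x) = norm x"
  by (metis cinner_left_translation_both norm_eq_sqrt_inner inner_L2_def)

section \<open>Multiplication operators\<close>

lemma multiplication_add: "multiplication a (x + y) = multiplication a x + multiplication a y"
proof (cases "essentially_bounded a")
  case True
  show ?thesis
    by (rule L2_eqI) (use AE_rep_multiplication[OF True, of "x + y"] AE_rep_multiplication[OF True, of x]
    AE_rep_multiplication[OF True, of y] AE_rep_plus[of "multiplication a x" "multiplication a y"]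
    AE_rep_plus[of x y] in eventually_elim, simp add: distrib_left)
next
  case False
  then have "multiplication a x = 0" for x
    by transfer (use square_integrable_zero in \<open>auto simp: L2_rel_def\<close>)
  then show ?thesis by simp
qed

lemma multiplication_scaleC: "multiplication a (c *\<^sub>C x) = c *\<^sub>C multiplication a x"
proof (cases "essentially_bounded a")
  case True
  show ?thesis
    by (rule L2_eqI) (use AE_rep_multiplication[OF True, of "c *\<^sub>C x"] AE_rep_multiplication[OF True, of x]
    AE_rep_scaleC[of c "multiplication a x"]
    AE_rep_scaleC[of c x] in eventually_elim, simp add: mult_ac)
next
  case False
  then have "multiplication a x = 0" for x
    by transfer (use square_integrable_zero in \<open>auto simp: L2_rel_def\<close>)
  then show ?thesis by simp
qed

lemma essentially_bounded_measurable [measurable_dest]: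
  "essentially_bounded a \<Longrightarrow> a \<in> borel_measurable haar"
  by (simp add: essentially_bounded_def)

lemma cinner_multiplication:
  assumes "essentially_bounded a"
  shows "cinner (multiplication a x) y = (\<integral>t. a t * rep_L2 x t * cnj (rep_L2 y t) \<partial>haar)"
  by (rule cinner_eq_integral_AE[OF AE_rep_multiplication[OF assms] AE_I2[OF refl]]; use assms in simp)

lemma essentially_boundedI:
  "a \<in> borel_measurable haar \<Longrightarrow> (\<And>x. cmod (a x) \<le> C) \<Longrightarrow> essentially_bounded a"
  by (auto simp: essentially_bounded_def)

lemma norm_multiplication_le:
  assumes "essentially_bounded a" and C: "AE t in haar. cmod (a t) \<le> C" "0 \<le> C"
  shows "norm (multiplication a x) \<le> C * norm x"
proof -
  have "(norm (multiplication a x))\<^sup>2 \<le> (\<integral>t. C\<^sup>2 * (cmod (rep_L2 x t))\<^sup>2 \<partial>haar)"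
    unfolding norm_power2_eq_integral
  proof (rule integral_mono_AE)
    show "AE t in haar. (cmod (rep_L2 (multiplication a x) t))\<^sup>2 \<le> C\<^sup>2 * (cmod (rep_L2 x t))\<^sup>2"
      using C(1) AE_rep_multiplication[OF assms(1), of x]
      by eventually_elim (auto simp: norm_mult power_mult_distrib intro!: mult_right_mono power_mono)
  qed auto
  also have "\<dots> = (C * norm x)\<^sup>2"
    by (simp add: norm_power2_eq_integral power_mult_distrib)
  finally show ?thesis using C(2) by (simp add: power2_le_iff_abs_le)
qed

lemma bounded_linear_multiplication:
  assumes "essentially_bounded a"
  shows "bounded_linear (multiplication a)"
proof -
  obtain C where "AE t in haar. cmod (a t) \<le> C"
    using assms by (auto simp: essentially_bounded_def)
  then have "AE t in haar. cmod (a t) \<le> max C 0"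
    by eventually_elim auto
  then have "norm (multiplication a x) \<le> max C 0 * norm x" for x
    by (rule norm_multiplication_le[OF assms]) auto
  then show ?thesis
    by (intro bounded_linear_intro[where K = "max C 0"])
      (auto simp: multiplication_add multiplication_scaleC scaleR_L2_def mult.commute)
qed

definition multiplication_op :: "('g::haar_group \<Rightarrow> complex) \<Rightarrow> 'g op" where
  "multiplication_op a = Blinfun (multiplication a)"

lemma multiplication_op_apply:
  "essentially_bounded a \<Longrightarrow> multiplication_op a x = multiplication a x"
  by (simp add: multiplication_op_def bounded_linear_Blinfun_apply bounded_linear_multiplication)

lemma multiplication_op_in_masa:
  "essentially_bounded a \<Longrightarrow> multiplication_op a \<in> multiplication_masa"
  unfolding multiplication_masa_def using multiplication_op_apply by blast

lemma multiplication_adjoint: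
  assumes "essentially_bounded a"
  shows "cinner (multiplication a x) y = cinner x (multiplication (\<lambda>t. cnj (a t)) y)"
proof -
  have b: "essentially_bounded (\<lambda>t. cnj (a t))"
    using assms by (auto simp: essentially_bounded_def)
  have "cinner x (multiplication (\<lambda>t. cnj (a t)) y) = (\<integral>t. rep_L2 x t * cnj (cnj (a t) * rep_L2 y t) \<partial>haar)"
    by (rule cinner_eq_integral_AE(1)[OF AE_I2[OF refl] AE_rep_multiplication[OF b]])
      (use assms in auto)
  then show ?thesis
    by (simp add: cinner_multiplication[OF assms] mult_ac)
qed

lemma multiplication_mult:
  assumes "essentially_bounded a" "essentially_bounded b"
  shows "multiplication a (multiplication b x) = multiplication (\<lambda>t. a t * b t) x"
proof -
  obtain C D where "AE x in haar. cmod (a x) \<le> C" "AE x in haar. cmod (b x) \<le> D"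
    using assms by (auto simp: essentially_bounded_def)
  then have "AE x in haar. cmod (a x * b x) \<le> C * D"
    proof eventually_elim
    case (elim x)
    have "0 \<le> C" using elim(1) norm_ge_zero[of "a x"] by linarith
    then show ?case using elim by (auto simp: norm_mult intro!: mult_mono)
  qed
  then have ab: "essentially_bounded (\<lambda>t. a t * b t)"
    using assms by (auto simp: essentially_bounded_def)
  show ?thesis
    by (rule L2_eqI) (use AE_rep_multiplication[OF assms(1), of "multiplication b x"]
      AE_rep_multiplication[OF assms(2), of x] AE_rep_multiplication[OF ab, of x] in eventually_elim, simp)
qed

section \<open>Completeness and the Riesz representation\<close>

lemma rep_L2_diff: "AE t in haar. rep_L2 (x - y) t = rep_L2 x t - rep_L2 y t"
  using AE_rep_plus[of x "(- 1) *\<^sub>C y"] AE_rep_scaleC[of "- 1" y]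
  by eventually_elim (simp flip: uminus_eq_scaleC)

lemma nn_integral_rep_diff:
  "(\<integral>\<^sup>+t. ennreal ((cmod (rep_L2 x t - rep_L2 y t))\<^sup>2) \<partial>haar) = ennreal ((norm (x - y))\<^sup>2)"
proof -
  have "(\<integral>\<^sup>+t. ennreal ((cmod (rep_L2 x t - rep_L2 y t))\<^sup>2) \<partial>haar)
      = (\<integral>\<^sup>+t. ennreal ((cmod (rep_L2 (x - y) t))\<^sup>2) \<partial>haar)"
    by (rule nn_integral_cong_AE) (use rep_L2_diff[of x y] in eventually_elim, simp)
  then show ?thesis
    by (simp add: nn_integral_eq_integral norm_power2_eq_integral)
qed

text \<open>The almost everywhere half of the Riesz-Fischer theorem. The squared increments have
  integral at most \<open>(1/16)^k\<close>, so with weight \<open>4^k\<close> they are still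
  summable in mean. Almost everywhere the weighted squares then tend to \<open>0\<close>, hence the
  increments are eventually at most \<open>(1/2)^k\<close>.\<close>

lemma L2_fast_Cauchy_AE_convergent:
  fixes X :: "nat \<Rightarrow> 'g::haar_group L2"
  assumes fast: "\<And>k. norm (X (Suc k) - X k) \<le> (1/4)^k"
  shows "AE t in haar. convergent (\<lambda>k. rep_L2 (X k) t)"
proof -
  define d where "d k t = 4^k * (cmod (rep_L2 (X (Suc k)) t - rep_L2 (X k) t))\<^sup>2" for k t
  have [measurable]: "d k \<in> borel_measurable haar" for k
    unfolding d_def by simp
  have "(\<integral>\<^sup>+t. ennreal (d k t) \<partial>haar) \<le> ennreal ((1/4)^k)" for k
  proof -
    have "(\<integral>\<^sup>+t. ennreal (d k t) \<partial>haar)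
        = ennreal (4^k) * (\<integral>\<^sup>+t. ennreal ((cmod (rep_L2 (X (Suc k)) t - rep_L2 (X k) t))\<^sup>2) \<partial>haar)"
      unfolding d_def by (subst nn_integral_cmult[symmetric]) (auto simp: ennreal_mult)
    also have "\<dots> = ennreal (4^k * (norm (X (Suc k) - X k))\<^sup>2)"
      by (simp add: nn_integral_rep_diff ennreal_mult)
    also have "\<dots> \<le> ennreal (4^k * ((1/4)^k)\<^sup>2)"
      by (intro ennreal_leI mult_left_mono power_mono fast) auto
    also have "4^k * ((1/4)^k)\<^sup>2 = (1/4::real)^k"
      by (simp add: power2_eq_square field_simps flip: power_mult_distrib)
    finally show ?thesis .
  qed
  then have "(\<Sum>k. \<integral>\<^sup>+t. ennreal (d k t) \<partial>haar) \<le> (\<Sum>k. ennreal ((1/4)^k))"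
    by (intro suminf_le) auto
  also have "\<dots> < \<infinity>"
    by (subst suminf_ennreal2) (auto intro: summable_geometric)
  finally have "(\<integral>\<^sup>+t. (\<Sum>k. ennreal (d k t)) \<partial>haar) \<noteq> \<infinity>"
    by (subst nn_integral_suminf) auto
  then have "AE t in haar. (\<Sum>k. ennreal (d k t)) \<noteq> \<infinity>"
    by (intro nn_integral_PInf_AE) auto
  then show ?thesis
  proof eventually_elim
    case (elim t)
    then have "summable (\<lambda>k. d k t)"
      by (intro summable_suminf_not_top) (auto simp: d_def)
    then have "(\<lambda>k. d k t) \<longlonglongrightarrow> 0"
      by (rule summable_LIMSEQ_zero)
    then have "\<forall>\<^sub>F k in sequentially. d k t < 1"
      by (rule order_tendstoD) simp
    then have "\<forall>\<^sub>F k in sequentially.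
        norm (rep_L2 (X (Suc k)) t - rep_L2 (X k) t) \<le> (1/2)^k"
    proof eventually_elim
      case (elim k)
      then have "(2^k * cmod (rep_L2 (X (Suc k)) t - rep_L2 (X k) t))\<^sup>2 \<le> 1\<^sup>2"
        by (simp add: d_def power_mult_distrib power_mult[symmetric] mult.commute[of k 2] power_mult)
      then have "2^k * cmod (rep_L2 (X (Suc k)) t - rep_L2 (X k) t) \<le> 1"
        by (rule power2_le_imp_le) simp
      then show ?case by (simp add: field_simps)
    qed
    then have "summable (\<lambda>k. rep_L2 (X (Suc k)) t - rep_L2 (X k) t)"
      by (rule summable_comparison_test_ev) (auto intro: summable_geometric)
    then have "convergent (\<lambda>n. rep_L2 (X 0) t + (\<Sum>k<n. rep_L2 (X (Suc k)) t - rep_L2 (X k) t))"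
      by (intro convergent_add convergent_const) (simp add: summable_iff_convergent)
    then show ?case
      using sum_lessThan_telescope[of "\<lambda>k. rep_L2 (X k) t"] by simp
  qed
qed

text \<open>Fatou's lemma bounds the distance from \<open>X m\<close> to the pointwise limit by any
  bound on the later terms. Radius \<open>1\<close> yields square integrability of the limit, radius
  \<open>r / 2\<close> yields convergence in norm.\<close>

lemma L2_fast_Cauchy_convergent:
  fixes X :: "nat \<Rightarrow> 'g::haar_group L2"
  assumes "Cauchy X" and fast: "\<And>k. norm (X (Suc k) - X k) \<le> (1/4)^k"
  shows "convergent X"
proof -
  define f where "f t = lim (\<lambda>k. rep_L2 (X k) t)" for t
  have f_m [measurable]: "f \<in> borel_measurable haar"
    unfolding f_def by (rule borel_measurable_lim_metric) simp
  have conv: "AE t in haar. (\<lambda>k. rep_L2 (X k) t) \<longlonglongrightarrow> f t"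
    using L2_fast_Cauchy_AE_convergent[OF fast]
    by eventually_elim (simp add: f_def convergent_LIMSEQ_iff)
  have fatou: "(\<integral>\<^sup>+t. ennreal ((cmod (f t - rep_L2 (X m) t))\<^sup>2) \<partial>haar) \<le> ennreal (r\<^sup>2)"
    if r: "\<And>k. k \<ge> m \<Longrightarrow> norm (X k - X m) \<le> r" for m r
  proof -
    have "(\<integral>\<^sup>+t. ennreal ((cmod (f t - rep_L2 (X m) t))\<^sup>2) \<partial>haar)
        = (\<integral>\<^sup>+t. liminf (\<lambda>k. ennreal ((cmod (rep_L2 (X k) t - rep_L2 (X m) t))\<^sup>2)) \<partial>haar)"
    proof (rule nn_integral_cong_AE, use conv in eventually_elim)
      case (elim t)
      then have "(\<lambda>k. ennreal ((cmod (rep_L2 (X k) t - rep_L2 (X m) t))\<^sup>2))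
          \<longlonglongrightarrow> ennreal ((cmod (f t - rep_L2 (X m) t))\<^sup>2)"
        by (intro tendsto_ennrealI tendsto_intros)
      then show ?case
        by (intro lim_imp_Liminf[symmetric]) auto
    qed
    also have "\<dots> \<le> liminf (\<lambda>k. \<integral>\<^sup>+t. ennreal ((cmod (rep_L2 (X k) t - rep_L2 (X m) t))\<^sup>2) \<partial>haar)"
      by (rule nn_integral_liminf) simp
    also have "\<dots> \<le> liminf (\<lambda>k. ennreal (r\<^sup>2))"
    proof (rule Liminf_mono, rule eventually_sequentiallyI[of m])
      fix k assume "k \<ge> m"
      then show "(\<integral>\<^sup>+t. ennreal ((cmod (rep_L2 (X k) t - rep_L2 (X m) t))\<^sup>2) \<partial>haar) \<le> ennreal (r\<^sup>2)"
        unfolding nn_integral_rep_diff by (intro ennreal_leI power_mono r) auto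
    qed
    finally show ?thesis by (simp add: Liminf_const)
  qed
  have sq: "square_integrable f"
  proof -
    obtain m where m: "\<And>k. k \<ge> m \<Longrightarrow> norm (X k - X m) < 1"
      using \<open>Cauchy X\<close> unfolding Cauchy_def dist_norm by (metis order_refl zero_less_one)
    have "(\<integral>\<^sup>+t. ennreal ((cmod (f t - rep_L2 (X m) t))\<^sup>2) \<partial>haar) \<le> ennreal (1\<^sup>2)"
      by (rule fatou) (use m in \<open>auto intro: less_imp_le\<close>)
    then have "integrable haar (\<lambda>t. (cmod (f t - rep_L2 (X m) t))\<^sup>2)"
      by (intro integrableI_bounded) (auto simp: le_less_trans)
    then have "square_integrable (\<lambda>t. f t - rep_L2 (X m) t)"
      by (auto simp: square_integrable_def)
    from square_integrable_add[OF this square_integrable_rep[of "X m"]] show ?thesis by simp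
  qed
  have "X \<longlonglongrightarrow> abs_L2 f"
  proof (rule LIMSEQ_I)
    fix r :: real assume "r > 0"
    then obtain M where M: "\<And>m n. m \<ge> M \<Longrightarrow> n \<ge> M \<Longrightarrow> norm (X m - X n) < r / 2"
      using \<open>Cauchy X\<close> unfolding Cauchy_def dist_norm by (meson half_gt_zero)
    have "norm (X m - abs_L2 f) < r" if "m \<ge> M" for m
    proof -
      have "ennreal ((norm (abs_L2 f - X m))\<^sup>2)
          = (\<integral>\<^sup>+t. ennreal ((cmod (f t - rep_L2 (X m) t))\<^sup>2) \<partial>haar)"
        unfolding nn_integral_rep_diff[symmetric]
        by (rule nn_integral_cong_AE) (use AE_rep_abs_L2[OF sq] in eventually_elim, simp)
      also have "\<dots> \<le> ennreal ((r / 2)\<^sup>2)"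
        by (rule fatou) (use that M in \<open>auto intro!: less_imp_le\<close>)
      finally have "(norm (abs_L2 f - X m))\<^sup>2 \<le> (r / 2)\<^sup>2"
        by simp
      then have "norm (abs_L2 f - X m) \<le> r / 2"
        using \<open>r > 0\<close> by (simp add: power2_le_iff_abs_le)
      then show ?thesis
        using \<open>r > 0\<close> by (simp add: norm_minus_commute)
    qed
    then show "\<exists>M. \<forall>m\<ge>M. norm (X m - abs_L2 f) < r" by blast
  qed
  then show ?thesis by (rule convergentI)
qed

instance L2 :: (haar_group) complete_space
proof
  fix X :: "nat \<Rightarrow> 'a L2"
  assume X: "Cauchy X"
  then have "\<exists>M. \<forall>m\<ge>M. \<forall>n\<ge>M. norm (X m - X n) < (1/4)^k" for k :: nat
    unfolding Cauchy_def dist_norm by simp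
  then obtain M where M: "\<And>k m n. m \<ge> M k \<Longrightarrow> n \<ge> M k \<Longrightarrow> norm (X m - X n) < (1/4)^k"
    by metis
  \<comment> \<open>The summand \<open>1\<close> makes \<open>r\<close> strictly increasing, and the
    sum keeps \<open>M k \<le> r k\<close>; consecutive terms of the subsequence therefore differ by
    at most \<open>(1/4)^k\<close>.\<close>
  define r where "r k = (\<Sum>i\<le>k. M i + 1)" for k
  have r: "strict_mono r" "M k \<le> r k" for k
    using member_le_sum[of k "{..k}" "\<lambda>i. M i + 1"] by (auto simp: r_def strict_mono_Suc_iff)
  have "norm (X (r (Suc k)) - X (r k)) \<le> (1/4)^k" for k
    by (rule less_imp_le, rule M) (use r(2)[of k] strict_monoD[OF r(1), of k "Suc k"] in auto)
  then have "convergent (X \<circ> r)"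
    using Cauchy_subseq_Cauchy[OF X r(1)] by (intro L2_fast_Cauchy_convergent) auto
  then obtain x where "(X \<circ> r) \<longlonglongrightarrow> x"
    by (auto simp: convergent_def)
  then have "X \<longlonglongrightarrow> x"
    by (rule Cauchy_converges_subseq[OF X r(1)])
  then show "convergent X" by (rule convergentI)
qed

instance L2 :: (haar_group) banach ..

text \<open>The representing vector minimises \<open>F x = (norm x)\<^sup>2 - 2 * \<phi> x\<close>,
  which is bounded below by completing the square. In the parallelogram law the linear parts cancel,
  so minimising sequences are Cauchy, and at the minimiser the first variation vanishes.\<close>

lemma riesz_representation_real:
  fixes \<phi> :: "'a::{real_inner, complete_space} \<Rightarrow> real"
  assumes "bounded_linear \<phi>"
  shows "\<exists>y. \<forall>x. \<phi> x = inner y x"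
proof -
  interpret \<phi>: bounded_linear \<phi> by fact
  define F where "F x = (norm x)\<^sup>2 - 2 * \<phi> x" for x
  obtain C where C: "\<And>x. norm (\<phi> x) \<le> norm x * C"
    using \<phi>.bounded by blast
  have "- C\<^sup>2 \<le> F x" for x
  proof -
    have "0 \<le> (norm x - C)\<^sup>2" by simp
    then show ?thesis using C[of x] by (simp add: F_def power2_diff)
  qed
  then have bdd: "bdd_below (range F)" by (intro bdd_belowI[of _ "- C\<^sup>2"]) auto
  define m where "m = Inf (range F)"
  have m_le: "m \<le> F x" for x
    unfolding m_def using bdd by (simp add: cInf_lower)
  have "\<exists>x. F x < m + 1 / Suc n" for n
    using cInf_lessD[of "range F" "m + 1 / Suc n"] by (auto simp: m_def)
  then obtain X where X: "\<And>n. F (X n) < m + 1 / Suc n" by metis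
  have par: "F x + F y = 2 * F ((1/2) *\<^sub>R (x + y)) + (norm (x - y))\<^sup>2 / 2" for x y
    unfolding F_def power2_norm_eq_inner
    by (simp add: \<phi>.add \<phi>.scaleR inner_simps inner_commute algebra_simps add_divide_distrib diff_divide_distrib)
  have close: "(norm (X i - X j))\<^sup>2 \<le> 2 / Suc i + 2 / Suc j" for i j
    using par[of "X i" "X j"] X[of i] X[of j] m_le[of "(1/2) *\<^sub>R (X i + X j)"] by simp
  have "Cauchy X"
  proof (rule CauchyI)
    fix e :: real assume "e > 0"
    then obtain N :: nat where N: "4 / e\<^sup>2 < N"
      using reals_Archimedean2 by blast
    have "norm (X i - X j) < e" if "i \<ge> N" "j \<ge> N" for i j
    proof -
      have "2 / Suc i \<le> 2 / Suc N" "2 / Suc j \<le> 2 / Suc N"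
        using that by (auto intro!: divide_left_mono)
      then have "(norm (X i - X j))\<^sup>2 \<le> 4 / Suc N"
        using close[of i j] by simp
      also have "\<dots> < e\<^sup>2"
      proof -
        have "4 < N * e\<^sup>2"
          using N \<open>e > 0\<close> by (simp add: field_simps)
        also have "\<dots> \<le> Suc N * e\<^sup>2" by (intro mult_right_mono) auto
        finally show ?thesis by (simp add: field_simps)
      qed
      finally show ?thesis
        using \<open>e > 0\<close> by (simp add: power_less_imp_less_base)
    qed
    then show "\<exists>M. \<forall>m\<ge>M. \<forall>n\<ge>M. norm (X m - X n) < e" by blast
  qed
  then obtain y where y: "X \<longlonglongrightarrow> y"
    using Cauchy_convergent_iff convergent_def by blast
  have "(\<lambda>n. F (X n)) \<longlonglongrightarrow> F y"
    unfolding F_def by (intro tendsto_intros y \<phi>.tendsto)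
  moreover have "(\<lambda>n. m + 1 / Suc n) \<longlonglongrightarrow> m + 0"
    by (intro tendsto_intros LIMSEQ_Suc lim_1_over_n)
  ultimately have Fy: "F y \<le> m + 0"
    by (rule LIMSEQ_le) (use X less_imp_le in blast)
  have "\<phi> x = inner y x" for x
  proof (rule ccontr)
    assume ne: "\<phi> x \<noteq> inner y x"
    define c where "c = \<phi> x - inner y x"
    have q: "F (y + t *\<^sub>R x) = F y - 2 * t * c + t\<^sup>2 * (norm x)\<^sup>2" for t
      unfolding F_def power2_norm_eq_inner c_def
      by (simp add: \<phi>.add \<phi>.scaleR inner_simps inner_commute algebra_simps power2_eq_square)
    have ge: "2 * t * c \<le> t\<^sup>2 * (norm x)\<^sup>2" for t
      using q[of t] m_le[of "y + t *\<^sub>R x"] Fy by simp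
    have x0: "(norm x)\<^sup>2 > 0"
      using ne \<phi>.zero by (cases "x = 0") auto
    define N where "N = (norm x)\<^sup>2"
    \<comment> \<open>\<open>t = c / N\<close> is the vertex of the parabola
      \<open>2 * t * c - t\<^sup>2 * N\<close>, where its value is
      \<open>c\<^sup>2 / N\<close>.\<close>
    have "2 * c\<^sup>2 / N \<le> c\<^sup>2 / N"
      using ge[of "c / N"] x0 unfolding N_def[symmetric] by (simp add: power2_eq_square)
    moreover have "c\<^sup>2 / N > 0" using x0 ne by (simp add: c_def N_def)
    ultimately show False by simp
  qed
  then show ?thesis by blast
qed

text \<open>The real part of the form is a bounded real functional of \<open>y\<close>, represented
  by a vector \<open>t x\<close>. Conjugate linearity in \<open>y\<close> recovers the imaginary
  part, and linearity in \<open>x\<close> is then inherited because \<open>t x\<close> is determined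
  by its inner products.\<close>

lemma sesquilinear_form_operator:
  fixes B :: "'g::haar_group L2 \<Rightarrow> 'g L2 \<Rightarrow> complex"
  assumes add_left: "\<And>x x' y. B (x + x') y = B x y + B x' y"
    and add_right: "\<And>x y y'. B x (y + y') = B x y + B x y'"
    and scale_left: "\<And>c x y. B (c *\<^sub>C x) y = c * B x y"
    and scale_right: "\<And>c x y. B x (c *\<^sub>C y) = cnj c * B x y"
    and bound: "\<And>x y. cmod (B x y) \<le> C * norm x * norm y"
    and "0 \<le> C"
  obtains T :: "'g op"
    where "T \<in> bounded_operators" "\<And>x y. cinner (T x) y = B x y" "norm T \<le> C"
proof -
  have "\<exists>z. \<forall>y. Re (B x y) = inner z y" for x
  proof (rule riesz_representation_real, rule bounded_linear_intro[where K = "C * norm x"])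
    fix y r
    show "Re (B x (r *\<^sub>R y)) = r *\<^sub>R Re (B x y)"
      by (simp add: scaleR_L2_def scale_right)
    show "norm (Re (B x y)) \<le> norm y * (C * norm x)"
      using abs_Re_le_cmod[of "B x y"] bound[of x y] by (simp add: mult_ac)
  qed (simp add: add_right)
  then obtain t where t: "\<And>x y. Re (B x y) = inner (t x) y" by metis
  have ct: "cinner (t x) y = B x y" for x y
    unfolding cinner_eq_inner t[symmetric] scale_right by (simp add: complex_eq_iff)
  have nt: "norm (t x) \<le> norm x * C" for x
  proof (cases "t x = 0")
    case False
    have "(norm (t x))\<^sup>2 = cmod (cinner (t x) (t x))"
      by (simp add: cinner_self norm_power)
    also have "\<dots> \<le> C * norm x * norm (t x)"
      unfolding ct by (rule bound)
    finally show ?thesis using False by (simp add: power2_eq_square mult.commute)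
  qed (use \<open>0 \<le> C\<close> in simp)
  have sc: "t (c *\<^sub>C x) = c *\<^sub>C t x" for c x
    by (rule cinner_ext) (simp add: ct scale_left)
  have bl: "bounded_linear t"
  proof (rule bounded_linear_intro[where K = C])
    show "t (x + y) = t x + t y" for x y
      by (rule cinner_ext) (simp add: ct add_left cinner_add_left)
  qed (use nt sc in \<open>auto simp: scaleR_L2_def\<close>)
  show ?thesis
  proof (rule that[of "Blinfun t"])
    show "norm (Blinfun t) \<le> C"
      by (rule norm_blinfun_bound[OF \<open>0 \<le> C\<close>])
        (use nt in \<open>simp add: bounded_linear_Blinfun_apply[OF bl] mult.commute\<close>)
  qed (auto simp: bounded_operators_def bounded_linear_Blinfun_apply[OF bl] sc ct)
qed

lemma adjoint_operator:
  fixes T :: "'g::haar_group op"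
  assumes "T \<in> bounded_operators"
  obtains S :: "'g op" where "S \<in> bounded_operators" "\<And>x y. cinner (T x) y = cinner x (S y)"
proof -
  have T: "T (c *\<^sub>C x) = c *\<^sub>C T x" for c x
    using assms by (simp add: bounded_operators_def)
  have "cmod (cinner x (T y)) \<le> norm T * norm x * norm y" for x y
  proof -
    have "cmod (cinner x (T y)) \<le> norm x * norm (T y)" by (rule norm_cinner_le)
    also have "\<dots> \<le> norm x * (norm T * norm y)"
      by (intro mult_left_mono norm_blinfun) auto
    finally show ?thesis by (simp add: mult_ac)
  qed
  then obtain S :: "'g op" where S: "S \<in> bounded_operators" "\<And>x y. cinner (S x) y = cinner x (T y)"
    by (rule sesquilinear_form_operator[of "\<lambda>x y. cinner x (T y)" "norm T", rotated 4])
      (auto simp: cinner_add_left cinner_add_right blinfun.add_right T)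
  then show ?thesis
    by (intro that[of S]) (metis cinner_commute)+
qed

section \<open>Parseval frames\<close>

text \<open>Finite nonempty intersections of relatively compact basic open sets. Closure under
  intersection gives uniqueness of measures, countability allows exceptional null sets to be
  collected, and relative compactness makes every member of finite Haar measure.\<close>

lemma countable_relatively_compact_pi_system:
  obtains B :: "'g::{haar_group, second_countable_topology} set set"
  where "countable B" "B \<noteq> {}" "Int_stable B" "sigma_sets UNIV B = sets borel" "\<Union>B = UNIV"
    "\<And>U. U \<in> B \<Longrightarrow> open U" "\<And>U. U \<in> B \<Longrightarrow> \<exists>K. compact K \<and> U \<subseteq> K"
proof -
  obtain B0 :: "'g set set" where B0: "countable B0" "topological_basis B0"
    using ex_countable_basis by blast
  define B1 where "B1 = {U \<in> B0. \<exists>K. compact K \<and> U \<subseteq> K}"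
  have B1: "\<exists>U\<in>B1. x \<in> U \<and> U \<subseteq> O'" if "open O'" "x \<in> O'" for x :: 'g and O'
  proof -
    obtain W K where W: "open W" "compact K" "x \<in> W" "W \<subseteq> K"
      using locally_compact by blast
    obtain U where "U \<in> B0" "x \<in> U" "U \<subseteq> O' \<inter> W"
      by (rule topological_basisE[OF B0(2), of "O' \<inter> W" x]) (use W \<open>open O'\<close> \<open>x \<in> O'\<close> in auto)
    moreover from this W have "U \<in> B1" unfolding B1_def by blast
    ultimately show ?thesis by blast
  qed
  have B1_open: "open U" if "U \<in> B1" for U
    using that B0(2) by (auto simp: B1_def topological_basis_open)
  define B where "B = Inter ` {F. F \<noteq> {} \<and> finite F \<and> F \<subseteq> B1}"
  have B1_B: "B1 \<subseteq> B"
    unfolding B_def by (auto intro!: image_eqI[of _ _ "{_}"])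
  have op: "open U" if "U \<in> B" for U
    using that B1_open by (auto simp: B_def intro!: open_Inter)
  have cov: "\<Union>B = UNIV"
    using B1[of UNIV] B1_B by blast
  show ?thesis
  proof (rule that[of B])
    have "countable B1" using B0(1) by (auto simp: B1_def)
    then have "countable {F. F \<subseteq> B1 \<and> finite F}"
      using countable_Collect_finite_subset by (auto simp: conj_commute)
    then show "countable B"
      unfolding B_def by (intro countable_image) (auto elim: countable_subset[rotated])
    show "B \<noteq> {}" using cov by auto
    show "Int_stable B"
    proof (rule Int_stableI)
      fix a b assume "a \<in> B" "b \<in> B"
      then obtain F F' where "a = \<Inter>F" "b = \<Inter>F'" "F \<noteq> {}" "F' \<noteq> {}" "finite F" "finite F'"
        "F \<subseteq> B1" "F' \<subseteq> B1"
        unfolding B_def by blast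
      then show "a \<inter> b \<in> B"
        unfolding B_def by (intro image_eqI[of _ _ "F \<union> F'"]) auto
    qed
    show "sigma_sets UNIV B = sets borel"
    proof -
      have "sigma_sets UNIV B = sigma_sets UNIV {S. open S}"
      proof (rule sigma_sets_eqI)
        fix a :: "'g set" assume "a \<in> {S. open S}"
        then have "a = \<Union>{U \<in> B1. U \<subseteq> a}"
          using B1[of a] by blast
        also have "\<dots> \<in> sigma_sets UNIV B"
          by (rule sigma_sets_UNION) (use B1_B \<open>countable B1\<close> in \<open>auto intro: sigma_sets.Basic\<close>)
        finally show "a \<in> sigma_sets UNIV B" .
      qed (use op in \<open>auto intro: sigma_sets.Basic\<close>)
      then show ?thesis by (simp add: borel_def)
    qed
    show "\<exists>K. compact K \<and> U \<subseteq> K" if U: "U \<in> B" for U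
    proof -
      obtain F where "U = \<Inter>F" "F \<noteq> {}" "F \<subseteq> B1" using U by (auto simp: B_def)
      then obtain V where "V \<in> B1" "U \<subseteq> V" by blast
      then show ?thesis by (auto simp: B1_def)
    qed
  qed (use op cov in auto)
qed

lemma emeasure_haar_finite_subset_compact:
  "compact K \<Longrightarrow> A \<subseteq> K \<Longrightarrow> emeasure haar A < \<infinity>" for K :: "'g::haar_group set"
  by (rule le_less_trans[OF emeasure_mono haar_compact_finite])
    (auto simp: sets_haar compact_imp_closed)

lemma sigma_finite_haar:
  "sigma_finite_measure (haar :: 'g::{haar_group, second_countable_topology} measure)"
proof -
  obtain B :: "'g set set"
    where B: "countable B" "\<Union>B = UNIV" "\<And>U. U \<in> B \<Longrightarrow> open U"
      "\<And>U. U \<in> B \<Longrightarrow> \<exists>K. compact K \<and> U \<subseteq> K"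
    by (rule countable_relatively_compact_pi_system) blast
  show ?thesis
  proof (standard, rule exI[of _ B], intro conjI ballI)
    fix U assume "U \<in> B"
    then show "emeasure haar U \<noteq> \<infinity>"
      using B(4) emeasure_haar_finite_subset_compact by (metis less_irrefl)
  qed (use B in \<open>auto simp: sets_haar\<close>)
qed

interpretation haar: sigma_finite_measure "haar :: 'g::{haar_group, second_countable_topology} measure"
  by (rule sigma_finite_haar)

interpretation haar_pair: pair_sigma_finite
  "haar :: 'g::{haar_group, second_countable_topology} measure"
  "haar :: 'g::{haar_group, second_countable_topology} measure"
  ..

section \<open>Totality of indicator functions\<close>

definition indicator_L2 :: "'g::haar_group set \<Rightarrow> 'g L2" where
  "indicator_L2 A = abs_L2 (indicator A)"

lemma square_integrable_indicator:
  assumes "A \<in> sets borel" "emeasure haar A < \<infinity>"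
  shows "square_integrable (indicator A :: 'g::haar_group \<Rightarrow> complex)"
proof -
  have "(cmod (indicator A x))\<^sup>2 = indicator A x" for x :: 'g
    by (simp add: indicator_def)
  then show ?thesis
    using assms by (auto simp: square_integrable_def sets_haar)
qed

lemma AE_rep_indicator_L2:
  "A \<in> sets borel \<Longrightarrow> emeasure haar A < \<infinity> \<Longrightarrow> AE t in haar. rep_L2 (indicator_L2 A) t = indicator A t"
  unfolding indicator_L2_def by (intro AE_rep_abs_L2 square_integrable_indicator)

lemma cinner_indicator_L2_right:
  assumes "A \<in> sets borel" "emeasure haar A < \<infinity>"
  shows "cinner x (indicator_L2 A) = (\<integral>t. rep_L2 x t * indicator A t \<partial>haar)"
    and "integrable haar (\<lambda>t. rep_L2 x t * indicator A t)"
proof -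
  have [measurable]: "A \<in> sets haar" using assms by (simp add: sets_haar)
  have c: "cnj (indicator A t) = indicator A t" for t :: 'a
    by (simp add: indicator_def)
  note * = cinner_eq_integral_AE[OF AE_I2[OF refl] AE_rep_indicator_L2[OF assms]]
  have "cinner x (indicator_L2 A) = (\<integral>t. rep_L2 x t * cnj (indicator A t) \<partial>haar)"
    by (rule *) auto
  then show "cinner x (indicator_L2 A) = (\<integral>t. rep_L2 x t * indicator A t \<partial>haar)" by (simp add: c)
  have "integrable haar (\<lambda>t. rep_L2 x t * cnj (indicator A t))"
    by (rule *) auto
  then show "integrable haar (\<lambda>t. rep_L2 x t * indicator A t)" by (simp add: c)
qed

text \<open>The measures with densities the positive and the negative part of \<open>g\<close> agree
  and are finite on the pi-system, which covers the space; hence they are equal, and so are their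
  densities almost everywhere.\<close>

lemma AE_eq_0_of_integrals_pi_system:
  fixes g :: "'g::{haar_group, second_countable_topology} \<Rightarrow> real"
  assumes B: "countable B" "Int_stable B" "sigma_sets UNIV B = sets borel" "\<Union>B = UNIV"
    and [measurable]: "g \<in> borel_measurable haar"
    and int: "\<And>U. U \<in> B \<Longrightarrow> integrable haar (\<lambda>t. g t * indicator U t)"
    and zero: "\<And>U. U \<in> B \<Longrightarrow> (\<integral>t. g t * indicator U t \<partial>haar) = 0"
  shows "AE t in haar. g t = 0"
proof -
  \<comment> \<open>\<open>ennreal\<close> sends negative reals to \<open>0\<close>, so these are
    the positive and the negative part of \<open>g\<close>; they agree at \<open>t\<close> exactly
    when \<open>g t = 0\<close>.\<close>
  let ?p = "\<lambda>t. ennreal (g t)" and ?n = "\<lambda>t. ennreal (- g t)"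
  have sets: "U \<in> sets haar" if "U \<in> B" for U
    using that B(3) by (auto simp: sets_haar intro: sigma_sets.Basic)
  have part: "emeasure (density haar (\<lambda>t. ennreal (h t))) U
      = ennreal (\<integral>t. max 0 (h t * indicator U t) \<partial>haar)"
    if "U \<in> B" "h = g \<or> h = (\<lambda>t. - g t)" for U h
  proof -
    have [measurable]: "h \<in> borel_measurable haar" using that by auto
    have i: "integrable haar (\<lambda>t. h t * indicator U t)"
      using that int by auto
    have "emeasure (density haar (\<lambda>t. ennreal (h t))) U
        = (\<integral>\<^sup>+t. ennreal (h t) * indicator U t \<partial>haar)"
      using sets[OF that(1)] by (simp add: emeasure_density)
    also have "\<dots> = (\<integral>\<^sup>+t. ennreal (max 0 (h t * indicator U t)) \<partial>haar)"
      by (rule nn_integral_cong) (simp add: indicator_def max_def ennreal_neg)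
    also have "\<dots> = ennreal (\<integral>t. max 0 (h t * indicator U t) \<partial>haar)"
      by (rule nn_integral_eq_integral) (use i in auto)
    finally show ?thesis .
  qed
  have "density haar ?p = density haar ?n"
  proof (rule measure_eqI_generator_eq_countable[OF B(2), of UNIV])
    fix U assume U: "U \<in> B"
    have i: "integrable haar (\<lambda>t. max 0 (g t * indicator U t))"
      "integrable haar (\<lambda>t. max 0 (- g t * indicator U t))"
      using int[OF U] by auto
    have "(\<integral>t. max 0 (g t * indicator U t) \<partial>haar) - (\<integral>t. max 0 (- g t * indicator U t) \<partial>haar)
        = (\<integral>t. max 0 (g t * indicator U t) - max 0 (- g t * indicator U t) \<partial>haar)"
      using i by simp
    also have "\<dots> = (\<integral>t. g t * indicator U t \<partial>haar)"
      by (rule Bochner_Integration.integral_cong) (auto simp: max_def)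
    finally show "emeasure (density haar ?p) U = emeasure (density haar ?n) U"
      using part[OF U, of g] part[OF U, of "\<lambda>t. - g t"] zero[OF U] by simp
  next
    fix U assume "U \<in> B"
    then show "emeasure (density haar ?p) U \<noteq> \<infinity>" using part[of U g] by simp
  qed (use B in \<open>auto simp: sets_haar\<close>)
  then have "AE t in haar. ?p t = ?n t"
    by (intro haar.density_unique) auto
  then show ?thesis
  proof eventually_elim
    case (elim t)
    show ?case
    proof (rule ccontr)
      assume "g t \<noteq> 0"
      then consider "g t > 0" | "g t < 0" by linarith
      then show False
        using elim by cases (auto simp: ennreal_neg)
    qed
  qed
qed

text \<open>Countability feeds the orthonormalisation below. Openness and relative compactness are
  kept because nonzero matrix entries are later tested on these same indicators, where compact
  supports allow a locally constant coefficient.\<close>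

lemma total_indicators:
  obtains B :: "'g::{haar_group, second_countable_topology} set set"
  where "countable B" "B \<noteq> {}"
    "\<And>U. U \<in> B \<Longrightarrow> open U" "\<And>U. U \<in> B \<Longrightarrow> \<exists>K. compact K \<and> U \<subseteq> K"
    "\<And>x. (\<And>U. U \<in> B \<Longrightarrow> cinner x (indicator_L2 U) = 0) \<Longrightarrow> x = 0"
proof -
  obtain B :: "'g set set" where B: "countable B" "B \<noteq> {}" "Int_stable B"
    "sigma_sets UNIV B = sets borel" "\<Union>B = UNIV"
    "\<And>U. U \<in> B \<Longrightarrow> open U" "\<And>U. U \<in> B \<Longrightarrow> \<exists>K. compact K \<and> U \<subseteq> K"
    by (rule countable_relatively_compact_pi_system) blast
  have "x = 0" if x: "\<And>U. U \<in> B \<Longrightarrow> cinner x (indicator_L2 U) = 0" for x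
  proof -
    have U: "integrable haar (\<lambda>t. rep_L2 x t * indicator U t)"
      "(\<integral>t. rep_L2 x t * indicator U t \<partial>haar) = 0" if "U \<in> B" for U
    proof -
      have "U \<in> sets borel" "emeasure haar U < \<infinity>"
        using B(6,7)[OF that] emeasure_haar_finite_subset_compact by auto
      then show "integrable haar (\<lambda>t. rep_L2 x t * indicator U t)"
        "(\<integral>t. rep_L2 x t * indicator U t \<partial>haar) = 0"
        using cinner_indicator_L2_right[of U x] x[OF that] by auto
    qed
    have re: "Re (z * indicator U t) = Re z * indicator U t" "Im (z * indicator U t) = Im z * indicator U t"
      for z and U :: "'g set" and t
      by (auto simp: indicator_def)
    have "AE t in haar. Re (rep_L2 x t) = 0"
    proof (rule AE_eq_0_of_integrals_pi_system[OF B(1,3,4,5)])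
      fix V assume V: "V \<in> B"
      show "integrable haar (\<lambda>t. Re (rep_L2 x t) * indicator V t)"
        using integrable_Re[OF U(1)[OF V]] unfolding re .
      show "(\<integral>t. Re (rep_L2 x t) * indicator V t \<partial>haar) = 0"
        using integral_Re[OF U(1)[OF V]] unfolding re U(2)[OF V] by simp
    qed simp
    moreover have "AE t in haar. Im (rep_L2 x t) = 0"
    proof (rule AE_eq_0_of_integrals_pi_system[OF B(1,3,4,5)])
      fix V assume V: "V \<in> B"
      show "integrable haar (\<lambda>t. Im (rep_L2 x t) * indicator V t)"
        using integrable_Im[OF U(1)[OF V]] unfolding re .
      show "(\<integral>t. Im (rep_L2 x t) * indicator V t \<partial>haar) = 0"
        using integral_Im[OF U(1)[OF V]] unfolding re U(2)[OF V] by simp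
    qed simp
    moreover have "AE t in haar. rep_L2 (0::'g L2) t = 0"
      using AE_rep_scaleC[of 0 "0 :: 'g L2"] by simp
    ultimately show "x = 0"
      by (intro L2_eqI, eventually_elim) (simp add: complex_eq_iff)
  qed
  then show ?thesis using that[OF B(1,2,6,7)] by blast
qed

text \<open>The intended instances are orthonormal bases padded with zero vectors. Indexing by
  \<open>nat\<close> then also covers the finite dimensional spaces of finite groups and redundant
  generating sequences.\<close>

locale parseval_frame =
  fixes e :: "nat \<Rightarrow> 'g::{haar_group, second_countable_topology} L2"
  assumes frame_sums: "(\<lambda>n. cinner x (e n) *\<^sub>C e n) sums x"
    and frame_contraction: "norm (\<Sum>n<N. cinner x (e n) *\<^sub>C e n) \<le> norm x"
begin

lemma parseval: "(\<lambda>n. cinner x (e n) * cnj (cinner y (e n))) sums cinner x y"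
  using bounded_linear.sums[OF bounded_linear_cinner_left frame_sums, of x y]
  by (simp flip: cinner_commute)

lemma parseval_norm: "(\<lambda>n. (cmod (cinner x (e n)))\<^sup>2) sums (norm x)\<^sup>2"
proof -
  have "(\<lambda>n. complex_of_real ((cmod (cinner x (e n)))\<^sup>2)) sums of_real ((norm x)\<^sup>2)"
    using parseval[of x x] unfolding complex_norm_square cinner_self .
  then show ?thesis by (simp only: sums_of_real_iff)
qed

lemma bessel: "(\<Sum>n<N. (cmod (cinner x (e n)))\<^sup>2) \<le> (norm x)\<^sup>2"
  using sum_le_suminf[OF sums_summable[OF parseval_norm[of x]], of "{..<N}"]
  by (simp add: sums_unique[OF parseval_norm, symmetric])

end

text \<open>Since \<open>sgn 0 = 0\<close>, a vector depending linearly on its predecessors yields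
  \<open>0\<close> instead of being skipped, so the index set is unchanged.\<close>

fun gram_schmidt :: "(nat \<Rightarrow> 'g::haar_group L2) \<Rightarrow> nat \<Rightarrow> 'g L2" where
  "gram_schmidt d n =
     sgn (d n - (\<Sum>k<n. cinner (d n) (gram_schmidt d k) *\<^sub>C gram_schmidt d k))"

declare gram_schmidt.simps [simp del]

lemma gram_schmidt_self: "gram_schmidt d n = 0 \<or> cinner (gram_schmidt d n) (gram_schmidt d n) = 1"
  unfolding cinner_self gram_schmidt.simps[of d n] norm_sgn by auto

lemma gram_schmidt_orthogonal_less: "k < n \<Longrightarrow> cinner (gram_schmidt d n) (gram_schmidt d k) = 0"
proof (induction n arbitrary: k rule: less_induct)
  case (less n)
  let ?e = "gram_schmidt d"
  let ?v = "d n - (\<Sum>j<n. cinner (d n) (?e j) *\<^sub>C ?e j)"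
  have ort: "cinner (?e j) (?e k) = 0" if "j < n" "j \<noteq> k" for j
    using less.IH[of j k] less.IH[of k j] less.prems that cinner_commute[of "?e j" "?e k"]
    by (cases "j < k") auto
  have "(\<Sum>j<n. cinner (d n) (?e j) * cinner (?e j) (?e k))
      = (\<Sum>j<n. if j = k then cinner (d n) (?e k) * cinner (?e k) (?e k) else 0)"
    by (rule sum.cong) (auto simp: ort)
  also have "\<dots> = cinner (d n) (?e k) * cinner (?e k) (?e k)"
    using less.prems by simp
  also have "\<dots> = cinner (d n) (?e k)"
    using gram_schmidt_self[of d k] by auto
  finally have "cinner ?v (?e k) = 0"
    by (simp add: cinner_diff_left cinner_sum_left)
  then show ?case
    by (subst gram_schmidt.simps) (simp add: sgn_div_norm)
qed

lemma gram_schmidt_orthogonal: "k \<noteq> n \<Longrightarrow> cinner (gram_schmidt d n) (gram_schmidt d k) = 0"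
  using gram_schmidt_orthogonal_less[of k n d] gram_schmidt_orthogonal_less[of n k d]
    cinner_commute[of "gram_schmidt d n" "gram_schmidt d k"]
  by (cases "k < n") auto

text \<open>\<open>d n\<close> is a combination of the first \<open>n + 1\<close> orthonormalised
  vectors, so totality passes from the old sequence to the new one.\<close>

lemma gram_schmidt_span:
  assumes "\<And>n. cinner x (gram_schmidt d n) = 0"
  shows "cinner x (d n) = 0"
proof -
  let ?v = "d n - (\<Sum>j<n. cinner (d n) (gram_schmidt d j) *\<^sub>C gram_schmidt d j)"
  have scaled: "norm v *\<^sub>R sgn v = v" for v :: "'a L2"
    by (cases "v = 0") (simp_all add: sgn_div_norm)
  have "d n = norm ?v *\<^sub>R gram_schmidt d n + (\<Sum>j<n. cinner (d n) (gram_schmidt d j) *\<^sub>C gram_schmidt d j)"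
    using scaled unfolding gram_schmidt.simps[of d n] by simp
  then have "cinner x (d n) = cinner x \<dots>" by simp
  also have "\<dots> = 0"
    by (simp add: cinner_add_right cinner_sum_right assms)
  finally show ?thesis .
qed

text \<open>Orthogonality and Pythagoras give the Bessel inequality, hence by completeness
  convergence of the expansion. Its limit has the coefficients of \<open>x\<close>, and totality of
  the indicators identifies it with \<open>x\<close>.\<close>

lemma parseval_frame_exists:
  obtains e :: "nat \<Rightarrow> 'g::{haar_group, second_countable_topology} L2" where "parseval_frame e"
proof -
  obtain B :: "'g set set" where B: "countable B" "B \<noteq> {}"
    "\<And>x. (\<And>U. U \<in> B \<Longrightarrow> cinner x (indicator_L2 U) = 0) \<Longrightarrow> x = 0"
    using total_indicators by metis
  define e where "e = gram_schmidt (\<lambda>n. indicator_L2 (from_nat_into B n))"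
  have ort: "k \<noteq> n \<Longrightarrow> cinner (e n) (e k) = 0" for k n
    unfolding e_def by (rule gram_schmidt_orthogonal)
  have self: "e n = 0 \<or> cinner (e n) (e n) = 1" for n
    unfolding e_def by (rule gram_schmidt_self)
  have total: "x = 0" if "\<And>n. cinner x (e n) = 0" for x
  proof (rule B(3))
    fix U assume "U \<in> B"
    then obtain n where "U = from_nat_into B n"
      using from_nat_into_surj[OF B(1)] by metis
    then show "cinner x (indicator_L2 U) = 0"
      using gram_schmidt_span[of x "\<lambda>n. indicator_L2 (from_nat_into B n)" n] that
      by (simp add: e_def)
  qed
  let ?s = "\<lambda>x n. cinner x (e n) *\<^sub>C e n"
  have pair: "cinner (\<Sum>n\<in>A. ?s x n) y = (\<Sum>n\<in>A. cinner x (e n) * cnj (cinner y (e n)))" for A x y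
    unfolding cinner_sum_left cinner_scaleC_left cinner_commute[of "e _" y] ..
  have coef: "cinner (\<Sum>n\<in>A. ?s x n) (e k) = (if k \<in> A then cinner x (e k) else 0)"
    if "finite A" for A x k
  proof -
    have "cinner (\<Sum>n\<in>A. ?s x n) (e k) = (\<Sum>n\<in>A. if n = k then cinner x (e k) else 0)"
      unfolding cinner_sum_left
      by (rule sum.cong) (use ort self[of k] in \<open>auto\<close>)
    then show ?thesis using that by simp
  qed
  have sumsq: "(norm (\<Sum>n\<in>A. ?s x n))\<^sup>2 = (\<Sum>n\<in>A. (cmod (cinner x (e n)))\<^sup>2)" if "finite A" for A x
  proof -
    have "complex_of_real ((norm (\<Sum>n\<in>A. ?s x n))\<^sup>2) = of_real (\<Sum>n\<in>A. (cmod (cinner x (e n)))\<^sup>2)"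
      unfolding cinner_self[symmetric] of_real_sum complex_norm_square
      by (subst pair, rule sum.cong) (use that coef in auto)
    then show ?thesis using of_real_eq_iff by blast
  qed
  have contr: "(\<Sum>n<N. (cmod (cinner x (e n)))\<^sup>2) \<le> (norm x)\<^sup>2" for N x
  proof -
    let ?P = "\<Sum>n<N. ?s x n"
    have "cinner ?P x = cinner ?P ?P"
      unfolding pair[of x "{..<N}" x] pair[of x "{..<N}" ?P] by (simp add: coef)
    then have "cinner ?P (x - ?P) = 0" by (simp add: cinner_diff_right)
    then have "orthogonal ?P (x - ?P)" by (simp add: orthogonal_def inner_L2_def)
    from norm_add_Pythagorean[OF this] have "(norm x)\<^sup>2 = (norm ?P)\<^sup>2 + (norm (x - ?P))\<^sup>2" by simp
    then show ?thesis using sumsq[of "{..<N}" x] by simp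
  qed
  show ?thesis
  proof (rule that[of e], standard)
    fix x :: "'g L2" and N
    have "(norm (\<Sum>n<N. ?s x n))\<^sup>2 \<le> (norm x)\<^sup>2"
      using sumsq[of "{..<N}" x] contr[where N = N and x = x] by simp
    then show "norm (\<Sum>n<N. ?s x n) \<le> norm x" by (rule power2_le_imp_le) simp
  next
    fix x :: "'g L2"
    have sm: "summable (\<lambda>n. (cmod (cinner x (e n)))\<^sup>2)"
      by (rule bounded_imp_summable[of _ "(norm x)\<^sup>2"])
        (use contr[of x "Suc _"] in \<open>auto simp: lessThan_Suc_atMost\<close>)
    have "summable (?s x)"
      unfolding summable_Cauchy
    proof (intro allI impI)
      fix r :: real assume "r > 0"
      then have "r\<^sup>2 > 0" by simp
      then obtain N where N: "\<And>m n. m \<ge> N \<Longrightarrow> norm (\<Sum>n=m..<n. (cmod (cinner x (e n)))\<^sup>2) < r\<^sup>2"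
        using sm unfolding summable_Cauchy by blast
      have "norm (sum (?s x) {m..<n}) < r" if "m \<ge> N" for m n
      proof (rule power_less_imp_less_base[of _ 2])
        show "(norm (sum (?s x) {m..<n}))\<^sup>2 < r\<^sup>2"
          using N[OF that, of n] sumsq[of "{m..<n}" x] by simp
      qed (use \<open>r > 0\<close> in auto)
      then show "\<exists>N. \<forall>m\<ge>N. \<forall>n. norm (sum (?s x) {m..<n}) < r" by blast
    qed
    then obtain y where y: "?s x sums y" by (auto simp: summable_def)
    have "cinner (x - y) (e k) = 0" for k
    proof -
      have "(\<lambda>n. cinner (?s x n) (e k)) sums cinner y (e k)"
        by (rule bounded_linear.sums[OF bounded_linear_cinner_left y])
      moreover have "(\<lambda>n. cinner (?s x n) (e k)) = (\<lambda>n. if n = k then cinner x (e k) else 0)"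
        using ort self[of k] by auto
      ultimately have "cinner y (e k) = cinner x (e k)"
        using sums_single[of k "\<lambda>_. cinner x (e k)"] sums_unique2 by fastforce
      then show ?thesis by (simp add: cinner_diff_left)
    qed
    from total[OF this] have "x = y" by simp
    then show "?s x sums x" using y by simp
  qed
qed

section \<open>Coefficients and reflection of Haar measure\<close>

lemma measurable_uminus_group [measurable (raw)]:
  fixes f :: "'a \<Rightarrow> 'g::topological_group_add"
  assumes "f \<in> borel_measurable M"
  shows "(\<lambda>x. - f x) \<in> borel_measurable M"
  by (rule borel_measurable_continuous_on[OF _ assms]) (intro continuous_intros)

lemma measurable_diff_group [measurable (raw)]:
  fixes f g :: "'a \<Rightarrow> 'g::{topological_group_add, second_countable_topology}"
  assumes [measurable]: "f \<in> borel_measurable M" "g \<in> borel_measurable M"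
  shows "(\<lambda>x. f x - g x) \<in> borel_measurable M"
  unfolding diff_conv_add_uminus by measurable

lemma measurable_coefficient [measurable]:
  "(\<lambda>s. cinner (left_translation s x) y) \<in> borel_measurable
     (haar :: 'g::{haar_group, second_countable_topology} measure)"
  unfolding cinner_left_translation by measurable

lemma cmod_coefficient_le: "cmod (cinner (left_translation s x) y) \<le> norm x * norm y"
  using norm_cinner_le[of "left_translation s x" y] by simp

lemma integrable_mult_coefficient:
  fixes f :: "'g::{haar_group, second_countable_topology} \<Rightarrow> complex"
  assumes "integrable haar f"
  shows "integrable haar (\<lambda>s. f s * cinner (left_translation s x) y)"
    and "cmod (\<integral>s. f s * cinner (left_translation s x) y \<partial>haar) \<le> (\<integral>s. cmod (f s) \<partial>haar) * norm x * norm y"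
proof -
  have [measurable]: "f \<in> borel_measurable haar" using assms by auto
  have le: "cmod (f s * cinner (left_translation s x) y) \<le> cmod (f s) * (norm x * norm y)" for s
    unfolding norm_mult by (intro mult_left_mono cmod_coefficient_le) auto
  show i: "integrable haar (\<lambda>s. f s * cinner (left_translation s x) y)"
  proof (rule Bochner_Integration.integrable_bound)
    show "integrable haar (\<lambda>s. cmod (f s) * (norm x * norm y))" using assms by simp
    show "AE s in haar. norm (f s * cinner (left_translation s x) y) \<le> norm (cmod (f s) * (norm x * norm y))"
      using le by (simp add: abs_mult)
  qed measurable
  have "cmod (\<integral>s. f s * cinner (left_translation s x) y \<partial>haar)
      \<le> (\<integral>s. cmod (f s * cinner (left_translation s x) y) \<partial>haar)" by (rule integral_norm_bound)
  also have "\<dots> \<le> (\<integral>s. cmod (f s) * (norm x * norm y) \<partial>haar)"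
    by (rule integral_mono) (use i le assms in auto)
  finally show "cmod (\<integral>s. f s * cinner (left_translation s x) y \<partial>haar) \<le> (\<integral>s. cmod (f s) \<partial>haar) * norm x * norm y"
    by (simp add: mult.assoc)
qed

section \<open>Reflection of Haar measure\<close>

text \<open>The product of the measures of \<open>-A\<close> and of the group is a double integral
  of \<open>indicator A (- y)\<close>. A left translation of \<open>y\<close> by \<open>x\<close>
  turns the integrand into \<open>indicator A (- y + x)\<close>; after exchanging the integrals,
  left invariance in \<open>x\<close> shows the value \<open>0\<close>. The total mass is
  nonzero.\<close>

lemma haar_null_uminus:
  fixes A :: "'g::{haar_group, second_countable_topology} set"
  assumes [measurable]: "A \<in> sets haar" and null: "emeasure haar A = 0"
  shows "emeasure haar (uminus -` A) = 0"
proof -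
  have [measurable]: "uminus -` A \<in> sets (haar :: 'g measure)"
    using measurable_sets[OF _ assms(1), of uminus haar] by simp
  have "emeasure haar (uminus -` A) * emeasure haar (UNIV :: 'g set)
      = (\<integral>\<^sup>+x. \<integral>\<^sup>+y. indicator A (- y) \<partial>haar \<partial>(haar :: 'g measure))"
  proof -
    have "(\<integral>\<^sup>+y. indicator A (- y) \<partial>haar) = (\<integral>\<^sup>+y. indicator (uminus -` A) y \<partial>haar)"
      by (rule nn_integral_cong) (simp add: indicator_def)
    then show ?thesis by simp
  qed
  also have "\<dots> = (\<integral>\<^sup>+x. \<integral>\<^sup>+y. indicator A (- y + x) \<partial>haar \<partial>(haar :: 'g measure))"
  proof (rule nn_integral_cong)
    fix x :: 'g
    show "(\<integral>\<^sup>+y. indicator A (- y) \<partial>haar) = (\<integral>\<^sup>+y. indicator A (- y + x) \<partial>haar)"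
      by (subst nn_integral_haar_translate[of "\<lambda>y. indicator A (- y + x)" x, symmetric])
        (auto simp: minus_add add.assoc simp del: add_uminus_conv_diff)
  qed
  also have "\<dots> = (\<integral>\<^sup>+y. \<integral>\<^sup>+x. indicator A (- y + x) \<partial>haar \<partial>(haar :: 'g measure))"
    by (rule haar_pair.Fubini') measurable
  also have "\<dots> = 0"
    using null by (subst nn_integral_haar_translate) auto
  finally show ?thesis using haar_nonzero by auto
qed

text \<open>Reflection preserves null sets, so Radon-Nikodym applies. The reflected measure is
  finite on each member of a countable cover by relatively compact sets, so the derivative is finite
  almost everywhere and may be taken real valued.\<close>

lemma inverse_density_exists:
  "\<exists>r. r \<in> borel_measurable haar \<and> (\<forall>x. 0 \<le> r x) \<and>
     distr haar haar uminus =
       density (haar :: 'g::{haar_group, second_countable_topology} measure) (\<lambda>x. ennreal (r x))"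
proof -
  let ?N = "distr haar haar uminus :: 'g measure"
  have "absolutely_continuous haar ?N"
    unfolding absolutely_continuous_def null_sets_def
    by (auto simp: emeasure_distr haar_null_uminus)
  then obtain f where f [measurable]: "f \<in> borel_measurable haar" and N: "density haar f = ?N"
    using haar.Radon_Nikodym[of ?N] by auto
  obtain B :: "'g set set" where B: "countable B" "\<Union>B = UNIV"
    "\<And>U. U \<in> B \<Longrightarrow> open U" "\<And>U. U \<in> B \<Longrightarrow> \<exists>K. compact K \<and> U \<subseteq> K"
    by (rule countable_relatively_compact_pi_system) blast
  have "AE x in haar. f x * indicator U x \<noteq> \<infinity>" if U: "U \<in> B" for U
  proof (rule nn_integral_PInf_AE)
    have [measurable]: "U \<in> sets haar" using B(3)[OF U] by (simp add: sets_haar)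
    show "(\<lambda>x. f x * indicator U x) \<in> borel_measurable haar" by measurable
    obtain K where K: "compact K" "U \<subseteq> K" using B(4)[OF U] by blast
    have "(\<integral>\<^sup>+x. f x * indicator U x \<partial>haar) = emeasure ?N U"
      unfolding N[symmetric] by (simp add: emeasure_density)
    also have "\<dots> = emeasure haar (uminus -` U)"
      by (simp add: emeasure_distr)
    also have "\<dots> < \<infinity>"
    proof (rule emeasure_haar_finite_subset_compact)
      show "compact (uminus ` K)"
        by (intro compact_continuous_image continuous_intros K)
      show "uminus -` U \<subseteq> uminus ` K"
      proof
        fix x assume "x \<in> uminus -` U"
        then have "- x \<in> K" using K(2) by auto
        then show "x \<in> uminus ` K" by (rule image_eqI[rotated]) simp
      qed
    qed
    finally show "(\<integral>\<^sup>+x. f x * indicator U x \<partial>haar) \<noteq> \<infinity>" by simp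
  qed
  then have "AE x in haar. \<forall>U\<in>B. f x * indicator U x \<noteq> \<infinity>"
    using B(1) by (simp add: AE_ball_countable)
  then have fin: "AE x in haar. f x = ennreal (enn2real (f x))"
  proof eventually_elim
    case (elim x)
    have "x \<in> \<Union>B" by (simp add: B(2))
    then obtain U where U: "U \<in> B" "x \<in> U" by auto
    from elim[rule_format, OF U(1)] U(2) have "f x \<noteq> \<infinity>" by simp
    then show ?case by (simp add: less_top)
  qed
  show ?thesis
    by (rule exI[of _ "\<lambda>x. enn2real (f x)"], intro conjI allI)
      (auto simp: N[symmetric] intro!: density_cong fin)
qed

text \<open>The density of the reflected Haar measure, that is, \<open>\<Delta>(x\<inverse>)\<close> for the modular function \<open>\<Delta>\<close>.\<close>

definition inverse_density :: "'g::{haar_group, second_countable_topology} \<Rightarrow> real" where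
  "inverse_density = (SOME r. r \<in> borel_measurable haar \<and> (\<forall>x. 0 \<le> r x) \<and>
     distr haar haar uminus = density haar (\<lambda>x. ennreal (r x)))"

lemma measurable_inverse_density [measurable]: "inverse_density \<in> borel_measurable haar"
  and inverse_density_nonneg [simp]: "0 \<le> inverse_density x"
  and distr_uminus_haar: "distr haar haar uminus = density haar (\<lambda>x. ennreal (inverse_density x))"
  unfolding inverse_density_def using someI_ex[OF inverse_density_exists] by blast+

lemma measurable_uminus_haar [measurable]: "uminus \<in> measurable haar (haar :: 'g::haar_group measure)"
  unfolding measurable_cong_sets[OF sets_haar sets_haar]
  by (intro borel_measurable_continuous_onI continuous_intros)

text \<open>The substitution \<open>s = x - y\<close>: reflection, which costs the density, followed
  by a left translation, which costs nothing.\<close>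

lemma nn_integral_haar_reflect:
  fixes k :: "'g::{haar_group, second_countable_topology} \<Rightarrow> ennreal"
  assumes [measurable]: "k \<in> borel_measurable haar"
  shows "(\<integral>\<^sup>+y. k y \<partial>haar) = (\<integral>\<^sup>+s. ennreal (inverse_density (- x + s)) * k (- s + x) \<partial>haar)"
proof -
  have "(\<integral>\<^sup>+y. k y \<partial>haar) = (\<integral>\<^sup>+y. k (- y) \<partial>distr haar haar uminus)"
    by (subst nn_integral_distr) auto
  also have "\<dots> = (\<integral>\<^sup>+z. ennreal (inverse_density z) * k (- z) \<partial>haar)"
    unfolding distr_uminus_haar by (subst nn_integral_density) auto
  also have "\<dots> = (\<integral>\<^sup>+s. ennreal (inverse_density (- x + s)) * k (- (- x + s)) \<partial>haar)"
    by (rule nn_integral_haar_translate[symmetric]) simp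
  finally show ?thesis by (simp add: minus_add)
qed

lemma integral_haar_reflect:
  fixes k :: "'g::{haar_group, second_countable_topology} \<Rightarrow> complex"
  assumes [measurable]: "k \<in> borel_measurable haar"
  shows "(\<integral>y. k y \<partial>haar) = (\<integral>s. of_real (inverse_density (- x + s)) * k (- s + x) \<partial>haar)"
proof -
  have "(\<integral>y. k y \<partial>haar) = (\<integral>y. k (- y) \<partial>distr haar haar uminus)"
    by (subst integral_distr) auto
  also have "\<dots> = (\<integral>z. of_real (inverse_density z) * k (- z) \<partial>haar)"
    unfolding distr_uminus_haar by (subst integral_density) (auto simp: scaleR_conv_of_real)
  also have "\<dots> = (\<integral>s. of_real (inverse_density (- x + s)) * k (- (- x + s)) \<partial>haar)"
    by (rule integral_haar_translate[symmetric]) simp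
  finally show ?thesis by (simp add: minus_add)
qed

text \<open>The image of the complex measure \<open>f(y) g(x)\<close> under (x, y) \<mapsto>
  xy\<inverse> has an integrable density \<open>h\<close>. Substituting in the inner integral gives
  \<open>h\<close> explicitly, and Fubini applies since the reflected weight preserves the integral
  of \<open>cmod (f y)\<close>. This produces the symbols of averaged rank one operators.\<close>

lemma convolution_with_reflection:
  fixes f g :: "'g::{haar_group, second_countable_topology} \<Rightarrow> complex"
  assumes f: "integrable haar f" and g: "integrable haar g"
  obtains h where "integrable haar h"
    "\<And>F C. F \<in> borel_measurable haar \<Longrightarrow> (\<And>s. cmod (F s) \<le> C) \<Longrightarrow>
       (\<integral>x. g x * (\<integral>y. f y * F (x - y) \<partial>haar) \<partial>haar) = (\<integral>s. h s * F s \<partial>haar)"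
proof -
  have [measurable]: "f \<in> borel_measurable haar" "g \<in> borel_measurable haar"
    using f g by auto
  let ?p = "\<lambda>x s. g x * (of_real (inverse_density (- x + s)) * f (- s + x))"
  have int: "integrable (haar \<Otimes>\<^sub>M haar) (case_prod ?p)"
  proof (rule integrableI_bounded)
    show "case_prod ?p \<in> borel_measurable (haar \<Otimes>\<^sub>M haar)" by measurable
    have "(\<integral>\<^sup>+z. ennreal (norm (case_prod ?p z)) \<partial>(haar \<Otimes>\<^sub>M haar))
        = (\<integral>\<^sup>+x. \<integral>\<^sup>+s. ennreal (norm (?p x s)) \<partial>haar \<partial>haar)"
      by (subst haar.nn_integral_fst[symmetric]) auto
    also have "\<dots> = (\<integral>\<^sup>+x. ennreal (cmod (g x)) *
        (\<integral>\<^sup>+s. ennreal (inverse_density (- x + s)) * ennreal (cmod (f (- s + x))) \<partial>haar) \<partial>haar)"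
      by (intro nn_integral_cong, subst nn_integral_cmult[symmetric])
        (auto simp: norm_mult ennreal_mult)
    also have "\<dots> = (\<integral>\<^sup>+x. ennreal (cmod (g x)) * (\<integral>\<^sup>+y. ennreal (cmod (f y)) \<partial>haar) \<partial>haar)"
      by (intro nn_integral_cong arg_cong2[where f = times] refl nn_integral_haar_reflect[symmetric]) simp
    also have "\<dots> = (\<integral>\<^sup>+x. ennreal (cmod (g x)) \<partial>haar) * (\<integral>\<^sup>+y. ennreal (cmod (f y)) \<partial>haar)"
      by (rule nn_integral_multc) auto
    also have "\<dots> < \<infinity>"
      using f g by (auto simp: integrable_iff_bounded ennreal_mult_less_top)
    finally show "(\<integral>\<^sup>+z. ennreal (norm (case_prod ?p z)) \<partial>(haar \<Otimes>\<^sub>M haar)) < \<infinity>" .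
  qed
  show ?thesis
  proof (rule that[of "\<lambda>s. \<integral>x. ?p x s \<partial>haar"])
    show "integrable haar (\<lambda>s. \<integral>x. ?p x s \<partial>haar)"
      using haar_pair.integrable_snd[OF int] .
    fix F :: "'g \<Rightarrow> complex" and C
    assume [measurable]: "F \<in> borel_measurable haar" and C: "\<And>s. cmod (F s) \<le> C"
    have "integrable (haar \<Otimes>\<^sub>M haar) (\<lambda>z. of_real C * case_prod ?p z)"
      using int by simp
    then have int': "integrable (haar \<Otimes>\<^sub>M haar) (\<lambda>(x, s). ?p x s * F s)"
    proof (rule Bochner_Integration.integrable_bound)
      have "0 \<le> C" using C[of 0] norm_ge_zero order_trans by blast
      then show "AE z in haar \<Otimes>\<^sub>M haar. norm (case z of (x, s) \<Rightarrow> ?p x s * F s)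
          \<le> norm (of_real C * case_prod ?p z)"
        using C by (auto simp: norm_mult mult.commute[of C] intro!: AE_I2 mult_left_mono)
    qed measurable
    have "(\<integral>x. g x * (\<integral>y. f y * F (x - y) \<partial>haar) \<partial>haar)
        = (\<integral>x. \<integral>s. ?p x s * F s \<partial>haar \<partial>haar)"
    proof (rule Bochner_Integration.integral_cong[OF refl])
      fix x
      have "(\<integral>y. f y * F (x - y) \<partial>haar)
          = (\<integral>s. of_real (inverse_density (- x + s)) * (f (- s + x) * F (x - (- s + x))) \<partial>haar)"
        by (rule integral_haar_reflect) simp
      also have "\<dots> = (\<integral>s. of_real (inverse_density (- x + s)) * f (- s + x) * F s \<partial>haar)"
        by (rule Bochner_Integration.integral_cong[OF refl])
          (simp add: diff_conv_add_uminus minus_add add.assoc mult.assoc del: add_uminus_conv_diff)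
      finally show "g x * (\<integral>y. f y * F (x - y) \<partial>haar) = (\<integral>s. ?p x s * F s \<partial>haar)"
        by (simp add: mult.assoc)
    qed
    also have "\<dots> = (\<integral>s. \<integral>x. ?p x s * F s \<partial>haar \<partial>haar)"
      by (rule haar_pair.Fubini_integral[symmetric, OF int'])
    also have "\<dots> = (\<integral>s. (\<integral>x. ?p x s \<partial>haar) * F s \<partial>haar)"
      by simp
    finally show "(\<integral>x. g x * (\<integral>y. f y * F (x - y) \<partial>haar) \<partial>haar)
        = (\<integral>s. (\<integral>x. ?p x s \<partial>haar) * F s \<partial>haar)" .
  qed
qed

section \<open>Normal functionals and the pairing with the Fourier algebra\<close>

lemma left_translation_zero [simp]: "left_translation 0 x = x"
  by (rule L2_eqI) (use AE_rep_left_translation[of 0 x] in simp)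

lemma topspace_weak_star: "topspace (weak_star :: 'g::haar_group op topology) = bounded_operators"
proof -
  have "normal_functional (\<lambda>T :: 'g op. 0)"
    unfolding normal_functional_def
    by (intro exI[of _ "\<lambda>_. 0"]) (auto simp: fun_eq_iff)
  then have "bounded_operators \<in>
      {{T \<in> bounded_operators. \<phi> T \<in> U} |\<phi> (U :: complex set). normal_functional (\<phi> :: 'g op \<Rightarrow> complex) \<and> open U}"
    by (intro CollectI exI[of _ "\<lambda>_. 0"] exI[of _ UNIV]) auto
  then show ?thesis
    unfolding weak_star_def topology_generated_by_topspace by blast
qed

text \<open>Cauchy-Schwarz in each term and then in the sum over \<open>n\<close>. \<open>K\<close>
  is any map with a norm bound, because the estimate is applied to bounded operators as well as to
  \<open>left_translation s\<close>; the assumptions bound partial sums, as Bessel inequalities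
  do.\<close>

lemma cinner_series_bound:
  fixes K :: "'g::haar_group L2 \<Rightarrow> 'g L2"
  assumes K: "\<And>x. norm (K x) \<le> C * norm x" "0 \<le> C"
    and x: "\<And>N. (\<Sum>n<N. (norm (x n))\<^sup>2) \<le> A\<^sup>2" "0 \<le> A"
    and y: "\<And>N. (\<Sum>n<N. (norm (y n))\<^sup>2) \<le> B\<^sup>2" "0 \<le> B"
  shows "(\<Sum>n<N. cmod (cinner (K (x n)) (y n))) \<le> C * A * B"
    and "summable (\<lambda>n. cmod (cinner (K (x n)) (y n)))"
    and "cmod (\<Sum>n. cinner (K (x n)) (y n)) \<le> C * A * B"
proof -
  show fin: "(\<Sum>n<N. cmod (cinner (K (x n)) (y n))) \<le> C * A * B" for N
  proof -
    have "(\<Sum>n<N. cmod (cinner (K (x n)) (y n))) \<le> (\<Sum>n<N. C * (\<bar>norm (x n)\<bar> * \<bar>norm (y n)\<bar>))"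
    proof (rule sum_mono)
      fix n
      have "cmod (cinner (K (x n)) (y n)) \<le> norm (K (x n)) * norm (y n)"
        by (rule norm_cinner_le)
      also have "\<dots> \<le> C * norm (x n) * norm (y n)"
        by (intro mult_right_mono K) auto
      finally show "cmod (cinner (K (x n)) (y n)) \<le> C * (\<bar>norm (x n)\<bar> * \<bar>norm (y n)\<bar>)"
        by (simp add: mult.assoc)
    qed
    also have "\<dots> = C * (\<Sum>n<N. \<bar>norm (x n)\<bar> * \<bar>norm (y n)\<bar>)"
      by (simp add: sum_distrib_left)
    also have "\<dots> \<le> C * (L2_set (\<lambda>n. norm (x n)) {..<N} * L2_set (\<lambda>n. norm (y n)) {..<N})"
      by (intro mult_left_mono L2_set_mult_ineq K)
    also have "\<dots> \<le> C * (A * B)"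
      using x(1)[of N] x(2) y(1)[of N] y(2) K(2) unfolding L2_set_def
      by (intro mult_left_mono mult_mono real_le_lsqrt) (auto intro: sum_nonneg)
    finally show ?thesis by (simp add: mult.assoc)
  qed
  show sm: "summable (\<lambda>n. cmod (cinner (K (x n)) (y n)))"
    by (rule bounded_imp_summable[of _ "C * A * B"])
      (use fin[of "Suc _"] in \<open>auto simp: lessThan_Suc_atMost\<close>)
  have "cmod (\<Sum>n. cinner (K (x n)) (y n)) \<le> (\<Sum>n. cmod (cinner (K (x n)) (y n)))"
    by (rule summable_norm[OF sm])
  also have "\<dots> \<le> C * A * B"
    by (rule suminf_le_const[OF sm fin])
  finally show "cmod (\<Sum>n. cinner (K (x n)) (y n)) \<le> C * A * B" .
qed

lemma normal_functional_bounded_linear: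
  assumes "normal_functional \<phi>"
  shows "bounded_linear \<phi>"
proof -
  obtain x y :: "nat \<Rightarrow> 'a L2" where x: "summable (\<lambda>n. (norm (x n))\<^sup>2)"
    and y: "summable (\<lambda>n. (norm (y n))\<^sup>2)"
    and \<phi>: "\<phi> = (\<lambda>T. \<Sum>n. cinner (T (x n)) (y n))"
    using assms unfolding normal_functional_def by blast
  let ?A = "sqrt (\<Sum>n. (norm (x n))\<^sup>2)" and ?B = "sqrt (\<Sum>n. (norm (y n))\<^sup>2)"
  have A: "(\<Sum>n<N. (norm (x n))\<^sup>2) \<le> ?A\<^sup>2" for N
    using sum_le_suminf[OF x, of "{..<N}"] suminf_nonneg[OF x] by simp
  have B: "(\<Sum>n<N. (norm (y n))\<^sup>2) \<le> ?B\<^sup>2" for N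
    using sum_le_suminf[OF y, of "{..<N}"] suminf_nonneg[OF y] by simp
  have nn: "0 \<le> ?A" "0 \<le> ?B" using suminf_nonneg[OF x] suminf_nonneg[OF y] by auto
  note * = cinner_series_bound[where K = "blinfun_apply T" and C = "norm T" for T,
      OF norm_blinfun norm_ge_zero A nn(1) B nn(2)]
  note sm = summable_norm_cancel[OF *(2)]
  show ?thesis
    unfolding \<phi>
  proof (rule bounded_linear_intro[where K = "?A * ?B"])
    fix S T :: "'a op" and r :: real
    show "(\<Sum>n. cinner ((S + T) (x n)) (y n)) = (\<Sum>n. cinner (S (x n)) (y n)) + (\<Sum>n. cinner (T (x n)) (y n))"
      by (simp add: blinfun.add_left cinner_add_left suminf_add[OF sm sm])
    show "(\<Sum>n. cinner ((r *\<^sub>R T) (x n)) (y n)) = r *\<^sub>R (\<Sum>n. cinner (T (x n)) (y n))"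
      by (simp add: blinfun.scaleR_left suminf_mult[OF sm] scaleR_conv_of_real)
    show "norm (\<Sum>n. cinner (T (x n)) (y n)) \<le> norm T * (?A * ?B)"
      using *(3)[of T] by (simp add: mult.assoc)
  qed
qed

lemma normal_functional_single: "normal_functional (\<lambda>T :: 'g::haar_group op. cinner (T x) y)"
proof -
  have "(\<lambda>T :: 'g op. cinner (T x) y) =
      (\<lambda>T. \<Sum>n. cinner (T (if n = 0 then x else 0)) (if n = 0 then y else 0))"
    by (subst suminf_finite[of "{0}"]) auto
  moreover have "summable (\<lambda>n::nat. (norm (if n = 0 then z else 0))\<^sup>2)" for z :: "'g L2"
    by (rule summable_finite[of "{0}"]) auto
  ultimately show ?thesis
    unfolding normal_functional_def
    by (intro exI[of _ "\<lambda>n. if n = 0 then x else 0"] exI[of _ "\<lambda>n. if n = 0 then y else 0"]) auto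
qed

lemma closed_bounded_operators: "closed (bounded_operators :: 'g::haar_group op set)"
proof -
  have "closed {T :: 'g op. T (c *\<^sub>C x) = c *\<^sub>C T x}" for c x
    by (intro closed_Collect_eq continuous_intros
        bounded_linear.continuous_on[OF bounded_linear_scaleC])
  then have "closed (\<Inter>c. \<Inter>x. {T :: 'g op. T (c *\<^sub>C x) = c *\<^sub>C T x})"
    by (intro closed_INT ballI)
  also have "(\<Inter>c. \<Inter>x. {T :: 'g op. T (c *\<^sub>C x) = c *\<^sub>C T x}) = bounded_operators"
    by (auto simp: bounded_operators_def)
  finally show ?thesis .
qed

lemma reduced_Cstar_subset: "reduced_Cstar \<subseteq> (bounded_operators :: 'g::haar_group op set)"
  unfolding reduced_Cstar_def
  by (rule closure_minimal[OF _ closed_bounded_operators]) (auto simp: L1_operators_def)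

lemma L1_operators_subset: "L1_operators \<subseteq> reduced_Cstar"
  unfolding reduced_Cstar_def by (rule closure_subset)

lemma reduced_Cstar_subset_VN: "reduced_Cstar \<subseteq> VN"
  unfolding VN_def
  by (rule closure_of_subset) (simp add: topspace_weak_star reduced_Cstar_subset)

lemma VN_subset_bounded: "VN \<subseteq> bounded_operators"
  unfolding VN_def using closure_of_subset_topspace[of weak_star] by (simp add: topspace_weak_star)

lemma openin_weak_star_preimage:
  "normal_functional \<phi> \<Longrightarrow> open U \<Longrightarrow> openin weak_star {T \<in> bounded_operators. \<phi> T \<in> U}"
  unfolding weak_star_def by (rule topology_generated_by_Basis) blast

text \<open>Reduces identities on \<open>VN\<close> to the operators \<lambda>(f). Norm continuity
  carries equality to the norm closure. If it failed at a point of the weak* closure, preimages of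
  disjoint neighbourhoods of the two values would form a weak* neighbourhood of that point missing
  \<open>reduced_Cstar\<close>.\<close>

lemma normal_functional_eq_on_VN:
  assumes \<phi>: "normal_functional \<phi>" and \<psi>: "normal_functional \<psi>"
    and eq: "\<And>T. T \<in> L1_operators \<Longrightarrow> \<phi> T = \<psi> T" and T: "T \<in> VN"
  shows "\<phi> T = \<psi> T"
proof (rule ccontr)
  assume "\<phi> T \<noteq> \<psi> T"
  then obtain U V where UV: "open U" "open V" "\<phi> T \<in> U" "\<psi> T \<in> V" "U \<inter> V = {}"
    using hausdorff[of "\<phi> T" "\<psi> T"] by blast
  have cont: "continuous_on UNIV \<phi>" "continuous_on UNIV \<psi>"
    by (intro linear_continuous_on normal_functional_bounded_linear \<phi> \<psi>)+
  have closed: "closed {S. \<phi> S = \<psi> S}"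
    by (intro closed_Collect_eq cont)
  have eq': "\<phi> S = \<psi> S" if "S \<in> reduced_Cstar" for S
    using closure_minimal[OF _ closed, of L1_operators] that eq unfolding reduced_Cstar_def by auto
  let ?W = "{S \<in> bounded_operators. \<phi> S \<in> U} \<inter> {S \<in> bounded_operators. \<psi> S \<in> V}"
  have W: "openin weak_star ?W"
    using \<phi> \<psi> UV by (intro openin_Int openin_weak_star_preimage) auto
  have TW: "T \<in> ?W" using T VN_subset_bounded UV by auto
  have "\<forall>W. T \<in> W \<and> openin weak_star W \<longrightarrow> (\<exists>S. S \<in> reduced_Cstar \<and> S \<in> W)"
    using T unfolding VN_def in_closure_of by (rule conjunct2)
  from this[rule_format, OF conjI[OF TW W]] obtain S where "S \<in> reduced_Cstar" "S \<in> ?W"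
    by (elim exE conjE)
  then show False using eq' UV by auto
qed

text \<open>The description in the definition determines one value: on \<lambda>(f) the number
  \<open>cinner (S x) y\<close> depends on \<open>x\<close> and \<open>y\<close> only through their
  coefficient, and equality of two vector functionals extends to \<open>VN\<close>.\<close>

lemma fourier_pairing_coefficient:
  assumes "T \<in> VN"
  shows "fourier_pairing (coefficient x y) T = cinner (T x) y"
  unfolding fourier_pairing_def
proof (rule the_equality)
  fix c assume "\<exists>x' y'. coefficient x y = coefficient x' y' \<and> c = cinner (T x') y'"
  then obtain x' y' where *: "coefficient x y = coefficient x' y'" "c = cinner (T x') y'" by blast
  have "cinner (S x') y' = cinner (S x) y" if "S \<in> L1_operators" for S
    using that fun_cong[OF *(1)] by (auto simp: L1_operators_def coefficient_def)
  then have "cinner (T x') y' = cinner (T x) y"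
    by (rule normal_functional_eq_on_VN[OF normal_functional_single normal_functional_single _ assms])
  then show "c = cinner (T x) y" using * by simp
qed blast

lemma closedin_weak_star_annihilator:
  assumes "\<And>\<phi>. \<phi> \<in> \<Phi> \<Longrightarrow> normal_functional \<phi>"
  shows "closedin weak_star {T \<in> bounded_operators. \<forall>\<phi>\<in>\<Phi>. \<phi> T = 0}"
proof -
  have "openin weak_star (\<Union>\<phi>\<in>\<Phi>. {T \<in> bounded_operators. \<phi> T \<in> - {0}})"
    by (intro openin_Union) (use openin_weak_star_preimage[OF assms, of _ "- {0}"] in auto)
  moreover have "bounded_operators - {T \<in> bounded_operators. \<forall>\<phi>\<in>\<Phi>. \<phi> T = 0}
      = (\<Union>\<phi>\<in>\<Phi>. {T \<in> bounded_operators. \<phi> T \<in> - {0}})" by auto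
  ultimately show ?thesis
    by (simp add: closedin_def topspace_weak_star)
qed

section \<open>The averaging form\<close>

lemma multiplication_cmult:
  assumes "essentially_bounded a"
  shows "multiplication (\<lambda>t. c * a t) x = c *\<^sub>C multiplication a x"
proof -
  obtain C where "AE t in haar. cmod (a t) \<le> C" using assms by (auto simp: essentially_bounded_def)
  then have "AE t in haar. cmod (c * a t) \<le> cmod c * C"
    by eventually_elim (auto simp: norm_mult intro: mult_left_mono)
  then have b: "essentially_bounded (\<lambda>t. c * a t)" using assms by (auto simp: essentially_bounded_def)
  show ?thesis
    by (rule L2_eqI) (use AE_rep_multiplication[OF assms, of x] AE_rep_multiplication[OF b, of x]
      AE_rep_scaleC[of c "multiplication a x"] in eventually_elim, simp)
qed

lemma multiplication_plus:
  assumes "essentially_bounded a" "essentially_bounded b"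
  shows "multiplication (\<lambda>t. a t + b t) x = multiplication a x + multiplication b x"
proof -
  obtain C D where "AE t in haar. cmod (a t) \<le> C" "AE t in haar. cmod (b t) \<le> D"
    using assms by (auto simp: essentially_bounded_def)
  then have "AE t in haar. cmod (a t + b t) \<le> C + D"
    by eventually_elim (auto intro: norm_triangle_mono)
  then have b: "essentially_bounded (\<lambda>t. a t + b t)" using assms by (auto simp: essentially_bounded_def)
  show ?thesis
    by (rule L2_eqI) (use AE_rep_multiplication[OF assms(1), of x]
      AE_rep_multiplication[OF assms(2), of x] AE_rep_multiplication[OF b, of x]
      AE_rep_plus[of "multiplication a x" "multiplication b x"]
      in eventually_elim, simp add: distrib_right)
qed

context parseval_frame
begin

text \<open>\<open>left_translation (- y) a\<close> is the function r \<mapsto> a(yr), that is, the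
  value at \<open>y\<close> of all right translates of \<open>a\<close> at once. Its
  \<open>n\<close>-th frame coefficient is regarded as a function of \<open>y\<close>, so that it
  can serve as a multiplier.\<close>

definition frame_coeff :: "'g L2 \<Rightarrow> nat \<Rightarrow> 'g \<Rightarrow> complex" where
  "frame_coeff a n y = cinner (left_translation (- y) a) (e n)"

lemma measurable_frame_coeff [measurable]: "frame_coeff a n \<in> borel_measurable haar"
proof -
  have "(\<lambda>y. cinner (left_translation (- y) a) (e n)) \<in> borel_measurable haar"
    by (rule measurable_compose[OF measurable_uminus_haar measurable_coefficient])
  then show ?thesis by (simp add: frame_coeff_def[abs_def])
qed

lemma essentially_bounded_frame_coeff: "essentially_bounded (frame_coeff a n)"
  by (rule essentially_boundedI[where C = "norm a * norm (e n)"])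
    (auto simp: frame_coeff_def cmod_coefficient_le)

text \<open>Parseval for the translates by \<open>- y\<close> and \<open>- x\<close>, both then
  translated by \<open>x\<close>. It factorises the Schur multiplier (x, y) \<mapsto>
  u(xy\<inverse>), \<open>u = coefficient a b\<close>, into functions of one variable.\<close>

lemma frame_coeff_sums:
  "(\<lambda>n. frame_coeff a n y * cnj (frame_coeff b n x)) sums cinner (left_translation (x - y) a) b"
proof -
  have "cinner (left_translation (- y) a) (left_translation (- x) b)
      = cinner (left_translation x (left_translation (- y) a)) (left_translation x (left_translation (- x) b))"
    by simp
  also have "\<dots> = cinner (left_translation (x - y) a) b"
    unfolding left_translation_left_translation by simp
  finally show ?thesis
    using parseval[of "left_translation (- y) a" "left_translation (- x) b"]
    by (simp add: frame_coeff_def)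
qed

lemma frame_coeff_bessel: "(\<Sum>n<N. (cmod (frame_coeff a n y))\<^sup>2) \<le> (norm a)\<^sup>2"
  using bessel[of "left_translation (- y) a" N] by (simp add: frame_coeff_def)

text \<open>The bound is uniform in \<open>N\<close>, \<open>x\<close> and \<open>y\<close>, and so
  supplies the dominating functions wherever the frame series is exchanged with an integral.\<close>

lemma frame_coeff_partial_sum_le:
  "cmod (\<Sum>n<N. frame_coeff a n y * cnj (frame_coeff b n x)) \<le> norm a * norm b"
proof -
  have "cmod (\<Sum>n<N. frame_coeff a n y * cnj (frame_coeff b n x))
      \<le> (\<Sum>n<N. \<bar>cmod (frame_coeff a n y)\<bar> * \<bar>cmod (frame_coeff b n x)\<bar>)"
    by (rule order_trans[OF norm_sum]) (simp add: norm_mult)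
  also have "\<dots> \<le> L2_set (\<lambda>n. cmod (frame_coeff a n y)) {..<N} * L2_set (\<lambda>n. cmod (frame_coeff b n x)) {..<N}"
    by (rule L2_set_mult_ineq)
  also have "\<dots> \<le> norm a * norm b"
    unfolding L2_set_def
    by (intro mult_mono real_le_lsqrt frame_coeff_bessel) (auto intro: sum_nonneg)
  finally show ?thesis .
qed

definition frame_vec :: "'g L2 \<Rightarrow> 'g L2 \<Rightarrow> nat \<Rightarrow> 'g L2" where
  "frame_vec a x n = multiplication (frame_coeff a n) x"

lemma AE_rep_frame_vec: "AE t in haar. rep_L2 (frame_vec a x n) t = frame_coeff a n t * rep_L2 x t"
  unfolding frame_vec_def by (rule AE_rep_multiplication[OF essentially_bounded_frame_coeff])

lemma frame_vec_add: "frame_vec (a + b) x n = frame_vec a x n + frame_vec b x n"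
proof -
  have "frame_coeff (a + b) n = (\<lambda>t. frame_coeff a n t + frame_coeff b n t)"
    by (simp add: frame_coeff_def fun_eq_iff left_translation_add cinner_add_left)
  then show ?thesis
    by (simp add: frame_vec_def multiplication_plus essentially_bounded_frame_coeff)
qed

lemma frame_vec_scaleC: "frame_vec (c *\<^sub>C a) x n = c *\<^sub>C frame_vec a x n"
proof -
  have "frame_coeff (c *\<^sub>C a) n = (\<lambda>t. c * frame_coeff a n t)"
    by (simp add: frame_coeff_def fun_eq_iff left_translation_scaleC)
  then show ?thesis
    by (simp add: frame_vec_def multiplication_cmult essentially_bounded_frame_coeff)
qed

text \<open>Commutativity of multiplications: a masa element next to \<open>K\<close> can be
  absorbed into the test vector.\<close>

lemma frame_vec_multiplication:
  assumes "essentially_bounded g"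
  shows "frame_vec a (multiplication g x) n = multiplication g (frame_vec a x n)"
  unfolding frame_vec_def multiplication_mult[OF assms essentially_bounded_frame_coeff]
    multiplication_mult[OF essentially_bounded_frame_coeff assms]
  by (simp add: mult.commute)

text \<open>The pointwise Bessel inequality for the frame functions, integrated against
  \<open>(cmod (rep_L2 x t))\<^sup>2\<close>. It gives the square summability demanded of the
  sequences in \<open>normal_functional\<close>.\<close>

lemma frame_vec_bessel: "(\<Sum>n<N. (norm (frame_vec a x n))\<^sup>2) \<le> (norm a * norm x)\<^sup>2"
proof -
  have eq: "(norm (frame_vec a x n))\<^sup>2 = (\<integral>t. (cmod (frame_coeff a n t))\<^sup>2 * (cmod (rep_L2 x t))\<^sup>2 \<partial>haar)"
    and int: "integrable haar (\<lambda>t. (cmod (frame_coeff a n t))\<^sup>2 * (cmod (rep_L2 x t))\<^sup>2)" for n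
  proof -
    have ae: "AE t in haar. (cmod (rep_L2 (frame_vec a x n) t))\<^sup>2
        = (cmod (frame_coeff a n t))\<^sup>2 * (cmod (rep_L2 x t))\<^sup>2"
      using AE_rep_frame_vec[of a x n] by eventually_elim (simp add: norm_mult power_mult_distrib)
    show "(norm (frame_vec a x n))\<^sup>2 = (\<integral>t. (cmod (frame_coeff a n t))\<^sup>2 * (cmod (rep_L2 x t))\<^sup>2 \<partial>haar)"
      unfolding norm_power2_eq_integral by (rule integral_cong_AE[OF _ _ ae]) auto
    show "integrable haar (\<lambda>t. (cmod (frame_coeff a n t))\<^sup>2 * (cmod (rep_L2 x t))\<^sup>2)"
      using integrable_cong_AE[OF _ _ ae] by simp
  qed
  have "(\<Sum>n<N. (norm (frame_vec a x n))\<^sup>2)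
      = (\<integral>t. (\<Sum>n<N. (cmod (frame_coeff a n t))\<^sup>2) * (cmod (rep_L2 x t))\<^sup>2 \<partial>haar)"
    unfolding eq sum_distrib_right by (rule Bochner_Integration.integral_sum[symmetric]) (rule int)
  also have "\<dots> \<le> (\<integral>t. (norm a)\<^sup>2 * (cmod (rep_L2 x t))\<^sup>2 \<partial>haar)"
  proof (rule integral_mono)
    show "integrable haar (\<lambda>t. (\<Sum>n<N. (cmod (frame_coeff a n t))\<^sup>2) * (cmod (rep_L2 x t))\<^sup>2)"
      unfolding sum_distrib_right by (intro Bochner_Integration.integrable_sum int)
  qed (auto intro!: frame_coeff_bessel mult_right_mono)
  also have "\<dots> = (norm a * norm x)\<^sup>2"
    by (simp add: norm_power2_eq_integral[of x] power_mult_distrib)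
  finally show ?thesis .
qed

text \<open>For a bounded operator \<open>K\<close> this is the integral of \<open>(K (\<rho>\<^sub>t a \<cdot> x), \<rho>\<^sub>t b \<cdot> y)\<close> over \<open>t\<close>, where
  \<open>\<rho>\<^sub>t a = a(\<cdot> t)\<close>, expanded along the frame; in this form it is visibly weak* continuous in \<open>K\<close>.\<close>

definition averaging_form :: "'g op \<Rightarrow> 'g L2 \<Rightarrow> 'g L2 \<Rightarrow> 'g L2 \<Rightarrow> 'g L2 \<Rightarrow> complex" where
  "averaging_form K x y a b = (\<Sum>n. cinner (K (frame_vec a x n)) (frame_vec b y n))"

lemmas frame_vec_series =
  cinner_series_bound[where x = "frame_vec a x" and y = "frame_vec b y" for a x b y,
    OF _ _ frame_vec_bessel mult_nonneg_nonneg[OF norm_ge_zero norm_ge_zero]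
      frame_vec_bessel mult_nonneg_nonneg[OF norm_ge_zero norm_ge_zero]]

lemmas frame_vec_series_op = frame_vec_series[where K = "blinfun_apply K" for K, OF norm_blinfun norm_ge_zero]

lemma averaging_form_sums:
  fixes K :: "'g op"
  shows "(\<lambda>n. cinner (K (frame_vec a x n)) (frame_vec b y n)) sums averaging_form K x y a b"
  unfolding averaging_form_def
  by (rule summable_sums[OF summable_norm_cancel[OF frame_vec_series_op(2)]])

lemma averaging_form_bound:
  "cmod (averaging_form K x y a b) \<le> norm K * (norm a * norm x) * (norm b * norm y)"
  unfolding averaging_form_def by (rule frame_vec_series_op(3))

lemma normal_averaging_form: "normal_functional (\<lambda>K. averaging_form K x y a b)"
proof -
  have "summable (\<lambda>n. (norm (frame_vec a x n))\<^sup>2)" for a x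
    by (rule bounded_imp_summable[of _ "(norm a * norm x)\<^sup>2"])
      (use frame_vec_bessel[of a x "Suc _"] in \<open>auto simp: lessThan_Suc_atMost\<close>)
  then show ?thesis
    unfolding normal_functional_def averaging_form_def by blast
qed

lemma averaging_form_eqI:
  fixes K :: "'g op"
  shows "(\<lambda>n. cinner (K (frame_vec a x n)) (frame_vec b y n)) sums z \<Longrightarrow> averaging_form K x y a b = z"
  by (rule sums_unique2[OF averaging_form_sums])

lemma averaging_form_add_left:
  "averaging_form K x y (a + a') b = averaging_form K x y a b + averaging_form K x y a' b"
  by (rule averaging_form_eqI) (simp add: frame_vec_add blinfun.add_right cinner_add_left
      sums_add[OF averaging_form_sums averaging_form_sums])

lemma averaging_form_add_right:
  "averaging_form K x y a (b + b') = averaging_form K x y a b + averaging_form K x y a b'"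
  by (rule averaging_form_eqI) (simp add: frame_vec_add cinner_add_right
      sums_add[OF averaging_form_sums averaging_form_sums])

lemma averaging_form_scaleC_left:
  assumes "K \<in> bounded_operators"
  shows "averaging_form K x y (c *\<^sub>C a) b = c * averaging_form K x y a b"
  by (rule averaging_form_eqI) (use assms in \<open>simp add: frame_vec_scaleC bounded_operators_def
      sums_mult[OF averaging_form_sums]\<close>)

lemma averaging_form_scaleC_right:
  "averaging_form K x y a (c *\<^sub>C b) = cnj c * averaging_form K x y a b"
  by (rule averaging_form_eqI) (simp add: frame_vec_scaleC sums_mult[OF averaging_form_sums])

lemma averaging_form_diff:
  "averaging_form (K - K') x y a b = averaging_form K x y a b - averaging_form K' x y a b"
  by (rule averaging_form_eqI) (simp add: blinfun.diff_left cinner_diff_left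
      sums_diff[OF averaging_form_sums averaging_form_sums])

lemma averaging_form_plus:
  "averaging_form (K + K') x y a b = averaging_form K x y a b + averaging_form K' x y a b"
  by (rule averaging_form_eqI) (simp add: blinfun.add_left cinner_add_left
      sums_add[OF averaging_form_sums averaging_form_sums])

lemma averaging_form_scaleC_op:
  "averaging_form (scaleC_op c K) x y a b = c * averaging_form K x y a b"
  by (rule averaging_form_eqI) (simp add: scaleC_op_apply sums_mult[OF averaging_form_sums])

lemma averaging_form_zero [simp]: "averaging_form 0 x y a b = 0"
  by (rule averaging_form_eqI) simp

end

section \<open>Averaging compact operators\<close>

definition rank_one :: "'g::haar_group L2 \<Rightarrow> 'g L2 \<Rightarrow> 'g op" where
  "rank_one z w = Blinfun (\<lambda>x. cinner x w *\<^sub>C z)"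

lemma rank_one_apply: "rank_one z w x = cinner x w *\<^sub>C z"
proof -
  have "bounded_linear (\<lambda>x. cinner x w *\<^sub>C z)"
  proof (rule bounded_linear_intro[where K = "norm w * norm z"])
    show "norm (cinner x w *\<^sub>C z) \<le> norm x * (norm w * norm z)" for x
      using mult_right_mono[OF norm_cinner_le[of x w] norm_ge_zero[of z]] by (simp add: mult.assoc)
  qed (simp_all add: cinner_add_left scaleC_add_left scaleR_L2_def)
  then show ?thesis by (simp add: rank_one_def bounded_linear_Blinfun_apply)
qed

definition finite_rank_operators :: "'g::haar_group op set" where
  "finite_rank_operators = {\<Sum>n<N. rank_one (z n) (w n) |(N :: nat) z w. True}"

lemma bounded_operators_sum:
  "(\<And>i. i \<in> A \<Longrightarrow> f i \<in> bounded_operators) \<Longrightarrow> (\<Sum>i\<in>A. f i) \<in> bounded_operators"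
proof (induction A rule: infinite_finite_induct)
  case (insert i A)
  then show ?case
    by (simp add: bounded_operators_def blinfun.add_left scaleC_add_right)
qed (auto simp: bounded_operators_def)

lemma rank_one_bounded: "rank_one z w \<in> bounded_operators"
  by (simp add: bounded_operators_def rank_one_apply)

lemma finite_rank_operators_subset: "finite_rank_operators \<subseteq> bounded_operators"
  unfolding finite_rank_operators_def by (auto intro!: bounded_operators_sum rank_one_bounded)

lemma norm_operator_le_of_cinner:
  fixes T :: "'g::haar_group op"
  assumes "\<And>x y. cmod (cinner (T x) y) \<le> C * norm x * norm y" "0 \<le> C"
  shows "norm T \<le> C"
proof (rule norm_blinfun_bound[OF assms(2)])
  fix x
  show "norm (T x) \<le> C * norm x"
  proof (cases "T x = 0")
    case False
    have "(norm (T x))\<^sup>2 = cmod (cinner (T x) (T x))"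
      by (simp add: cinner_self norm_power)
    also have "\<dots> \<le> C * norm x * norm (T x)" by (rule assms(1))
    finally show ?thesis using False by (simp add: power2_eq_square)
  qed (use assms(2) in simp)
qed

context parseval_frame
begin

text \<open>The frame partial sums \<open>P N\<close> are contractions converging pointwise to the
  identity, hence uniformly on the totally bounded image of the unit ball. The approximants are
  \<open>P N\<close> after \<open>K\<close>, written with the adjoint \<open>S\<close> as sums of
  rank one operators.\<close>

lemma compact_subset_closure_finite_rank: "(compact_operators :: 'g op set) \<subseteq> closure finite_rank_operators"
proof
  fix K :: "'g op" assume K: "K \<in> compact_operators"
  then have Kb: "K \<in> bounded_operators" and Kc: "compact (closure (K ` ball 0 1))"
    by (auto simp: compact_operators_def)
  obtain S :: "'g op" where S: "\<And>x y. cinner (K x) y = cinner x (S y)"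
    using adjoint_operator[OF Kb] by metis
  define F where "F N = (\<Sum>n<N. rank_one (e n) (S (e n)))" for N
  define P where "P N x = (\<Sum>n<N. cinner x (e n) *\<^sub>C e n)" for N x
  have F: "F N x = P N (K x)" for N x
    by (simp add: F_def P_def blinfun.sum_left rank_one_apply S)
  have P_diff: "P N (x - y) = P N x - P N y" for N x y
    unfolding P_def sum_subtractf[symmetric]
    by (rule sum.cong) (auto simp: cinner_diff_left intro!: cinner_ext simp: left_diff_distrib)
  have P_le: "norm (P N x) \<le> norm x" for N x
    unfolding P_def by (rule frame_contraction)
  have P_lim: "(\<lambda>N. P N x) \<longlonglongrightarrow> x" for x
    using frame_sums[of x] by (simp add: sums_def P_def)
  show "K \<in> closure finite_rank_operators"
    unfolding closure_approachable
  proof (intro allI impI)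
    fix r :: real assume "r > 0"
    \<comment> \<open>Three errors of size \<open>d\<close> bound the difference on the open unit
      ball; rescaling to vectors of norm \<open>1 / 2\<close> doubles this to \<open>6 * d\<close>,
      which is below \<open>r\<close>.\<close>
    define d where "d = r / 9"
    have d: "d > 0" using \<open>r > 0\<close> by (simp add: d_def)
    obtain k where k: "finite k" "closure (K ` ball 0 1) \<subseteq> (\<Union>y\<in>k. ball y d)"
      using Kc d unfolding compact_eq_totally_bounded by blast
    have "\<forall>\<^sub>F N in sequentially. \<forall>y\<in>k. dist (P N y) y < d"
      using k(1) by (intro eventually_ball_finite ballI tendstoD P_lim d)
    then obtain N where N: "\<And>y. y \<in> k \<Longrightarrow> norm (P N y - y) < d"
      unfolding eventually_sequentially dist_norm by blast
    have ball: "norm (F N x - K x) \<le> 3 * d" if "norm x < 1" for x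
    proof -
      have "K x \<in> closure (K ` ball 0 1)"
        using that closure_subset by (force simp: dist_norm)
      then obtain y where y: "y \<in> k" "norm (K x - y) < d"
        using k(2) by (auto simp: dist_norm norm_minus_commute)
      have "F N x - K x = P N (K x - y) + (P N y - y) - (K x - y)"
        by (simp add: F P_diff)
      also have "norm \<dots> \<le> norm (P N (K x - y)) + norm (P N y - y) + norm (K x - y)"
        by (intro order_trans[OF norm_triangle_ineq4] add_right_mono norm_triangle_ineq)
      also have "\<dots> \<le> 3 * d" using P_le[of N "K x - y"] y N[of y] by simp
      finally show ?thesis .
    qed
    have "norm (F N - K) \<le> 6 * d"
    proof (rule norm_blinfun_bound)
      fix x
      show "norm ((F N - K) x) \<le> 6 * d * norm x"
      proof (cases "x = 0")
        case False
        let ?c = "1 / (2 * norm x)"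
        have "norm (F N (?c *\<^sub>R x) - K (?c *\<^sub>R x)) \<le> 3 * d"
          using False by (intro ball) simp
        also have "F N (?c *\<^sub>R x) - K (?c *\<^sub>R x) = ?c *\<^sub>R (F N - K) x"
          by (simp add: blinfun.scaleR_right blinfun.diff_left scaleR_diff_right)
        finally have "?c * norm ((F N - K) x) \<le> 3 * d"
          by simp
        then show ?thesis using False by (simp add: field_simps)
      qed simp
    qed (use d in simp)
    then have "dist (F N) K < r"
      using \<open>r > 0\<close> by (simp add: dist_norm d_def)
    moreover have "F N \<in> finite_rank_operators"
      unfolding finite_rank_operators_def F_def
      by (intro CollectI exI[of _ N] exI[of _ e] exI[of _ "\<lambda>n. S (e n)"]) simp
    ultimately show "\<exists>y\<in>finite_rank_operators. dist y K < r" by blast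
  qed
qed

text \<open>Translation by \<open>s\<close> relates the points t and s\<inverse>t only, and
  t(s\<inverse>t)\<inverse> = s. Schur multiplication by u(st\<inverse>) therefore multiplies this
  operator by the number u(s). The exchange of sum and integral is dominated by a multiple of
  \<open>cmod (w t)\<close>.\<close>

lemma frame_vec_translation_sums:
  "(\<lambda>n. cinner (left_translation s (frame_vec a x n)) (frame_vec b y n)) sums
     (cinner (left_translation s a) b * cinner (left_translation s x) y)"
proof -
  define w where "w t = rep_L2 x (- s + t) * cnj (rep_L2 y t)" for t
  have w [measurable]: "w \<in> borel_measurable haar" and wi: "integrable haar w"
    unfolding w_def using integrable_left_translation_cnj by auto
  define c where "c n t = frame_coeff a n (- s + t) * cnj (frame_coeff b n t)" for n t
  have [measurable]: "c n \<in> borel_measurable haar" for n unfolding c_def by measurable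
  have tm: "cinner (left_translation s (frame_vec a x n)) (frame_vec b y n) = (\<integral>t. c n t * w t \<partial>haar)"
    and int: "integrable haar (\<lambda>t. c n t * w t)" for n
  proof -
    have ae: "AE t in haar. rep_L2 (left_translation s (frame_vec a x n)) t
        = frame_coeff a n (- s + t) * rep_L2 x (- s + t)"
      using AE_rep_left_translation[of s "frame_vec a x n"]
        AE_haar_translate[OF AE_rep_frame_vec[of a x n], of "- s"]
      by eventually_elim simp
    have eq: "frame_coeff a n (- s + t) * rep_L2 x (- s + t) * cnj (frame_coeff b n t * rep_L2 y t)
        = c n t * w t" for t
      by (simp add: c_def w_def)
    note * = cinner_eq_integral_AE[OF ae AE_rep_frame_vec[of b y n], unfolded eq]
    show "cinner (left_translation s (frame_vec a x n)) (frame_vec b y n) = (\<integral>t. c n t * w t \<partial>haar)"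
      by (rule *) measurable
    show "integrable haar (\<lambda>t. c n t * w t)"
      by (rule *) measurable
  qed
  have "(\<lambda>N. \<integral>t. (\<Sum>n<N. c n t) * w t \<partial>haar) \<longlonglongrightarrow> (\<integral>t. cinner (left_translation s a) b * w t \<partial>haar)"
  proof (rule integral_dominated_convergence[where w = "\<lambda>t. norm a * norm b * cmod (w t)"])
    show "integrable haar (\<lambda>t. norm a * norm b * cmod (w t))"
      using wi by simp
    show "AE t in haar. (\<lambda>N. (\<Sum>n<N. c n t) * w t) \<longlonglongrightarrow> cinner (left_translation s a) b * w t"
    proof (rule AE_I2, rule tendsto_mult_right)
      fix t
      have "t - (- s + t) = s"
        by (simp add: diff_conv_add_uminus minus_add add.assoc del: add_uminus_conv_diff)
      then show "(\<lambda>N. \<Sum>n<N. c n t) \<longlonglongrightarrow> cinner (left_translation s a) b"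
        using frame_coeff_sums[of a "- s + t" b t] by (simp add: sums_def c_def)
    qed
    show "AE t in haar. norm ((\<Sum>n<N. c n t) * w t) \<le> norm a * norm b * cmod (w t)" for N
      unfolding norm_mult c_def
      by (intro AE_I2 mult_right_mono frame_coeff_partial_sum_le) auto
  qed measurable
  moreover have "(\<integral>t. (\<Sum>n<N. c n t) * w t \<partial>haar)
      = (\<Sum>n<N. cinner (left_translation s (frame_vec a x n)) (frame_vec b y n))" for N
    unfolding tm sum_distrib_right by (rule Bochner_Integration.integral_sum) (rule int)
  ultimately show ?thesis
    by (simp add: sums_def cinner_left_translation[of s x y] w_def)
qed

text \<open>The formula for single translations integrated against \<open>f\<close>. With
  \<open>x\<close> and \<open>y\<close> fixed it says that averaging replaces the symbol
  \<open>f\<close> by its product with \<open>coefficient x y\<close>.\<close>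

lemma averaging_form_L1:
  fixes T :: "'g op"
  assumes f: "integrable haar f"
    and T: "\<And>x y. cinner (T x) y = (\<integral>s. f s * cinner (left_translation s x) y \<partial>haar)"
  shows "averaging_form T x y a b =
    (\<integral>s. f s * (cinner (left_translation s a) b * cinner (left_translation s x) y) \<partial>haar)"
proof -
  have [measurable]: "f \<in> borel_measurable haar" using f by auto
  let ?q = "\<lambda>n s. cinner (left_translation s (frame_vec a x n)) (frame_vec b y n)"
  \<comment> \<open>The factor \<open>1\<close> is the norm bound of
    \<open>left_translation s\<close>, in the shape expected by
    \<open>frame_vec_series\<close>.\<close>
  define C where "C = 1 * (norm a * norm x) * (norm b * norm y)"
  have "(\<lambda>N. \<integral>s. f s * (\<Sum>n<N. ?q n s) \<partial>haar) \<longlonglongrightarrow>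
      (\<integral>s. f s * (cinner (left_translation s a) b * cinner (left_translation s x) y) \<partial>haar)"
  proof (rule integral_dominated_convergence[where w = "\<lambda>s. cmod (f s) * C"])
    show "integrable haar (\<lambda>s. cmod (f s) * C)" using f by simp
    show "AE s in haar. (\<lambda>N. f s * (\<Sum>n<N. ?q n s)) \<longlonglongrightarrow>
        f s * (cinner (left_translation s a) b * cinner (left_translation s x) y)"
      using frame_vec_translation_sums by (intro AE_I2 tendsto_mult_left) (simp add: sums_def)
    show "AE s in haar. norm (f s * (\<Sum>n<N. ?q n s)) \<le> cmod (f s) * C" for N
    proof (rule AE_I2)
      fix s
      have "cmod (\<Sum>n<N. ?q n s) \<le> (\<Sum>n<N. cmod (?q n s))" by (rule norm_sum)
      also have "\<dots> \<le> C"
        unfolding C_def by (rule frame_vec_series(1)) auto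
      finally show "norm (f s * (\<Sum>n<N. ?q n s)) \<le> cmod (f s) * C"
        by (simp add: norm_mult mult_left_mono)
    qed
  qed measurable
  moreover have "(\<integral>s. f s * (\<Sum>n<N. ?q n s) \<partial>haar) = (\<Sum>n<N. cinner (T (frame_vec a x n)) (frame_vec b y n))" for N
    unfolding T sum_distrib_left
    by (rule Bochner_Integration.integral_sum) (rule integrable_mult_coefficient[OF f])
  ultimately show ?thesis
    by (intro averaging_form_eqI) (simp add: sums_def)
qed

text \<open>\<open>rank_one z w\<close> has the kernel \<open>rep_L2 z s * cnj (rep_L2 w t)\<close>,
  which averaging multiplies by u(st\<inverse>). The limit is taken in the inner integral for each
  \<open>s\<close>, then in the outer one, dominated through the bound \<open>le\<close> that is
  uniform in \<open>s\<close>.\<close>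

lemma averaging_form_rank_one:
  "averaging_form (rank_one z w) x y a b =
    (\<integral>s. rep_L2 z s * cnj (rep_L2 y s) *
      (\<integral>t. rep_L2 x t * cnj (rep_L2 w t) * cinner (left_translation (s - t) a) b \<partial>haar) \<partial>haar)"
proof -
  define f where "f t = rep_L2 x t * cnj (rep_L2 w t)" for t
  define g where "g s = rep_L2 z s * cnj (rep_L2 y s)" for s
  have f: "integrable haar f" and g: "integrable haar g" unfolding f_def g_def by auto
  have [measurable]: "f \<in> borel_measurable haar" "g \<in> borel_measurable haar" using f g by auto
  let ?D = "\<lambda>N s t. \<Sum>n<N. frame_coeff a n t * cnj (frame_coeff b n s)"
  let ?u = "\<lambda>s. cinner (left_translation s a) b"
  have [measurable]: "(\<lambda>t. ?u (s - t)) \<in> borel_measurable haar" for s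
    by (rule measurable_compose[OF _ measurable_coefficient]) measurable
  have D_int: "integrable haar (\<lambda>t. f t * ?D N s t)" for N s
  proof (rule Bochner_Integration.integrable_bound)
    show "integrable haar (\<lambda>t. f t * of_real (norm a * norm b))" using f by simp
    show "AE t in haar. norm (f t * ?D N s t) \<le> norm (f t * of_real (norm a * norm b))"
      by (intro AE_I2) (auto simp: norm_mult simp flip: of_real_mult
          intro!: mult_left_mono frame_coeff_partial_sum_le)
  qed measurable
  have le: "cmod (\<integral>t. f t * ?D N s t \<partial>haar) \<le> norm a * norm b * (\<integral>t. cmod (f t) \<partial>haar)" for N s
  proof -
    have "cmod (\<integral>t. f t * ?D N s t \<partial>haar) \<le> (\<integral>t. cmod (f t * ?D N s t) \<partial>haar)"
      by (rule integral_norm_bound)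
    also have "\<dots> \<le> (\<integral>t. norm a * norm b * cmod (f t) \<partial>haar)"
    proof (rule integral_mono)
      show "cmod (f t * ?D N s t) \<le> norm a * norm b * cmod (f t)" for t
        using mult_left_mono[OF frame_coeff_partial_sum_le[of a t b s N] norm_ge_zero[of "f t"]]
        by (simp add: norm_mult mult.commute)
    qed (use D_int f in auto)
    finally show ?thesis by simp
  qed
  have inner_lim: "(\<lambda>N. \<integral>t. f t * ?D N s t \<partial>haar) \<longlonglongrightarrow> (\<integral>t. f t * ?u (s - t) \<partial>haar)" for s
  proof (rule integral_dominated_convergence[where w = "\<lambda>t. cmod (f t) * (norm a * norm b)"])
    show "integrable haar (\<lambda>t. cmod (f t) * (norm a * norm b))" using f by simp
    show "AE t in haar. (\<lambda>N. f t * ?D N s t) \<longlonglongrightarrow> f t * ?u (s - t)"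
      using frame_coeff_sums by (intro AE_I2 tendsto_mult_left) (simp add: sums_def)
    show "AE t in haar. norm (f t * ?D N s t) \<le> cmod (f t) * (norm a * norm b)" for N
      unfolding norm_mult by (intro AE_I2 mult_left_mono frame_coeff_partial_sum_le) auto
  qed measurable
  have "(\<lambda>N. \<integral>s. g s * (\<integral>t. f t * ?D N s t \<partial>haar) \<partial>haar) \<longlonglongrightarrow>
      (\<integral>s. g s * (\<integral>t. f t * ?u (s - t) \<partial>haar) \<partial>haar)"
  proof (rule integral_dominated_convergence[where w = "\<lambda>s. cmod (g s) * (norm a * norm b * (\<integral>t. cmod (f t) \<partial>haar))"])
    show "integrable haar (\<lambda>s. cmod (g s) * (norm a * norm b * (\<integral>t. cmod (f t) \<partial>haar)))"
      using g by simp
    show "AE s in haar. (\<lambda>N. g s * (\<integral>t. f t * ?D N s t \<partial>haar)) \<longlonglongrightarrow> g s * (\<integral>t. f t * ?u (s - t) \<partial>haar)"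
      by (intro AE_I2 tendsto_mult_left inner_lim)
    show "AE s in haar. norm (g s * (\<integral>t. f t * ?D N s t \<partial>haar))
        \<le> cmod (g s) * (norm a * norm b * (\<integral>t. cmod (f t) \<partial>haar))" for N
      unfolding norm_mult by (intro AE_I2 mult_left_mono le) auto
    show "(\<lambda>s. g s * (\<integral>t. f t * ?D N s t \<partial>haar)) \<in> borel_measurable haar" for N
      by measurable
    have "(\<lambda>(s, t). ?u (s - t)) \<in> borel_measurable (haar \<Otimes>\<^sub>M haar)"
      unfolding case_prod_beta
      by (rule measurable_compose[OF _ measurable_coefficient]) measurable
    then show "(\<lambda>s. g s * (\<integral>t. f t * ?u (s - t) \<partial>haar)) \<in> borel_measurable haar"
      by measurable
  qed
  moreover have "(\<integral>s. g s * (\<integral>t. f t * ?D N s t \<partial>haar) \<partial>haar)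
      = (\<Sum>n<N. cinner (rank_one z w (frame_vec a x n)) (frame_vec b y n))" for N
  proof -
    have fc: "cinner (frame_vec a x n) w = (\<integral>t. f t * frame_coeff a n t \<partial>haar)"
      and fi: "integrable haar (\<lambda>t. f t * frame_coeff a n t)" for n
    proof -
      have eq: "frame_coeff a n t * rep_L2 x t * cnj (rep_L2 w t) = f t * frame_coeff a n t" for t
        by (simp add: f_def)
      note * = cinner_eq_integral_AE[OF AE_rep_frame_vec[of a x n] AE_I2[OF refl], of w, unfolded eq]
      show "cinner (frame_vec a x n) w = (\<integral>t. f t * frame_coeff a n t \<partial>haar)"
        by (rule *) measurable
      show "integrable haar (\<lambda>t. f t * frame_coeff a n t)" by (rule *) measurable
    qed
    have gc: "cinner z (frame_vec b y n) = (\<integral>s. g s * cnj (frame_coeff b n s) \<partial>haar)"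
      and gi: "integrable haar (\<lambda>s. g s * cnj (frame_coeff b n s))" for n
    proof -
      have eq: "rep_L2 z s * cnj (frame_coeff b n s * rep_L2 y s) = g s * cnj (frame_coeff b n s)" for s
        by (simp add: g_def)
      note * = cinner_eq_integral_AE[OF AE_I2[OF refl] AE_rep_frame_vec[of b y n], of z, unfolded eq]
      show "cinner z (frame_vec b y n) = (\<integral>s. g s * cnj (frame_coeff b n s) \<partial>haar)"
        by (rule *) measurable
      show "integrable haar (\<lambda>s. g s * cnj (frame_coeff b n s))" by (rule *) measurable
    qed
    have "(\<integral>t. f t * ?D N s t \<partial>haar) = (\<Sum>n<N. cnj (frame_coeff b n s) * cinner (frame_vec a x n) w)" for s
    proof -
      have "(\<integral>t. f t * ?D N s t \<partial>haar) = (\<integral>t. (\<Sum>n<N. cnj (frame_coeff b n s) * (f t * frame_coeff a n t)) \<partial>haar)"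
        by (simp add: sum_distrib_left mult_ac)
      also have "\<dots> = (\<Sum>n<N. \<integral>t. cnj (frame_coeff b n s) * (f t * frame_coeff a n t) \<partial>haar)"
        by (rule Bochner_Integration.integral_sum) (use fi in simp)
      finally show ?thesis by (simp add: fc)
    qed
    then have "(\<integral>s. g s * (\<integral>t. f t * ?D N s t \<partial>haar) \<partial>haar)
        = (\<integral>s. (\<Sum>n<N. cinner (frame_vec a x n) w * (g s * cnj (frame_coeff b n s))) \<partial>haar)"
      by (simp add: sum_distrib_left mult_ac)
    also have "\<dots> = (\<Sum>n<N. \<integral>s. cinner (frame_vec a x n) w * (g s * cnj (frame_coeff b n s)) \<partial>haar)"
      by (rule Bochner_Integration.integral_sum) (use gi in simp)
    finally show ?thesis by (simp add: gc rank_one_apply)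
  qed
  ultimately have "averaging_form (rank_one z w) x y a b = (\<integral>s. g s * (\<integral>t. f t * ?u (s - t) \<partial>haar) \<partial>haar)"
    by (intro averaging_form_eqI) (simp add: sums_def)
  then show ?thesis by (simp add: f_def g_def)
qed

lemma averaging_form_sum:
  "averaging_form (\<Sum>i\<in>A. K i) x y a b = (\<Sum>i\<in>A. averaging_form (K i) x y a b)"
  by (rule linear_sum[OF bounded_linear.linear[OF normal_functional_bounded_linear[OF normal_averaging_form]]])

text \<open>For \<open>K \<in> bounded_operators\<close> the form is sesquilinear and bounded in
  \<open>a\<close>, \<open>b\<close>, so the Riesz theorem supplies such an operator; it is unique
  by \<open>cinner_ext\<close>.\<close>

definition averaging_op :: "'g op \<Rightarrow> 'g L2 \<Rightarrow> 'g L2 \<Rightarrow> 'g op" where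
  "averaging_op K x y =
     (SOME T. T \<in> bounded_operators \<and> (\<forall>a b. cinner (T a) b = averaging_form K x y a b))"

lemma averaging_op:
  assumes "K \<in> bounded_operators"
  shows "averaging_op K x y \<in> bounded_operators"
    and "cinner (averaging_op K x y a) b = averaging_form K x y a b"
proof -
  have "cmod (averaging_form K x y a b) \<le> (norm K * norm x * norm y) * norm a * norm b" for a b
    using averaging_form_bound[of K x y a b] by (simp add: mult_ac)
  then obtain T :: "'g op" where "T \<in> bounded_operators" "\<And>a b. cinner (T a) b = averaging_form K x y a b"
    by (rule sesquilinear_form_operator[of "averaging_form K x y" "norm K * norm x * norm y", rotated 4])
      (auto simp: averaging_form_add_left averaging_form_add_right averaging_form_scaleC_left[OF assms]
        averaging_form_scaleC_right)
  then have "\<exists>T :: 'g op. T \<in> bounded_operators \<and> (\<forall>a b. cinner (T a) b = averaging_form K x y a b)"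
    by blast
  from someI_ex[OF this]
  show "averaging_op K x y \<in> bounded_operators"
    "cinner (averaging_op K x y a) b = averaging_form K x y a b"
    unfolding averaging_op_def by blast+
qed

text \<open>For a rank one summand the double integral involves \<open>a\<close> and
  \<open>b\<close> only through their coefficient at \<open>s - t\<close>. The convolution lemma
  collapses it to one integral with an integrable symbol that does not depend on \<open>a\<close>
  and \<open>b\<close>.\<close>

lemma averaging_op_finite_rank:
  assumes "F \<in> finite_rank_operators"
  shows "averaging_op F x y \<in> L1_operators"
proof -
  obtain N :: nat and z w where F: "F = (\<Sum>n<N. rank_one (z n) (w n))"
    using assms by (auto simp: finite_rank_operators_def)
  have "\<exists>h. integrable haar h \<and> (\<forall>a b. averaging_form (rank_one (z n) (w n)) x y a b
      = (\<integral>s. h s * cinner (left_translation s a) b \<partial>haar))" for n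
  proof -
    obtain h where h: "integrable haar h" "\<And>F C. F \<in> borel_measurable haar \<Longrightarrow> (\<And>s. cmod (F s) \<le> C) \<Longrightarrow>
      (\<integral>s. rep_L2 (z n) s * cnj (rep_L2 y s) * (\<integral>t. rep_L2 x t * cnj (rep_L2 (w n) t) * F (s - t) \<partial>haar) \<partial>haar)
      = (\<integral>s. h s * F s \<partial>haar)"
      using convolution_with_reflection[OF integrable_rep_cnj[of x "w n"] integrable_rep_cnj[of "z n" y]]
      by blast
    have "averaging_form (rank_one (z n) (w n)) x y a b
        = (\<integral>s. h s * cinner (left_translation s a) b \<partial>haar)" for a b
      unfolding averaging_form_rank_one
      by (rule h(2)[OF measurable_coefficient cmod_coefficient_le])
    then show ?thesis using h(1) by blast
  qed
  then obtain h where h: "\<And>n. integrable haar (h n)"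
    "\<And>n a b. averaging_form (rank_one (z n) (w n)) x y a b
      = (\<integral>s. h n s * cinner (left_translation s a) b \<partial>haar)" by metis
  have Fb: "F \<in> bounded_operators" using assms finite_rank_operators_subset by blast
  have "cinner (averaging_op F x y a) b = (\<integral>s. (\<Sum>n<N. h n s) * cinner (left_translation s a) b \<partial>haar)" for a b
  proof -
    have "cinner (averaging_op F x y a) b = averaging_form F x y a b" by (rule averaging_op(2)[OF Fb])
    also have "\<dots> = (\<integral>s. (\<Sum>n<N. h n s) * cinner (left_translation s a) b \<partial>haar)"
      unfolding F averaging_form_sum h(2) sum_distrib_right
      by (rule Bochner_Integration.integral_sum[symmetric]) (rule integrable_mult_coefficient[OF h(1)])
    finally show ?thesis .
  qed
  moreover have "integrable haar (\<lambda>s. \<Sum>n<N. h n s)" using h(1) by simp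
  ultimately show ?thesis
    unfolding L1_operators_def using averaging_op(1)[OF Fb] by blast
qed

lemma averaging_op_compact:
  assumes "K \<in> compact_operators"
  shows "averaging_op K x y \<in> reduced_Cstar"
  unfolding reduced_Cstar_def closure_approachable
proof (intro allI impI)
  fix r :: real assume "r > 0"
  let ?C = "norm x * norm y"
  \<comment> \<open>Averaging is Lipschitz in \<open>K\<close> with constant \<open>?C\<close>;
    adding \<open>1\<close> keeps the quotient meaningful when \<open>x\<close> or \<open>y\<close>
    is zero.\<close>
  have "r / (?C + 1) > 0" using \<open>r > 0\<close> by (simp add: add_nonneg_pos)
  then obtain F where F: "F \<in> finite_rank_operators" "dist F K < r / (?C + 1)"
    using assms compact_subset_closure_finite_rank closure_approachable by (metis subsetD)
  have b: "F \<in> bounded_operators" "K \<in> bounded_operators"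
    using F(1) finite_rank_operators_subset assms by (auto simp: compact_operators_def)
  have "norm (averaging_op F x y - averaging_op K x y) \<le> norm (F - K) * ?C"
  proof (rule norm_operator_le_of_cinner)
    fix a c
    have "cinner ((averaging_op F x y - averaging_op K x y) a) c = averaging_form (F - K) x y a c"
      by (simp add: blinfun.diff_left cinner_diff_left averaging_op(2) b averaging_form_diff)
    then show "cmod (cinner ((averaging_op F x y - averaging_op K x y) a) c) \<le> norm (F - K) * ?C * norm a * norm c"
      using averaging_form_bound[of "F - K" x y a c] by (simp add: mult_ac)
  qed simp
  also have "\<dots> \<le> norm (F - K) * (?C + 1)"
    by (intro mult_left_mono) auto
  also have "\<dots> < r"
    using F(2) by (simp add: dist_norm add_nonneg_pos pos_less_divide_eq)
  finally show "\<exists>T\<in>L1_operators. dist T (averaging_op K x y) < r"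
    using averaging_op_finite_rank[OF F(1)] by (auto simp: dist_norm)
qed

text \<open>Where \<open>x\<close> and \<open>y\<close> live, the multiplier u(st\<inverse>) is the
  constant \<open>c\<close>. For rank one operators this is read off the double integral; both sides
  are linear and norm continuous in \<open>K\<close>, so it extends to limits of finite rank
  operators.\<close>

lemma averaging_form_compact_local:
  assumes K: "K \<in> compact_operators"
    and x: "AE t in haar. t \<notin> U \<longrightarrow> rep_L2 x t = 0" and y: "AE s in haar. s \<notin> V \<longrightarrow> rep_L2 y s = 0"
    and c: "\<And>s t. s \<in> V \<Longrightarrow> t \<in> U \<Longrightarrow> cinner (left_translation (s - t) a) b = c"
  shows "averaging_form K x y a b = c * cinner (K x) y"
proof -
  let ?u = "\<lambda>s. cinner (left_translation s a) b"
  have u [measurable]: "(\<lambda>t. ?u (s - t)) \<in> borel_measurable haar" for s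
    by (rule measurable_compose[OF _ measurable_coefficient]) measurable
  have u2 [measurable]: "(\<lambda>(s, t). ?u (s - t)) \<in> borel_measurable (haar \<Otimes>\<^sub>M haar)"
    unfolding case_prod_beta
    by (rule measurable_compose[OF _ measurable_coefficient]) measurable
  have r1: "averaging_form (rank_one z w) x y a b = c * cinner (rank_one z w x) y" for z w
  proof -
    have inner: "(\<integral>t. rep_L2 x t * cnj (rep_L2 w t) * ?u (s - t) \<partial>haar) = c * cinner x w" if "s \<in> V" for s
    proof -
      have "(\<integral>t. rep_L2 x t * cnj (rep_L2 w t) * ?u (s - t) \<partial>haar)
          = (\<integral>t. c * (rep_L2 x t * cnj (rep_L2 w t)) \<partial>haar)"
        by (rule integral_cong_AE) (use x c[OF that] in \<open>auto elim!: eventually_mono\<close>)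
      then show ?thesis by (simp add: cinner_eq_integral)
    qed
    have "averaging_form (rank_one z w) x y a b
        = (\<integral>s. (c * cinner x w) * (rep_L2 z s * cnj (rep_L2 y s)) \<partial>haar)"
      unfolding averaging_form_rank_one
      by (rule integral_cong_AE) (use y inner in \<open>auto elim!: eventually_mono\<close>)
    then show ?thesis by (simp add: cinner_eq_integral[of z y] rank_one_apply)
  qed
  have bl: "bounded_linear (\<lambda>K. averaging_form K x y a b)" "bounded_linear (\<lambda>K :: 'g op. c * cinner (K x) y)"
    by (intro bounded_linear_mult_right[THEN bounded_linear_compose]
        normal_functional_bounded_linear normal_averaging_form normal_functional_single)+
  have "finite_rank_operators \<subseteq> {K. averaging_form K x y a b = c * cinner (K x) y}"
    unfolding finite_rank_operators_def
    by (auto simp: averaging_form_sum r1 blinfun.sum_left cinner_sum_left sum_distrib_left)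
  moreover have "closed {K. averaging_form K x y a b = c * cinner (K x) y}"
    by (intro closed_Collect_eq linear_continuous_on bl)
  ultimately have "closure finite_rank_operators \<subseteq> {K. averaging_form K x y a b = c * cinner (K x) y}"
    by (rule closure_minimal)
  then show ?thesis using K compact_subset_closure_finite_rank by blast
qed

end

section \<open>Compact compressions of the reduced C*-algebra\<close>

lemma finite_rank_image_ball_in_compact:
  assumes "F \<in> finite_rank_operators"
  obtains C where "compact C" "F ` ball 0 1 \<subseteq> C"
proof -
  obtain N :: nat and z w where F: "F = (\<Sum>n<N. rank_one (z n) (w n))"
    using assms by (auto simp: finite_rank_operators_def)
  have "\<exists>C. compact C \<and> (\<Sum>n<N. rank_one (z n) (w n)) ` ball 0 1 \<subseteq> C"
  proof (induction N)
    case 0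
    show ?case by (rule exI[of _ "{0}"]) auto
  next
    case (Suc N)
    then obtain C where C: "compact C" "(\<Sum>n<N. rank_one (z n) (w n)) ` ball 0 1 \<subseteq> C" by blast
    let ?D = "(\<lambda>c. c *\<^sub>C z N) ` cball 0 (norm (w N))"
    have "bounded_linear (\<lambda>c. c *\<^sub>C z N)"
      by (rule bounded_linear_intro[where K = "norm (z N)"])
        (auto simp: scaleC_add_left scaleR_L2_def scaleR_conv_of_real)
    then have D: "compact ?D"
      by (intro compact_continuous_image linear_continuous_on) auto
    have "rank_one (z N) (w N) x \<in> ?D" if "norm x < 1" for x
    proof -
      have "cmod (cinner x (w N)) \<le> norm x * norm (w N)" by (rule norm_cinner_le)
      also have "\<dots> \<le> 1 * norm (w N)" using that by (intro mult_right_mono) auto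
      finally show ?thesis by (auto simp: rank_one_apply dist_norm)
    qed
    then have "(\<Sum>n<Suc N. rank_one (z n) (w n)) ` ball 0 1 \<subseteq> {x + y |x y. x \<in> C \<and> y \<in> ?D}"
      using C(2) by (force simp: blinfun.add_left dist_norm)
    then show ?case using compact_sums[OF C(1) D] by blast
  qed
  then show ?thesis using that F by blast
qed

lemma closure_finite_rank_subset_compact:
  "closure finite_rank_operators \<subseteq> (compact_operators :: 'g::haar_group op set)"
proof
  fix T :: "'g op" assume T: "T \<in> closure finite_rank_operators"
  have "T \<in> bounded_operators"
    using T closure_minimal[OF finite_rank_operators_subset closed_bounded_operators] by blast
  moreover have "compact (closure (T ` ball 0 1))"
    unfolding compact_eq_totally_bounded
  proof (intro conjI allI impI)
    show "complete (closure (T ` ball 0 1))"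
      by (simp add: complete_eq_closed)
    fix r :: real assume "r > 0"
    \<comment> \<open>A net of radius \<open>r / 4\<close> and an approximation error below
      \<open>r / 4\<close> give closed balls of radius \<open>r / 2\<close>. These cover the closure
      as well and lie inside the open balls of radius \<open>r\<close>.\<close>
    then have r: "r / 4 > 0" by simp
    then obtain F where F: "F \<in> finite_rank_operators" "norm (F - T) < r / 4"
      using T unfolding closure_approachable dist_norm by blast
    obtain C where C: "compact C" "F ` ball 0 1 \<subseteq> C"
      using finite_rank_image_ball_in_compact[OF F(1)] .
    obtain k where k: "finite k" "C \<subseteq> (\<Union>y\<in>k. ball y (r / 4))"
      using C(1) r unfolding compact_eq_totally_bounded by blast
    have "T ` ball 0 1 \<subseteq> (\<Union>y\<in>k. cball y (r / 2))"
    proof (rule image_subsetI)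
      fix x :: "'g L2" assume x: "x \<in> ball 0 1"
      then obtain y where y: "y \<in> k" "dist y (F x) < r / 4" using C(2) k(2) by force
      have "dist (F x) (T x) = norm ((F - T) x)" by (simp add: dist_norm blinfun.diff_left)
      also have "\<dots> \<le> norm (F - T) * norm x" by (rule norm_blinfun)
      also have "\<dots> \<le> norm (F - T) * 1" using x by (intro mult_left_mono) auto
      finally have "dist y (T x) \<le> r / 2" using y F(2) dist_triangle[of y "T x" "F x"] by simp
      then show "T x \<in> (\<Union>y\<in>k. cball y (r / 2))" using y by auto
    qed
    then have "closure (T ` ball 0 1) \<subseteq> (\<Union>y\<in>k. cball y (r / 2))"
      using k(1) by (intro closure_minimal closed_UN) auto
    also have "\<dots> \<subseteq> (\<Union>y\<in>k. ball y r)" using \<open>r > 0\<close> by fastforce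
    finally show "\<exists>k. finite k \<and> closure (T ` ball 0 1) \<subseteq> (\<Union>y\<in>k. ball y r)" using k(1) by blast
  qed
  ultimately show "T \<in> compact_operators" by (simp add: compact_operators_def)
qed

lemma L1_operator_exists:
  fixes f :: "'g::{haar_group, second_countable_topology} \<Rightarrow> complex"
  assumes "integrable haar f"
  obtains T :: "'g op" where "T \<in> bounded_operators"
    "\<And>x y. cinner (T x) y = (\<integral>s. f s * cinner (left_translation s x) y \<partial>haar)"
proof (rule sesquilinear_form_operator[of "\<lambda>x y. \<integral>s. f s * cinner (left_translation s x) y \<partial>haar" "\<integral>s. cmod (f s) \<partial>haar"])
  note i = integrable_mult_coefficient[OF assms]
  fix x x' y y' :: "'g L2" and c
  show "(\<integral>s. f s * cinner (left_translation s (x + x')) y \<partial>haar)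
      = (\<integral>s. f s * cinner (left_translation s x) y \<partial>haar) + (\<integral>s. f s * cinner (left_translation s x') y \<partial>haar)"
    by (simp add: left_translation_add cinner_add_left distrib_left i)
  show "(\<integral>s. f s * cinner (left_translation s x) (y + y') \<partial>haar)
      = (\<integral>s. f s * cinner (left_translation s x) y \<partial>haar) + (\<integral>s. f s * cinner (left_translation s x) y' \<partial>haar)"
    by (simp add: cinner_add_right distrib_left i)
  show "(\<integral>s. f s * cinner (left_translation s (c *\<^sub>C x)) y \<partial>haar)
      = c * (\<integral>s. f s * cinner (left_translation s x) y \<partial>haar)"
    by (simp add: left_translation_scaleC mult.left_commute[of _ c])
  show "(\<integral>s. f s * cinner (left_translation s x) (c *\<^sub>C y) \<partial>haar)
      = cnj c * (\<integral>s. f s * cinner (left_translation s x) y \<partial>haar)"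
    by (simp add: mult.left_commute[of _ "cnj c"])
  show "cmod (\<integral>s. f s * cinner (left_translation s x) y \<partial>haar) \<le> (\<integral>s. cmod (f s) \<partial>haar) * norm x * norm y"
    by (rule i)
qed (use that in auto)

text \<open>A bounded symbol makes the kernel bounded on a product of sets of finite measure,
  provided the modular weight is bounded there; the kernel is then square integrable.\<close>

definition bounded_L1_operators :: "'g::haar_group op set" where
  "bounded_L1_operators = {T. T \<in> bounded_operators \<and> (\<exists>f c. integrable haar f \<and> (\<forall>s. cmod (f s) \<le> c) \<and>
     (\<forall>x y. cinner (T x) y = (\<integral>s. f s * cinner (left_translation s x) y \<partial>haar)))}"

text \<open>Truncations of the symbol at height \<open>k\<close> converge in mean, and the L1 norm
  of a symbol bounds the norm of its operator.\<close>

lemma L1_operators_subset_closure_bounded: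
  "(L1_operators :: 'g::{haar_group, second_countable_topology} op set) \<subseteq> closure bounded_L1_operators"
proof
  fix T :: "'g op" assume "T \<in> L1_operators"
  then obtain f where Tb: "T \<in> bounded_operators" and f: "integrable haar f"
    and T: "\<And>x y. cinner (T x) y = (\<integral>s. f s * cinner (left_translation s x) y \<partial>haar)"
    by (auto simp: L1_operators_def)
  have [measurable]: "f \<in> borel_measurable haar" using f by auto
  define g where "g k s = (if cmod (f s) \<le> real k then f s else 0)" for k s
  have [measurable]: "g k \<in> borel_measurable haar" for k unfolding g_def by measurable
  have g: "integrable haar (g k)" for k
    by (rule Bochner_Integration.integrable_bound[OF f]) (auto simp: g_def)
  have "(\<lambda>k. \<integral>s. cmod (f s - g k s) \<partial>haar) \<longlonglongrightarrow> (\<integral>s. 0 \<partial>(haar :: 'g measure))"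
  proof (rule integral_dominated_convergence[where w = "\<lambda>s. cmod (f s)"])
    show "AE s in haar. (\<lambda>k. cmod (f s - g k s)) \<longlonglongrightarrow> 0"
    proof (rule AE_I2)
      fix s
      obtain k0 :: nat where "cmod (f s) \<le> real k0" using real_arch_simple by blast
      then have "\<forall>\<^sub>F k in sequentially. cmod (f s - g k s) = 0"
        by (intro eventually_sequentiallyI[of k0]) (auto simp: g_def)
      then show "(\<lambda>k. cmod (f s - g k s)) \<longlonglongrightarrow> 0" by (rule tendsto_eventually)
    qed
  qed (use f in \<open>auto simp: g_def\<close>)
  then have lim: "(\<lambda>k. \<integral>s. cmod (f s - g k s) \<partial>haar) \<longlonglongrightarrow> 0" by simp
  show "T \<in> closure bounded_L1_operators"
    unfolding closure_approachable
  proof (intro allI impI)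
    fix r :: real assume "r > 0"
    then have "\<forall>\<^sub>F k in sequentially. (\<integral>s. cmod (f s - g k s) \<partial>haar) < r"
      using order_tendstoD(2)[OF lim] by blast
    then obtain k where k: "(\<integral>s. cmod (f s - g k s) \<partial>haar) < r"
      unfolding eventually_sequentially by blast
    obtain S :: "'g op" where S: "S \<in> bounded_operators"
      "\<And>x y. cinner (S x) y = (\<integral>s. g k s * cinner (left_translation s x) y \<partial>haar)"
      using L1_operator_exists[OF g[of k]] by blast
    have "norm (T - S) \<le> (\<integral>s. cmod (f s - g k s) \<partial>haar)"
    proof (rule norm_operator_le_of_cinner)
      fix x y
      have "cinner ((T - S) x) y = (\<integral>s. (f s - g k s) * cinner (left_translation s x) y \<partial>haar)"
        by (simp add: blinfun.diff_left cinner_diff_left T S left_diff_distrib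
            integrable_mult_coefficient f g)
      then show "cmod (cinner ((T - S) x) y) \<le> (\<integral>s. cmod (f s - g k s) \<partial>haar) * norm x * norm y"
        using integrable_mult_coefficient(2)[of "\<lambda>s. f s - g k s" x y] f g by simp
    qed simp
    then have "dist S T < r" using k by (simp add: dist_norm norm_minus_commute)
    moreover have "S \<in> bounded_L1_operators"
      unfolding bounded_L1_operators_def
      using S g[of k] by (intro CollectI conjI exI[of _ "g k"] exI[of _ "real k"]) (auto simp: g_def)
    ultimately show "\<exists>S\<in>bounded_L1_operators. dist S T < r" by blast
  qed
qed

text \<open>The substitution \<open>y = - s + t\<close> exhibits \<lambda>(f) as an integral
  operator with kernel \<open>f (t - y) * inverse_density y\<close>.\<close>

lemma integral_haar_convolution:
  fixes f g :: "'g::{haar_group, second_countable_topology} \<Rightarrow> complex"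
  assumes [measurable]: "f \<in> borel_measurable haar" "g \<in> borel_measurable haar"
  shows "(\<integral>s. f s * g (- s + t) \<partial>haar) = (\<integral>y. of_real (inverse_density y) * (f (t - y) * g y) \<partial>haar)"
proof -
  have "(\<integral>s. f s * g (- s + t) \<partial>haar) = (\<integral>s. f (t + s) * g (- (t + s) + t) \<partial>haar)"
    by (rule integral_haar_translate[symmetric]) measurable
  also have "\<dots> = (\<integral>s. f (t - - s) * g (- s) \<partial>haar)"
    by (simp add: minus_add add.assoc del: add_uminus_conv_diff)
  also have "\<dots> = (\<integral>y. f (t - y) * g y \<partial>distr haar haar uminus)"
    by (subst integral_distr) auto
  also have "\<dots> = (\<integral>y. of_real (inverse_density y) * (f (t - y) * g y) \<partial>haar)"
    unfolding distr_uminus_haar by (subst integral_density) (auto simp: scaleR_conv_of_real)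
  finally show ?thesis .
qed

section \<open>Compressions to measurable sets\<close>

definition indicator_op :: "'g::haar_group set \<Rightarrow> 'g op" where
  "indicator_op A = multiplication_op (indicator A)"

lemma essentially_bounded_indicator: "A \<in> sets borel \<Longrightarrow> essentially_bounded (indicator A)"
  by (rule essentially_boundedI[where C = 1]) (auto simp: sets_haar indicator_def)

lemma indicator_op_apply: "A \<in> sets borel \<Longrightarrow> indicator_op A x = multiplication (indicator A) x"
  by (simp add: indicator_op_def multiplication_op_apply essentially_bounded_indicator)

lemma AE_rep_indicator_op:
  "A \<in> sets borel \<Longrightarrow> AE t in haar. rep_L2 (indicator_op A x) t = indicator A t * rep_L2 x t"
  by (simp add: indicator_op_apply AE_rep_multiplication essentially_bounded_indicator)

lemma indicator_op_adjoint:
  assumes "A \<in> sets borel"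
  shows "cinner (indicator_op A x) y = cinner x (indicator_op A y)"
proof -
  have "(\<lambda>t. cnj (indicator A t)) = (indicator A :: 'a \<Rightarrow> complex)"
    by (auto simp: indicator_def)
  then show ?thesis
    using multiplication_adjoint[OF essentially_bounded_indicator[OF assms], of x y]
    by (simp add: indicator_op_apply assms)
qed

lemma indicator_op_scaleC: "A \<in> sets borel \<Longrightarrow> indicator_op A (c *\<^sub>C x) = c *\<^sub>C indicator_op A x"
  by (simp add: indicator_op_apply multiplication_scaleC)

context parseval_frame
begin

text \<open>On \<open>A\<close> and \<open>B\<close> as below, \<open>T\<close> has the bounded kernel \<open>(t, y) \<mapsto> f(ty\<inverse>) \<Delta>(y\<inverse>)\<close>; the tails of the
  frame expansions of its rows tend to \<open>0\<close> in square mean.\<close>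

lemma compressed_bounded_L1_operator:
  fixes T :: "'g op"
  assumes T: "T \<in> bounded_L1_operators"
    and B: "B \<in> sets borel" "emeasure haar B < \<infinity>"
    and A: "A \<in> sets borel" "emeasure haar A < \<infinity>" "\<And>y. y \<in> A \<Longrightarrow> inverse_density y \<le> m"
  shows "indicator_op B o\<^sub>L T o\<^sub>L indicator_op A \<in> closure finite_rank_operators"
proof -
  obtain f c where f: "integrable haar f" and fc: "\<And>s. cmod (f s) \<le> c"
    and Tf: "\<And>x y. cinner (T x) y = (\<integral>s. f s * cinner (left_translation s x) y \<partial>haar)"
    using T by (auto simp: bounded_L1_operators_def)
  have [measurable]: "f \<in> borel_measurable haar" using f by auto
  have [measurable]: "A \<in> sets haar" "B \<in> sets haar" using A B by (auto simp: sets_haar)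
  define S where "S = indicator_op B o\<^sub>L T o\<^sub>L indicator_op A"
  \<comment> \<open>The kernel row over \<open>t\<close>, restricted to \<open>A\<close> and
    conjugated because \<open>cinner\<close> is conjugate linear in its second argument. Thus
    \<open>cinner x (\<kappa> t)\<close> below is the value at \<open>t\<close> of the operator
    applied to \<open>x\<close>, before the restriction to \<open>B\<close>.\<close>
  define k where "k t y = cnj (f (t - y)) * (indicator A y * of_real (inverse_density y))" for t y
  have [measurable]: "(\<lambda>(t, y). k t y) \<in> borel_measurable (haar \<Otimes>\<^sub>M haar)" "k t \<in> borel_measurable haar" for t
    unfolding k_def by measurable
  define M where "M = (c * m)\<^sup>2 * measure haar A"
  have c0: "0 \<le> c" using fc[of 0] norm_ge_zero order_trans by blast
  have k_le: "(cmod (k t y))\<^sup>2 \<le> (c * m)\<^sup>2 * indicator A y" for t y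
  proof (cases "y \<in> A")
    case True
    have "cmod (k t y) \<le> c * m"
      using True A(3)[OF True] fc[of "t - y"] c0 unfolding k_def norm_mult
      by (intro mult_mono) auto
    then show ?thesis using True by (simp add: power_mono)
  qed (simp add: k_def)
  have ind_int: "integrable haar (\<lambda>y. (c * m)\<^sup>2 * indicator A y)" using A(2) by simp
  have k_sq: "square_integrable (k t)" for t
    unfolding square_integrable_def
    using Bochner_Integration.integrable_bound[OF ind_int, of "\<lambda>y. (cmod (k t y))\<^sup>2"] k_le
    by (auto simp: abs_mult)
  define \<kappa> where "\<kappa> t = abs_L2 (k t)" for t
  have \<kappa>: "AE y in haar. rep_L2 (\<kappa> t) y = k t y" for t
    unfolding \<kappa>_def by (rule AE_rep_abs_L2[OF k_sq])
  have \<kappa>_cinner: "cinner x (\<kappa> t) = (\<integral>y. rep_L2 x y * cnj (k t y) \<partial>haar)" for x t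
    by (rule cinner_eq_integral_AE(1)[OF AE_I2[OF refl] \<kappa>]) auto
  have \<kappa>_norm: "(norm (\<kappa> t))\<^sup>2 = (\<integral>y. (cmod (k t y))\<^sup>2 \<partial>haar)" for t
    unfolding norm_power2_eq_integral by (rule integral_cong_AE) (use \<kappa>[of t] in \<open>auto elim: eventually_mono\<close>)
  have \<kappa>_le: "(norm (\<kappa> t))\<^sup>2 \<le> M" for t
  proof -
    have "(norm (\<kappa> t))\<^sup>2 \<le> (\<integral>y. (c * m)\<^sup>2 * indicator A y \<partial>haar)"
      unfolding \<kappa>_norm by (rule integral_mono[OF _ ind_int k_le]) (use k_sq[of t] in \<open>simp add: square_integrable_def\<close>)
    then show ?thesis using A(2) by (simp add: M_def)
  qed
  have \<kappa>_meas [measurable]: "(\<lambda>t. cinner x (\<kappa> t)) \<in> borel_measurable haar" "(\<lambda>t. (norm (\<kappa> t))\<^sup>2) \<in> borel_measurable haar" for x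
    unfolding \<kappa>_cinner \<kappa>_norm by measurable
  have B_int: "integrable haar (\<lambda>t. C * indicator B t)" for C :: real using B(2) by simp
  have v_sq: "square_integrable (\<lambda>t. indicator B t * cinner x (\<kappa> t))" for x
  proof -
    have "(cmod (indicator B t * cinner x (\<kappa> t)))\<^sup>2 \<le> (norm x)\<^sup>2 * M * indicator B t" for t
    proof (cases "t \<in> B")
      case True
      have "(cmod (cinner x (\<kappa> t)))\<^sup>2 \<le> (norm x * norm (\<kappa> t))\<^sup>2"
        by (intro power_mono norm_cinner_le) auto
      also have "\<dots> \<le> (norm x)\<^sup>2 * M"
        unfolding power_mult_distrib by (intro mult_left_mono \<kappa>_le) auto
      finally show ?thesis using True by simp
    qed simp
    then show ?thesis
      unfolding square_integrable_def
      using Bochner_Integration.integrable_bound[OF B_int[of "(norm x)\<^sup>2 * M"], of "\<lambda>t. (cmod (indicator B t * cinner x (\<kappa> t)))\<^sup>2"]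
      by (auto intro!: AE_I2 order_trans[OF _ abs_ge_self])
  qed
  have S_eq: "S x = abs_L2 (\<lambda>t. indicator B t * cinner x (\<kappa> t))" for x
  proof (rule cinner_ext)
    fix y
    define xa where "xa t = indicator A t * rep_L2 x t" for t
    define yb where "yb t = indicator B t * rep_L2 y t" for t
    have [measurable]: "xa \<in> borel_measurable haar" "yb \<in> borel_measurable haar"
      unfolding xa_def yb_def by measurable
    have xa: "AE t in haar. rep_L2 (indicator_op A x) t = xa t"
      and yb: "AE t in haar. rep_L2 (indicator_op B y) t = yb t"
      unfolding xa_def yb_def by (intro AE_rep_indicator_op A B)+
    have trans: "AE t in haar. rep_L2 (left_translation s (indicator_op A x)) t = xa (- s + t)" for s
      using AE_rep_left_translation[of s "indicator_op A x"] AE_haar_translate[OF xa, of "- s"]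
      by eventually_elim simp
    have coeff: "cinner (left_translation s (indicator_op A x)) (indicator_op B y)
        = (\<integral>t. xa (- s + t) * cnj (yb t) \<partial>haar)"
      and coeff_int: "integrable haar (\<lambda>t. xa (- s + t) * cnj (yb t))" for s
      by (rule cinner_eq_integral_AE[OF trans yb]; measurable)+
    \<comment> \<open>Replacing \<open>x\<close> and \<open>y\<close> by their moduli keeps the
      norms and turns the absolute integral into a bound by a coefficient, uniform in
      \<open>s\<close>. Together with integrability of \<open>f\<close> this permits Fubini.\<close>
    have abs_coeff: "(\<integral>\<^sup>+t. ennreal (cmod (xa (- s + t) * cnj (yb t))) \<partial>haar) \<le> ennreal (norm x * norm y)" for s
    proof -
      have sq: "square_integrable (\<lambda>t. of_real (cmod (rep_L2 z t)))" for z :: "'g L2"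
        by (simp add: square_integrable_def)
      define x' where "x' = abs_L2 (\<lambda>t. of_real (cmod (rep_L2 x t)))"
      define y' where "y' = abs_L2 (\<lambda>t. of_real (cmod (rep_L2 y t)))"
      have x': "AE t in haar. rep_L2 x' t = of_real (cmod (rep_L2 x t))"
        and y': "AE t in haar. rep_L2 y' t = of_real (cmod (rep_L2 y t))"
        unfolding x'_def y'_def by (rule AE_rep_abs_L2[OF sq])+
      have nx: "norm x' = norm x"
      proof -
        have "(norm x')\<^sup>2 = (norm x)\<^sup>2"
          unfolding norm_power2_eq_integral
          by (rule integral_cong_AE) (use x' in \<open>auto elim: eventually_mono\<close>)
        then show ?thesis by simp
      qed
      have ny: "norm y' = norm y"
      proof -
        have "(norm y')\<^sup>2 = (norm y)\<^sup>2"
          unfolding norm_power2_eq_integral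
          by (rule integral_cong_AE) (use y' in \<open>auto elim: eventually_mono\<close>)
        then show ?thesis by simp
      qed
      have ae: "AE t in haar. rep_L2 (left_translation s x') t = of_real (cmod (rep_L2 x (- s + t)))"
        using AE_rep_left_translation[of s x'] AE_haar_translate[OF x', of "- s"]
        by eventually_elim simp
      have c': "cinner (left_translation s x') y'
          = (\<integral>t. of_real (cmod (rep_L2 x (- s + t))) * cnj (of_real (cmod (rep_L2 y t))) \<partial>haar)"
        and i': "integrable haar (\<lambda>t. of_real (cmod (rep_L2 x (- s + t))) * cnj (complex_of_real (cmod (rep_L2 y t))))"
        by (rule cinner_eq_integral_AE[OF ae y']; measurable)+
      have i'': "integrable haar (\<lambda>t. cmod (rep_L2 x (- s + t)) * cmod (rep_L2 y t))"
        using integrable_Re[OF i'] by simp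
      have "(\<integral>\<^sup>+t. ennreal (cmod (xa (- s + t) * cnj (yb t))) \<partial>haar)
          \<le> (\<integral>\<^sup>+t. ennreal (cmod (rep_L2 x (- s + t)) * cmod (rep_L2 y t)) \<partial>haar)"
        by (intro nn_integral_mono ennreal_leI) (auto simp: xa_def yb_def norm_mult indicator_def)
      also have "\<dots> = ennreal (\<integral>t. cmod (rep_L2 x (- s + t)) * cmod (rep_L2 y t) \<partial>haar)"
        using i'' by (intro nn_integral_eq_integral) auto
      also have "(\<integral>t. cmod (rep_L2 x (- s + t)) * cmod (rep_L2 y t) \<partial>haar) = cmod (cinner (left_translation s x') y')"
      proof -
        have "cinner (left_translation s x') y' = of_real (\<integral>t. cmod (rep_L2 x (- s + t)) * cmod (rep_L2 y t) \<partial>haar)"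
          unfolding c' by (simp flip: of_real_mult)
        then show ?thesis by (simp add: integral_nonneg)
      qed
      also have "ennreal \<dots> \<le> ennreal (norm x * norm y)"
        using cmod_coefficient_le[of s x' y'] by (intro ennreal_leI) (simp add: nx ny)
      finally show ?thesis .
    qed
    have int: "integrable (haar \<Otimes>\<^sub>M haar) (\<lambda>(s, t). f s * (xa (- s + t) * cnj (yb t)))"
    proof (rule integrableI_bounded)
      have "(\<integral>\<^sup>+z. ennreal (norm (case z of (s, t) \<Rightarrow> f s * (xa (- s + t) * cnj (yb t)))) \<partial>(haar \<Otimes>\<^sub>M haar))
          = (\<integral>\<^sup>+s. \<integral>\<^sup>+t. ennreal (norm (f s * (xa (- s + t) * cnj (yb t)))) \<partial>haar \<partial>haar)"
        by (subst haar.nn_integral_fst[symmetric]) auto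
      also have "\<dots> = (\<integral>\<^sup>+s. ennreal (cmod (f s)) * (\<integral>\<^sup>+t. ennreal (cmod (xa (- s + t) * cnj (yb t))) \<partial>haar) \<partial>haar)"
        by (intro nn_integral_cong, subst nn_integral_cmult[symmetric])
          (auto simp: norm_mult ennreal_mult)
      also have "\<dots> \<le> (\<integral>\<^sup>+s. ennreal (cmod (f s)) * ennreal (norm x * norm y) \<partial>haar)"
        by (intro nn_integral_mono mult_left_mono abs_coeff) auto
      also have "\<dots> = (\<integral>\<^sup>+s. ennreal (cmod (f s)) \<partial>haar) * ennreal (norm x * norm y)"
        by (rule nn_integral_multc) auto
      also have "\<dots> < \<infinity>" using f by (auto simp: integrable_iff_bounded ennreal_mult_less_top)
      finally show "(\<integral>\<^sup>+z. ennreal (norm (case z of (s, t) \<Rightarrow> f s * (xa (- s + t) * cnj (yb t)))) \<partial>(haar \<Otimes>\<^sub>M haar)) < \<infinity>" .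
    qed measurable
    have "cinner (S x) y = cinner (T (indicator_op A x)) (indicator_op B y)"
      by (simp add: S_def indicator_op_adjoint B)
    also have "\<dots> = (\<integral>s. \<integral>t. f s * (xa (- s + t) * cnj (yb t)) \<partial>haar \<partial>haar)"
      unfolding Tf coeff by simp
    also have "\<dots> = (\<integral>t. \<integral>s. f s * (xa (- s + t) * cnj (yb t)) \<partial>haar \<partial>haar)"
      by (rule haar_pair.Fubini_integral[OF int, symmetric])
    also have "\<dots> = (\<integral>t. indicator B t * cinner x (\<kappa> t) * cnj (rep_L2 y t) \<partial>haar)"
    proof (rule Bochner_Integration.integral_cong[OF refl])
      fix t
      have "(\<integral>s. f s * (xa (- s + t) * cnj (yb t)) \<partial>haar) = (\<integral>s. f s * xa (- s + t) \<partial>haar) * cnj (yb t)"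
        by (simp flip: mult.assoc)
      also have "(\<integral>s. f s * xa (- s + t) \<partial>haar) = (\<integral>y. of_real (inverse_density y) * (f (t - y) * xa y) \<partial>haar)"
        by (rule integral_haar_convolution) measurable
      also have "\<dots> = cinner x (\<kappa> t)"
        unfolding \<kappa>_cinner
        by (rule Bochner_Integration.integral_cong) (auto simp: k_def xa_def indicator_def)
      finally show "(\<integral>s. f s * (xa (- s + t) * cnj (yb t)) \<partial>haar) = indicator B t * cinner x (\<kappa> t) * cnj (rep_L2 y t)"
        by (simp add: yb_def indicator_def)
    qed
    also have "\<dots> = cinner (abs_L2 (\<lambda>t. indicator B t * cinner x (\<kappa> t))) y"
      by (rule cinner_eq_integral_AE(1)[OF AE_rep_abs_L2[OF v_sq] AE_I2[OF refl], symmetric]) measurable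
    finally show "cinner (S x) y = cinner (abs_L2 (\<lambda>t. indicator B t * cinner x (\<kappa> t))) y" .
  qed
  \<comment> \<open>The tail of the Parseval series of the row \<open>\<kappa> t\<close>. It lies
    between \<open>0\<close> and \<open>M\<close> and tends to \<open>0\<close> for each
    \<open>t\<close>, so its integral over the finite measure set \<open>B\<close> tends to
    \<open>0\<close>.\<close>
  define Q where "Q N t = (norm (\<kappa> t))\<^sup>2 - (\<Sum>n<N. (cmod (cinner (e n) (\<kappa> t)))\<^sup>2)" for N t
  have comm: "cmod (cinner (\<kappa> t) z) = cmod (cinner z (\<kappa> t))" for t z
    by (subst cinner_commute) simp
  have Q_nonneg: "0 \<le> Q N t" for N t
    using bessel[of "\<kappa> t" N] by (simp add: Q_def comm)
  have Q_le: "Q N t \<le> M" for N t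
    using \<kappa>_le[of t] sum_nonneg[of "{..<N}" "\<lambda>n. (cmod (cinner (e n) (\<kappa> t)))\<^sup>2"] by (simp add: Q_def)
  have Q_lim: "(\<lambda>N. Q N t) \<longlonglongrightarrow> 0" for t
    using tendsto_diff[OF tendsto_const parseval_norm[of "\<kappa> t", unfolded sums_def], of "(norm (\<kappa> t))\<^sup>2"]
    by (simp add: Q_def comm)
  have [measurable]: "Q N \<in> borel_measurable haar" for N
    unfolding Q_def by measurable
  define P where "P N x = (\<Sum>n<N. cinner x (e n) *\<^sub>C e n)" for N x
  have tail: "cmod (cinner (x - P N x) (\<kappa> t)) \<le> norm x * sqrt (Q N t)" for N x t
  proof -
    let ?a = "\<lambda>n. cinner x (e n) * cinner (e n) (\<kappa> t)"
    have "?a sums cinner x (\<kappa> t)"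
      using bounded_linear.sums[OF bounded_linear_cinner_left frame_sums, of x "\<kappa> t"] by simp
    then have lim: "(\<lambda>K. (\<Sum>n<K. ?a n) - (\<Sum>n<N. ?a n)) \<longlonglongrightarrow> cinner (x - P N x) (\<kappa> t)"
      unfolding cinner_diff_left P_def cinner_sum_left cinner_scaleC_left
      by (intro tendsto_diff tendsto_const) (simp add: sums_def)
    show ?thesis
    proof (rule tendsto_upperbound[OF tendsto_norm[OF lim]])
      show "\<forall>\<^sub>F K in sequentially. norm ((\<Sum>n<K. ?a n) - (\<Sum>n<N. ?a n)) \<le> norm x * sqrt (Q N t)"
      proof (rule eventually_sequentiallyI[of N])
        fix K assume K: "N \<le> K"
        have split: "{..<K} = {..<N} \<union> {N..<K}" "{..<N} \<inter> {N..<K} = {}" using K by auto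
        have "(\<Sum>n<K. ?a n) - (\<Sum>n<N. ?a n) = (\<Sum>n=N..<K. ?a n)"
          unfolding split(1) by (subst sum.union_disjoint) auto
        also have "cmod \<dots> \<le> (\<Sum>n=N..<K. \<bar>cmod (cinner x (e n))\<bar> * \<bar>cmod (cinner (e n) (\<kappa> t))\<bar>)"
          by (rule order_trans[OF norm_sum]) (simp add: norm_mult)
        also have "\<dots> \<le> L2_set (\<lambda>n. cmod (cinner x (e n))) {N..<K} * L2_set (\<lambda>n. cmod (cinner (e n) (\<kappa> t))) {N..<K}"
          by (rule L2_set_mult_ineq)
        also have "\<dots> \<le> norm x * sqrt (Q N t)"
        proof (intro mult_mono)
          have "(\<Sum>n=N..<K. (cmod (cinner x (e n)))\<^sup>2) \<le> (\<Sum>n<K. (cmod (cinner x (e n)))\<^sup>2)"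
            by (rule sum_mono2) auto
          also have "\<dots> \<le> (norm x)\<^sup>2" by (rule bessel)
          finally show "L2_set (\<lambda>n. cmod (cinner x (e n))) {N..<K} \<le> norm x"
            unfolding L2_set_def by (intro real_le_lsqrt) (auto intro: sum_nonneg)
          have "(\<Sum>n<K. (cmod (cinner (e n) (\<kappa> t)))\<^sup>2) \<le> (norm (\<kappa> t))\<^sup>2"
            using bessel[of "\<kappa> t" K] by (simp add: comm)
          then have "(\<Sum>n=N..<K. (cmod (cinner (e n) (\<kappa> t)))\<^sup>2) \<le> Q N t"
            unfolding split(1) Q_def by (subst (asm) sum.union_disjoint) auto
          then show "L2_set (\<lambda>n. cmod (cinner (e n) (\<kappa> t))) {N..<K} \<le> sqrt (Q N t)"
            unfolding L2_set_def by (rule real_sqrt_le_mono)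
        qed (auto simp: L2_set_def intro: sum_nonneg)
        finally show "norm ((\<Sum>n<K. ?a n) - (\<Sum>n<N. ?a n)) \<le> norm x * sqrt (Q N t)" .
      qed
    qed simp
  qed
  have Q_int: "integrable haar (\<lambda>t. indicator B t * Q N t)" for N
  proof (rule Bochner_Integration.integrable_bound[OF B_int[of M]])
    show "AE t in haar. norm (indicator B t * Q N t) \<le> norm (M * indicator B t)"
      using Q_nonneg[of N] order_trans[OF Q_le abs_ge_self] by (auto intro!: AE_I2 simp: indicator_def)
  qed measurable
  have "(\<lambda>N. \<integral>t. indicator B t * Q N t \<partial>haar) \<longlonglongrightarrow> (\<integral>t. 0 \<partial>(haar :: 'g measure))"
  proof (rule integral_dominated_convergence[where w = "\<lambda>t. M * indicator B t"])
    show "AE t in haar. (\<lambda>N. indicator B t * Q N t) \<longlonglongrightarrow> 0"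
      using tendsto_mult_left[OF Q_lim] by (auto intro!: AE_I2)
    show "AE t in haar. norm (indicator B t * Q N t) \<le> M * indicator B t" for N
      using Q_nonneg[of N] Q_le[of N] by (auto intro!: AE_I2 simp: indicator_def)
  qed (use B_int in measurable)
  then have lim: "(\<lambda>N. sqrt (\<integral>t. indicator B t * Q N t \<partial>haar)) \<longlonglongrightarrow> 0"
    using tendsto_real_sqrt by fastforce
  \<comment> \<open>This is \<open>S\<close> after the frame partial sum \<open>P N\<close>.\<close>
  define F where "F N = (\<Sum>n<N. rank_one (S (e n)) (e n))" for N
  have S_scaleC: "S (d *\<^sub>C x) = d *\<^sub>C S x" for d x
    using T by (simp add: S_def indicator_op_scaleC A B bounded_L1_operators_def bounded_operators_def)
  have F_apply: "F N x = S (P N x)" for N x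
    by (simp add: F_def P_def blinfun.sum_left rank_one_apply blinfun.sum_right S_scaleC)
  \<comment> \<open>A bound of Hilbert-Schmidt type: the estimate \<open>tail\<close> of
    \<open>S\<close> on \<open>x - P N x\<close>, valid at every point of \<open>B\<close>, is
    squared and integrated.\<close>
  have norm_le: "norm (S - F N) \<le> sqrt (\<integral>t. indicator B t * Q N t \<partial>haar)" for N
  proof (rule norm_blinfun_bound)
    show "0 \<le> sqrt (\<integral>t. indicator B t * Q N t \<partial>haar)"
      using Q_nonneg by (auto intro!: integral_nonneg)
    fix x
    let ?z = "x - P N x"
    have "(norm (S ?z))\<^sup>2 = (\<integral>t. (cmod (indicator B t * cinner ?z (\<kappa> t)))\<^sup>2 \<partial>haar)"
      unfolding norm_power2_eq_integral S_eq
      by (rule integral_cong_AE) (use AE_rep_abs_L2[OF v_sq[of ?z]] in \<open>auto elim: eventually_mono\<close>)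
    also have "\<dots> \<le> (\<integral>t. (norm x)\<^sup>2 * (indicator B t * Q N t) \<partial>haar)"
    proof (rule integral_mono)
      show "integrable haar (\<lambda>t. (cmod (indicator B t * cinner ?z (\<kappa> t)))\<^sup>2)"
        using v_sq[of ?z] by (simp add: square_integrable_def)
      fix t
      have "(cmod (cinner ?z (\<kappa> t)))\<^sup>2 \<le> (norm x * sqrt (Q N t))\<^sup>2"
        by (intro power_mono tail) auto
      then show "(cmod (indicator B t * cinner ?z (\<kappa> t)))\<^sup>2 \<le> (norm x)\<^sup>2 * (indicator B t * Q N t)"
        using Q_nonneg[of N t] by (auto simp: power_mult_distrib indicator_def)
    qed (use Q_int in simp)
    finally have "(norm (S ?z))\<^sup>2 \<le> (norm x)\<^sup>2 * (\<integral>t. indicator B t * Q N t \<partial>haar)" by simp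
    then have "norm (S ?z) \<le> sqrt ((norm x)\<^sup>2 * (\<integral>t. indicator B t * Q N t \<partial>haar))"
      by (rule real_le_rsqrt)
    then show "norm ((S - F N) x) \<le> sqrt (\<integral>t. indicator B t * Q N t \<partial>haar) * norm x"
      by (simp add: blinfun.diff_left F_apply blinfun.diff_right real_sqrt_mult mult.commute)
  qed
  have "S \<in> closure finite_rank_operators"
    unfolding closure_approachable
  proof (intro allI impI)
    fix r :: real assume "r > 0"
    then have "\<forall>\<^sub>F N in sequentially. sqrt (\<integral>t. indicator B t * Q N t \<partial>haar) < r"
      using order_tendstoD(2)[OF lim] by blast
    then obtain N where "sqrt (\<integral>t. indicator B t * Q N t \<partial>haar) < r"
      unfolding eventually_sequentially by blast
    then have "dist (F N) S < r"
      using norm_le[of N] by (simp add: dist_norm norm_minus_commute)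
    moreover have "F N \<in> finite_rank_operators"
      unfolding finite_rank_operators_def F_def
      by (intro CollectI exI[of _ N] exI[of _ "\<lambda>n. S (e n)"] exI[of _ e]) simp
    ultimately show "\<exists>y\<in>finite_rank_operators. dist y S < r" by blast
  qed
  then show ?thesis by (simp add: S_def)
qed

text \<open>Compression is norm continuous, so the operators whose compression is a limit of finite
  rank operators form a closed set; it contains those with bounded symbol, hence
  \<open>L1_operators\<close> and their closure.\<close>

lemma compressed_reduced_Cstar_compact:
  fixes T :: "'g op"
  assumes T: "T \<in> reduced_Cstar"
    and B: "B \<in> sets borel" "emeasure haar B < \<infinity>"
    and A: "A \<in> sets borel" "emeasure haar A < \<infinity>" "\<And>y. y \<in> A \<Longrightarrow> inverse_density y \<le> m"
  shows "indicator_op B o\<^sub>L T o\<^sub>L indicator_op A \<in> compact_operators"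
proof -
  let ?X = "(\<lambda>T. indicator_op B o\<^sub>L T o\<^sub>L indicator_op A) -` closure finite_rank_operators"
  have "closed ?X"
    by (intro closed_vimage closed_closure continuous_intros)
  moreover have "bounded_L1_operators \<subseteq> ?X"
    using compressed_bounded_L1_operator[OF _ B A] by auto
  ultimately have "closure bounded_L1_operators \<subseteq> ?X" by (rule closure_minimal[rotated])
  then have "L1_operators \<subseteq> ?X" using L1_operators_subset_closure_bounded by blast
  from closure_minimal[OF this \<open>closed ?X\<close>] have "T \<in> ?X"
    using T unfolding reduced_Cstar_def by blast
  then show ?thesis using closure_finite_rank_subset_compact by auto
qed

end

section \<open>Bimodules and ideals of multiplicity\<close>

lemma masa_element:
  assumes "A \<in> multiplication_masa"
  obtains g where "essentially_bounded g" "\<And>x. A x = multiplication g x"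
  using assms by (auto simp: multiplication_masa_def)

lemma masa_bimodule_bounded_operators: "masa_bimodule bounded_operators"
  unfolding masa_bimodule_def
proof (intro conjI ballI allI)
  fix T A B :: "'a op"
  assume T: "T \<in> bounded_operators" and "A \<in> multiplication_masa" "B \<in> multiplication_masa"
  then show "A o\<^sub>L T o\<^sub>L B \<in> bounded_operators"
    by (elim masa_element) (simp add: bounded_operators_def multiplication_scaleC)
qed (auto simp: bounded_operators_def blinfun.add_left scaleC_add_right scaleC_op_apply mult.commute)

lemma Bim_bimodule:
  assumes "\<X> \<subseteq> bounded_operators"
  shows "masa_bimodule (Bim \<X>)" "closedin weak_star (Bim \<X>)" "\<X> \<subseteq> Bim \<X>"
proof -
  \<comment> \<open>The family intersected in \<open>Bim\<close> must be nonempty: an empty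
    intersection would be \<open>UNIV\<close>, which includes operators that are only real
    linear.\<close>
  have whole: "bounded_operators \<in> {\<U>. masa_bimodule \<U> \<and> closedin weak_star \<U> \<and> \<X> \<subseteq> \<U>}"
    using assms masa_bimodule_bounded_operators closedin_topspace[of weak_star]
    by (simp add: topspace_weak_star)
  show "masa_bimodule (Bim \<X>)"
    unfolding masa_bimodule_def
  proof (intro conjI ballI allI)
    show "Bim \<X> \<subseteq> bounded_operators" unfolding Bim_def using whole by blast
  qed (auto simp: Bim_def masa_bimodule_def)
  show "closedin weak_star (Bim \<X>)"
    unfolding Bim_def using whole by (intro closedin_Inter) auto
  show "\<X> \<subseteq> Bim \<X>" by (auto simp: Bim_def)
qed

lemma Bim_least: "masa_bimodule \<U> \<Longrightarrow> closedin weak_star \<U> \<Longrightarrow> \<X> \<subseteq> \<U> \<Longrightarrow> Bim \<X> \<subseteq> \<U>"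
  by (auto simp: Bim_def)

lemma annihilator_subset_bounded: "annihilator J \<subseteq> bounded_operators"
  unfolding annihilator_def using VN_subset_bounded by auto

context parseval_frame
begin

text \<open>The right factor acts on \<open>x\<close> and the adjoint of the left factor acts on
  \<open>y\<close>, because both commute past the frame functions.\<close>

lemma averaging_form_bimodule:
  assumes "A \<in> multiplication_masa" "B \<in> multiplication_masa"
  obtains x' y' where "\<And>T a b. averaging_form (A o\<^sub>L T o\<^sub>L B) x y a b = averaging_form T x' y' a b"
proof -
  obtain g h where g: "essentially_bounded g" "\<And>x. A x = multiplication g x"
    and h: "essentially_bounded h" "\<And>x. B x = multiplication h x"
    using assms by (metis masa_element)
  have g': "essentially_bounded (\<lambda>t. cnj (g t))" using g(1) by (auto simp: essentially_bounded_def)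
  show ?thesis
    by (rule that[of "multiplication h x" "multiplication (\<lambda>t. cnj (g t)) y"])
      (simp add: averaging_form_def g h multiplication_adjoint frame_vec_multiplication g')
qed

lemma averaging_form_vanishes_on_Bim:
  fixes J :: "('g \<Rightarrow> complex) set"
  assumes J: "closed_ideal J" and ab: "coefficient a b \<in> J" and K: "K \<in> Bim (annihilator J)"
  shows "averaging_form K x y a b = 0"
proof -
  define \<Phi> where "\<Phi> = {\<lambda>K. averaging_form K x y a b |x y a b. coefficient a b \<in> J}"
  define \<U> where "\<U> = {T \<in> bounded_operators. \<forall>\<phi>\<in>\<Phi>. \<phi> T = 0}"
  have \<U>: "T \<in> \<U> \<longleftrightarrow> T \<in> bounded_operators \<and>
      (\<forall>x y a b. coefficient a b \<in> J \<longrightarrow> averaging_form T x y a b = 0)" for T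
  proof -
    have "averaging_form T x y a b = 0" if "\<forall>\<phi>\<in>\<Phi>. \<phi> T = 0" "coefficient a b \<in> J" for x y a b
    proof -
      have "(\<lambda>K. averaging_form K x y a b) \<in> \<Phi>" unfolding \<Phi>_def using that(2) by blast
      from bspec[OF that(1) this] show ?thesis by simp
    qed
    moreover have "\<phi> T = 0" if "\<forall>x y a b. coefficient a b \<in> J \<longrightarrow> averaging_form T x y a b = 0" "\<phi> \<in> \<Phi>" for \<phi>
      using that by (auto simp: \<Phi>_def)
    ultimately show ?thesis unfolding \<U>_def by blast
  qed
  have "masa_bimodule \<U>"
    unfolding masa_bimodule_def
  proof (intro conjI ballI allI)
    fix T A B :: "'g op" assume T: "T \<in> \<U>" and AB: "A \<in> multiplication_masa" "B \<in> multiplication_masa"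
    have "averaging_form (A o\<^sub>L T o\<^sub>L B) x y a b = 0" if "coefficient a b \<in> J" for x y a b
    proof -
      obtain x' y' where "\<And>T a b. averaging_form (A o\<^sub>L T o\<^sub>L B) x y a b = averaging_form T x' y' a b"
        using averaging_form_bimodule[OF AB, of x y] by blast
      then show ?thesis using T that by (simp add: \<U>)
    qed
    moreover have "A o\<^sub>L T o\<^sub>L B \<in> bounded_operators"
      using masa_bimodule_bounded_operators T AB unfolding masa_bimodule_def \<U> by blast
    ultimately show "A o\<^sub>L T o\<^sub>L B \<in> \<U>" by (simp add: \<U>)
  next
    fix S T assume "S \<in> \<U>" "T \<in> \<U>"
    then show "S + T \<in> \<U>"
      using masa_bimodule_bounded_operators unfolding masa_bimodule_def
      by (auto simp: \<U> averaging_form_plus)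
  next
    fix c T assume "T \<in> \<U>"
    then show "scaleC_op c T \<in> \<U>"
      using masa_bimodule_bounded_operators unfolding masa_bimodule_def
      by (auto simp: \<U> averaging_form_scaleC_op)
  next
    show "\<U> \<subseteq> bounded_operators" by (auto simp: \<U>)
    show "0 \<in> \<U>"
      using masa_bimodule_bounded_operators unfolding masa_bimodule_def by (auto simp: \<U>)
  qed
  moreover have "closedin weak_star \<U>"
    unfolding \<U>_def by (rule closedin_weak_star_annihilator) (auto simp: \<Phi>_def normal_averaging_form)
  moreover have "annihilator J \<subseteq> \<U>"
  proof
    fix T assume T: "T \<in> annihilator J"
    then have VN: "T \<in> VN" and zero: "\<And>u. u \<in> J \<Longrightarrow> fourier_pairing u T = 0"
      by (auto simp: annihilator_def)
    have "averaging_form T x y a b = 0" if ab: "coefficient a b \<in> J" for x y a b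
    proof -
      \<comment> \<open>The ideal property keeps the product of the two coefficients in
        \<open>J\<close>, so it is again a coefficient, of \<open>p\<close> and \<open>q\<close>.
        The form agrees with the vector functional of \<open>p\<close> and \<open>q\<close> on
        \<lambda>(f), hence on \<open>VN\<close>, where it is a pairing with a member of
        \<open>J\<close>.\<close>
      have "coefficient x y \<in> fourier_algebra" by (auto simp: fourier_algebra_def)
      then have uv: "(\<lambda>s. coefficient x y s * coefficient a b s) \<in> J"
        using J ab unfolding closed_ideal_def by blast
      then obtain p q where pq: "(\<lambda>s. coefficient x y s * coefficient a b s) = coefficient p q"
        using J unfolding closed_ideal_def fourier_algebra_def by blast
      have "averaging_form T x y a b = cinner (T p) q"
      proof (rule normal_functional_eq_on_VN[OF normal_averaging_form normal_functional_single _ VN])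
        fix S :: "'g op" assume "S \<in> L1_operators"
        then obtain f where f: "integrable haar f"
          and S: "\<And>x y. cinner (S x) y = (\<integral>s. f s * cinner (left_translation s x) y \<partial>haar)"
          by (auto simp: L1_operators_def)
        have "cinner (left_translation s p) q
            = cinner (left_translation s a) b * cinner (left_translation s x) y" for s
          using fun_cong[OF pq, of s] by (simp add: coefficient_def mult.commute)
        then show "averaging_form S x y a b = cinner (S p) q"
          by (simp add: averaging_form_L1[OF f S] S)
      qed
      also have "\<dots> = fourier_pairing (coefficient p q) T"
        by (rule fourier_pairing_coefficient[OF VN, symmetric])
      also have "\<dots> = 0" using zero uv pq by simp
      finally show ?thesis .
    qed
    then show "T \<in> \<U>" using VN VN_subset_bounded by (auto simp: \<U>)
  qed
  ultimately have "Bim (annihilator J) \<subseteq> \<U>" by (rule Bim_least)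
  then show ?thesis using K ab by (auto simp: \<U>)
qed

end

section \<open>Nonvanishing of matrix entries and coefficients\<close>

lemma compact_haar_positive:
  obtains V :: "'g::haar_group set" where "compact V" "measure haar V > 0"
proof -
  have "\<exists>V :: 'g set. compact V \<and> emeasure haar V \<noteq> 0"
  proof (rule ccontr)
    assume "\<not> ?thesis"
    then have "emeasure haar (UNIV :: 'g set) \<le> 0"
      by (subst haar_inner_regular[OF open_UNIV], intro SUP_least) auto
    then show False using haar_nonzero[where 'a = 'g] by simp
  qed
  then obtain V :: "'g set" where V: "compact V" "emeasure haar V \<noteq> 0" by blast
  then have "measure haar V > 0"
    using haar_compact_finite[OF V(1)] by (simp add: measure_def enn2real_positive_iff zero_less_iff_neq_zero)
  then show ?thesis using that V by blast
qed

text \<open>Take the indicators of \<open>W\<close> and \<open>V\<close>, where \<open>W\<close>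
  contains every \<open>t - s + v\<close> with t in \<open>C\<close>, s in \<open>D\<close>, v in
  \<open>V\<close>. The translate of \<open>W\<close> by \<open>s - t\<close> then covers
  \<open>V\<close>, so the coefficient equals the measure of \<open>V\<close>.\<close>

lemma locally_constant_coefficient:
  fixes C D :: "'g::{haar_group, second_countable_topology} set"
  assumes "compact C" "compact D"
  obtains a b :: "'g L2" and c :: complex
  where "c \<noteq> 0" "\<And>s t. s \<in> D \<Longrightarrow> t \<in> C \<Longrightarrow> cinner (left_translation (s - t) a) b = c"
proof -
  obtain V :: "'g set" where V: "compact V" "measure haar V > 0" by (rule compact_haar_positive)
  define W where "W = (\<lambda>(t, s, v). t - s + v) ` (C \<times> D \<times> V)"
  have W: "compact W"
    unfolding W_def case_prod_beta
    by (intro compact_continuous_image compact_Times assms V continuous_intros)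
  have fin: "emeasure haar V < \<infinity>" "emeasure haar W < \<infinity>"
    using haar_compact_finite V W by auto
  have b: "V \<in> sets borel" "W \<in> sets borel" using V W by (auto simp: compact_imp_closed)
  then have [measurable]: "V \<in> sets haar" "W \<in> sets haar" by (auto simp: sets_haar)
  have "cinner (left_translation (s - t) (indicator_L2 W)) (indicator_L2 V) = of_real (measure haar V)"
    if "s \<in> D" "t \<in> C" for s t
  proof -
    have ae: "AE v in haar. rep_L2 (left_translation (s - t) (indicator_L2 W)) v = indicator W (- (s - t) + v)"
      using AE_rep_left_translation[of "s - t" "indicator_L2 W"]
        AE_haar_translate[OF AE_rep_indicator_L2[OF b(2) fin(2)], of "- (s - t)"]
      by eventually_elim simp
    have "cinner (left_translation (s - t) (indicator_L2 W)) (indicator_L2 V)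
        = (\<integral>v. indicator W (- (s - t) + v) * cnj (indicator V v) \<partial>haar)"
      by (rule cinner_eq_integral_AE(1)[OF ae AE_rep_indicator_L2[OF b(1) fin(1)]]) measurable
    also have "\<dots> = (\<integral>v. indicator V v \<partial>haar)"
    proof (rule Bochner_Integration.integral_cong[OF refl])
      fix v
      have "- (s - t) + v \<in> W" if "v \<in> V"
        unfolding W_def using that \<open>s \<in> D\<close> \<open>t \<in> C\<close> by (intro image_eqI[of _ _ "(t, s, v)"]) auto
      then show "indicator W (- (s - t) + v) * cnj (indicator V v) = (indicator V v :: complex)"
        by (auto simp: indicator_def)
    qed
    also have "\<dots> = (\<integral>v. complex_of_real (indicator V v) \<partial>haar)"
      by (rule Bochner_Integration.integral_cong) (auto simp: indicator_def)
    also have "\<dots> = of_real (measure haar V)" using fin by simp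
    finally show ?thesis .
  qed
  moreover have "of_real (measure haar V) \<noteq> (0 :: complex)" using V by simp
  ultimately show ?thesis using that by blast
qed

lemma AE_rep_indicator_L2_outside:
  assumes "A \<in> sets borel" "emeasure haar A < \<infinity>"
  shows "AE t in haar. t \<notin> A \<longrightarrow> rep_L2 (indicator_L2 A) t = 0"
  using AE_rep_indicator_L2[OF assms] by eventually_elim simp

lemma indicator_op_indicator_L2:
  assumes "A \<in> sets borel" "emeasure haar A < \<infinity>"
  shows "indicator_op A (indicator_L2 A) = indicator_L2 A"
  by (rule L2_eqI) (use AE_rep_indicator_op[OF assms(1), of "indicator_L2 A"]
    AE_rep_indicator_L2[OF assms] in eventually_elim, simp add: indicator_def)

text \<open>Totality is used once in each argument: for a nonzero value of \<open>T\<close>, then,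
  after passing to the adjoint, for a nonzero value of \<open>S\<close>.\<close>

lemma nonzero_matrix_entry:
  fixes T :: "'g::haar_group op"
  assumes "T \<in> bounded_operators" "T \<noteq> 0"
    and total: "\<And>x :: 'g L2. (\<And>U. U \<in> B \<Longrightarrow> cinner x (indicator_L2 U) = 0) \<Longrightarrow> x = 0"
  obtains U V where "U \<in> B" "V \<in> B" "cinner (T (indicator_L2 U)) (indicator_L2 V) \<noteq> 0"
proof -
  obtain S :: "'g op" where S: "\<And>x y. cinner (T x) y = cinner x (S y)"
    using adjoint_operator[OF assms(1)] by metis
  obtain x where "T x \<noteq> 0" using assms(2) by (metis blinfun_eqI blinfun.zero_left)
  then obtain V where V: "V \<in> B" "cinner (T x) (indicator_L2 V) \<noteq> 0" using total by blast
  then have "S (indicator_L2 V) \<noteq> 0" by (auto simp: S)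
  then obtain U where "U \<in> B" "cinner (S (indicator_L2 V)) (indicator_L2 U) \<noteq> 0"
    using total by blast
  then have "cinner (T (indicator_L2 U)) (indicator_L2 V) \<noteq> 0"
    unfolding S by (metis cinner_commute complex_cnj_zero_iff)
  then show ?thesis using that \<open>U \<in> B\<close> V(1) by blast
qed

theorem corollary3p5:
  fixes J :: "('g::{haar_group, second_countable_topology} \<Rightarrow> complex) set"
  assumes "closed_ideal J"
  shows "ideal_of_multiplicity J \<longleftrightarrow> bimodule_of_multiplicity (Bim (annihilator J))"
proof -
  obtain e :: "nat \<Rightarrow> 'g L2" where "parseval_frame e" by (rule parseval_frame_exists)
  then interpret parseval_frame e .
  obtain B :: "'g set set" where B: "\<And>U. U \<in> B \<Longrightarrow> open U" "\<And>U. U \<in> B \<Longrightarrow> \<exists>K. compact K \<and> U \<subseteq> K"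
    and total: "\<And>x. (\<And>U. U \<in> B \<Longrightarrow> cinner x (indicator_L2 U) = 0) \<Longrightarrow> x = 0"
    using total_indicators by metis
  have Bm: "U \<in> sets borel" "emeasure haar U < \<infinity>" if "U \<in> B" for U
    using B[OF that] emeasure_haar_finite_subset_compact by auto
  note bim = Bim_bimodule[OF annihilator_subset_bounded[of J]]
  \<comment> \<open>Multiplicity is stated as \<open>\<noteq> {0}\<close>, which the empty set
    satisfies too; a nonzero element can be extracted only once \<open>0\<close> is known to lie in
    the intersections.\<close>
  have zeros: "0 \<in> annihilator J" "(0 :: 'g op) \<in> reduced_Cstar"
    "0 \<in> Bim (annihilator J)" "(0 :: 'g op) \<in> compact_operators"
  proof -
    have "(0 :: 'g op) \<in> L1_operators"
      unfolding L1_operators_def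
      by (intro CollectI conjI exI[of _ "\<lambda>_. 0"]) (auto simp: bounded_operators_def)
    then show C: "(0 :: 'g op) \<in> reduced_Cstar" using L1_operators_subset by blast
    have "fourier_pairing u 0 = 0" if u: "u \<in> J" for u
    proof -
      obtain a b where "u = coefficient a b"
        using assms u unfolding closed_ideal_def fourier_algebra_def by blast
      then show ?thesis using fourier_pairing_coefficient[of 0 a b] C reduced_Cstar_subset_VN by auto
    qed
    then show "0 \<in> annihilator J" using C reduced_Cstar_subset_VN by (auto simp: annihilator_def)
    then show "0 \<in> Bim (annihilator J)" using bim(3) by blast
    show "(0 :: 'g op) \<in> compact_operators"
      by (auto simp: compact_operators_def bounded_operators_def image_constant_conv)
  qed
  show ?thesis
  proof
    assume "ideal_of_multiplicity J"
    then obtain T where T: "T \<in> annihilator J" "T \<in> reduced_Cstar" "T \<noteq> 0"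
      using zeros(1,2) unfolding ideal_of_multiplicity_def by blast
    \<comment> \<open>The adjoint moves the indicator that is about to shrink into the second
      argument, where pairing with it is integration over its set and dominated convergence
      applies.\<close>
    obtain S :: "'g op" where S: "\<And>x y. cinner (T x) y = cinner x (S y)"
      using adjoint_operator T(2) reduced_Cstar_subset by (metis subsetD)
    obtain U V where U: "U \<in> B" and V: "V \<in> B" and "cinner (T (indicator_L2 U)) (indicator_L2 V) \<noteq> 0"
      using nonzero_matrix_entry[OF _ T(3) total] T(2) reduced_Cstar_subset by (metis subsetD)
    then have UV: "cinner (S (indicator_L2 V)) (indicator_L2 U) \<noteq> 0"
      unfolding S by (metis cinner_commute complex_cnj_zero_iff)
    have [measurable]: "U \<in> sets haar" using Bm[OF U] by (simp add: sets_haar)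
    \<comment> \<open>The part of \<open>U\<close> on which the modular weight is at most
      \<open>m\<close>. These sets exhaust \<open>U\<close>, so the matrix entry is still nonzero
      for some \<open>m\<close>.\<close>
    define A where "A m = {y \<in> U. inverse_density y \<le> real m}" for m :: nat
    have Am: "A m \<in> sets haar" for m
    proof -
      have "A m = U \<inter> {y \<in> space haar. inverse_density y \<le> real m}" by (auto simp: A_def)
      also have "\<dots> \<in> sets haar" by measurable
      finally show ?thesis .
    qed
    then have [measurable]: "A m \<in> sets haar" for m .
    have Ab: "A m \<in> sets borel" "emeasure haar (A m) < \<infinity>" for m
    proof -
      show "A m \<in> sets borel" using Am by (simp add: sets_haar)
      have "emeasure haar (A m) \<le> emeasure haar U"
        by (rule emeasure_mono) (auto simp: A_def)
      then show "emeasure haar (A m) < \<infinity>" using Bm[OF U] le_less_trans by blast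
    qed
    have "(\<lambda>m. cinner (S (indicator_L2 V)) (indicator_L2 (A m))) \<longlonglongrightarrow> cinner (S (indicator_L2 V)) (indicator_L2 U)"
      unfolding cinner_indicator_L2_right(1)[OF Ab] cinner_indicator_L2_right(1)[OF Bm[OF U]]
    proof (rule integral_dominated_convergence[where w = "\<lambda>t. cmod (rep_L2 (S (indicator_L2 V)) t * indicator U t)"])
      show "integrable haar (\<lambda>t. cmod (rep_L2 (S (indicator_L2 V)) t * indicator U t))"
        by (rule integrable_norm[OF cinner_indicator_L2_right(2)[OF Bm[OF U]]])
      show "AE t in haar. (\<lambda>m. rep_L2 (S (indicator_L2 V)) t * indicator (A m) t)
          \<longlonglongrightarrow> rep_L2 (S (indicator_L2 V)) t * indicator U t"
      proof (rule AE_I2)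
        fix t :: 'g
        obtain m0 :: nat where "inverse_density t \<le> real m0" using real_arch_simple by blast
        then have "\<forall>\<^sub>F m in sequentially. indicator (A m) t = (indicator U t :: complex)"
          by (intro eventually_sequentiallyI[of m0]) (auto simp: A_def indicator_def)
        then have "(\<lambda>m. indicator (A m) t) \<longlonglongrightarrow> (indicator U t :: complex)" by (rule tendsto_eventually)
        then show "(\<lambda>m. rep_L2 (S (indicator_L2 V)) t * indicator (A m) t)
          \<longlonglongrightarrow> rep_L2 (S (indicator_L2 V)) t * indicator U t" by (rule tendsto_mult_left)
      qed
    qed (auto simp: A_def indicator_def norm_mult)
    then have "\<forall>\<^sub>F m in sequentially. cinner (S (indicator_L2 V)) (indicator_L2 (A m)) \<noteq> 0"
      using UV by (rule tendsto_imp_eventually_ne)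
    then obtain m where m: "cinner (S (indicator_L2 V)) (indicator_L2 (A m)) \<noteq> 0"
      unfolding eventually_sequentially by blast
    then have ne: "cinner (T (indicator_L2 (A m))) (indicator_L2 V) \<noteq> 0"
      unfolding S by (metis cinner_commute complex_cnj_zero_iff)
    let ?K = "indicator_op V o\<^sub>L T o\<^sub>L indicator_op (A m)"
    \<comment> \<open>The compressions fix the two test vectors, so the nonzero entry of
      \<open>T\<close> is also an entry of the compressed operator.\<close>
    have "cinner (?K (indicator_L2 (A m))) (indicator_L2 V) = cinner (T (indicator_L2 (A m))) (indicator_L2 V)"
      by (simp add: indicator_op_adjoint Bm(1)[OF V] indicator_op_indicator_L2[OF Ab]
          indicator_op_indicator_L2[OF Bm[OF V]])
    with ne have "?K \<noteq> 0" by (metis blinfun.zero_left cinner_zero_left)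
    moreover have "?K \<in> compact_operators"
      by (rule compressed_reduced_Cstar_compact[OF T(2) Bm[OF V] Ab, where m = "real m"]) (simp add: A_def)
    moreover have "?K \<in> Bim (annihilator J)"
    proof -
      have "indicator_op X \<in> multiplication_masa" if "X \<in> sets borel" for X :: "'g set"
        unfolding indicator_op_def using that
        by (intro multiplication_op_in_masa essentially_bounded_indicator)
      then show ?thesis
        using bim(1,3) T(1) Ab Bm[OF V] unfolding masa_bimodule_def by blast
    qed
    ultimately show "bimodule_of_multiplicity (Bim (annihilator J))"
      using bim unfolding bimodule_of_multiplicity_def by blast
  next
    assume "bimodule_of_multiplicity (Bim (annihilator J))"
    then obtain K where K: "K \<in> Bim (annihilator J)" "K \<in> compact_operators" "K \<noteq> 0"
      using zeros(3,4) unfolding bimodule_of_multiplicity_def by blast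
    have Kb: "K \<in> bounded_operators" using K(2) by (simp add: compact_operators_def)
    obtain U V where U: "U \<in> B" and V: "V \<in> B"
      and ne: "cinner (K (indicator_L2 U)) (indicator_L2 V) \<noteq> 0"
      using nonzero_matrix_entry[OF Kb K(3) total] by blast
    \<comment> \<open>\<open>U\<close> and \<open>V\<close> are only relatively compact; the locally
      constant coefficient is built for compact sets around them.\<close>
    obtain C D where CD: "compact C" "U \<subseteq> C" "compact D" "V \<subseteq> D"
      using B(2)[OF U] B(2)[OF V] by metis
    obtain a b :: "'g L2" and c where c: "c \<noteq> 0"
      "\<And>s t. s \<in> D \<Longrightarrow> t \<in> C \<Longrightarrow> cinner (left_translation (s - t) a) b = c"
      using locally_constant_coefficient[OF CD(1,3)] by metis
    let ?E = "averaging_op K (indicator_L2 U) (indicator_L2 V)"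
    \<comment> \<open>Since the multiplier is the constant \<open>c\<close> on the supports, this
      entry of the averaged operator is \<open>c\<close> times a nonzero entry of
      \<open>K\<close>.\<close>
    have "cinner (?E a) b = c * cinner (K (indicator_L2 U)) (indicator_L2 V)"
      unfolding averaging_op(2)[OF Kb]
      by (rule averaging_form_compact_local[OF K(2)
            AE_rep_indicator_L2_outside[OF Bm[OF U]] AE_rep_indicator_L2_outside[OF Bm[OF V]]])
        (use CD c in auto)
    then have "?E \<noteq> 0" using ne c(1) by auto
    moreover have E: "?E \<in> reduced_Cstar" by (rule averaging_op_compact[OF K(2)])
    moreover have "?E \<in> annihilator J"
      unfolding annihilator_def
    proof (intro CollectI conjI ballI)
      show VN: "?E \<in> VN" using E reduced_Cstar_subset_VN by blast
      fix u assume u: "u \<in> J"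
      then obtain p q where pq: "u = coefficient p q"
        using assms unfolding closed_ideal_def fourier_algebra_def by blast
      \<comment> \<open>Pairing with \<open>coefficient p q\<close> is the averaging form of
        \<open>K\<close> at \<open>p\<close>, \<open>q\<close>, which vanishes because
        \<open>K\<close> lies in the bimodule and \<open>u\<close> in \<open>J\<close>.\<close>
      show "fourier_pairing u ?E = 0"
        unfolding pq fourier_pairing_coefficient[OF VN] averaging_op(2)[OF Kb]
        by (rule averaging_form_vanishes_on_Bim[OF assms _ K(1)]) (use u pq in simp)
    qed
    ultimately show "ideal_of_multiplicity J"
      using assms unfolding ideal_of_multiplicity_def by blast
  qed
qed

end
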